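(* Every double spider is strongly antimagic.
   Context: All graphs are finite and simple. For a graph $G=(V,E)$ and a bijection $f:E\to\{1,2,\dots,|E|\}$, the vertex sum at $u$ is $\varphi_f(u)=\sum_{e\in E(u)}f(e)$, where $E(u)$ is the set of edges incident to $u$. The labeling $f$ is strongly antimagic if $\varphi_f(u)\neq\varphi_f(v)$ for all distinct $u,v\in V$ and moreover $\deg(u)<\deg(v)$ implies $\varphi_f(u)<\varphi_f(v)$. A graph is strongly antimagic if it admits a strongly antimagic labeling. A double spider is a tree containing exactly two vertices of degree at least $3$. *)

theory Defs
  imports Main
begin

definition simple_graph :: "'a set \<Rightarrow> 'a set set \<Rightarrow> bool" where
  "simple_graph V E \<longleftrightarrow> finite V \<and> (\<forall>e\<in>E. e \<subseteq> V \<and> card e = 2)"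

definition incident_edges :: "'a set set \<Rightarrow> 'a \<Rightarrow> 'a set set" where
  "incident_edges E u = {e \<in> E. u \<in> e}"

definition degree :: "'a set set \<Rightarrow> 'a \<Rightarrow> nat" where
  "degree E u = card (incident_edges E u)"

definition is_walk :: "'a set set \<Rightarrow> 'a list \<Rightarrow> bool" where
  "is_walk E p \<longleftrightarrow> p \<noteq> [] \<and> (\<forall>i. Suc i < length p \<longrightarrow> {p ! i, p ! Suc i} \<in> E)"

definition connected_graph :: "'a set \<Rightarrow> 'a set set \<Rightarrow> bool" where
  "connected_graph V E \<longleftrightarrow>
     (\<forall>u\<in>V. \<forall>v\<in>V. \<exists>p. is_walk E p \<and> hd p = u \<and> last p = v)"

definition has_cycle :: "'a set set \<Rightarrow> bool" where
  "has_cycle E \<longleftrightarrow> (\<exists>p. is_walk E p \<and> length p \<ge> 4 \<and> hd p = last p \<and> distinct (tl p))"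

definition is_tree :: "'a set \<Rightarrow> 'a set set \<Rightarrow> bool" where
  "is_tree V E \<longleftrightarrow> simple_graph V E \<and> V \<noteq> {} \<and> connected_graph V E \<and> \<not> has_cycle E"

definition double_spider :: "'a set \<Rightarrow> 'a set set \<Rightarrow> bool" where
  "double_spider V E \<longleftrightarrow> is_tree V E \<and> card {v \<in> V. degree E v \<ge> 3} = 2"

definition vertex_sum :: "'a set set \<Rightarrow> ('a set \<Rightarrow> nat) \<Rightarrow> 'a \<Rightarrow> nat" where
  "vertex_sum E f u = (\<Sum>e\<in>incident_edges E u. f e)"

definition strongly_antimagic_labeling ::
  "'a set \<Rightarrow> 'a set set \<Rightarrow> ('a set \<Rightarrow> nat) \<Rightarrow> bool" where
  "strongly_antimagic_labeling V E f \<longleftrightarrow>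
     bij_betw f E {1..card E} \<and>
     (\<forall>u\<in>V. \<forall>v\<in>V. u \<noteq> v \<longrightarrow> vertex_sum E f u \<noteq> vertex_sum E f v) \<and>
     (\<forall>u\<in>V. \<forall>v\<in>V. degree E u < degree E v \<longrightarrow> vertex_sum E f u < vertex_sum E f v)"

definition strongly_antimagic :: "'a set \<Rightarrow> 'a set set \<Rightarrow> bool" where
  "strongly_antimagic V E \<longleftrightarrow> (\<exists>f. strongly_antimagic_labeling V E f)"

end

theory Submission
  imports Defs "HOL-Library.Multiset"
begin

text \<open>
  Let the centres \<open>a\<close> and \<open>b\<close> be joined by the core, with at least as many legs at \<open>b\<close> as at \<open>a\<close>. The labels are
  divided into levels in such a way that every vertex of degree two joins labels of two prescribed levels and
  every pendant edge has a low label; then each pendant label is smaller than each sum at a vertex of degree two.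
  A new leg receives fresh labels at the bottom of the levels, and the old labels of one level are all shifted by
  the same amount. So the sums at the old vertices of degree two stay distinct, the sums at the new ones are
  consecutive numbers below them, and the change of the sums at \<open>a\<close> and \<open>b\<close> depends only on the number of labels
  of each level at these vertices. Counting them shows that the sum at \<open>a\<close> stays above all sums at vertices of
  degree two and below the sum at \<open>b\<close>. Starting from a core with at most five legs, depending on the parities of
  the lengths, all double spiders are built in this way, apart from two which are labelled explicitly. If
  \<open>a\<close> and \<open>b\<close> have equally many legs, their roles may have to be exchanged.
\<close>

section \<open>Paths labelled on four levels\<close>

text \<open>Since a leaf must get a low label and low and high labels alternate, parity decides what
  a centre receives: an even leg brings it a high label, an odd leg a low one, unless a top label is
  appended; this is what the fourth level is for. An insertion raises a centre sum by the number of
  its labels above each insertion point, so comparing the two centre sums becomes a matter of linear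
  inequalities between counts. The obstacle is an even leg at \<open>a\<close> when only a pendant
  edge is left at \<open>b\<close> to go with it: \<open>a\<close> would gain a high label and
  \<open>b\<close> none. From length 4 on, the leg is led over a top label back to the second level,
  so that it ends low as well; length 2 leaves no room for this detour, hence the separate last
  stage with \<open>wide_labels\<close>. Two sets of bounds are carried along:
  \<open>even_bounds\<close> admits even legs at \<open>a\<close> freely but wants a surplus of legs
  at \<open>b\<close>, while \<open>odd_bounds\<close> admits equally many legs and adds an even leg
  at \<open>a\<close> only together with an even leg at \<open>b\<close>.\<close>

definition adj :: "nat list \<Rightarrow> nat list" where
  "adj xs = map (\<lambda>(x, y). x + y) (zip xs (tl xs))"

fun alt :: "nat \<Rightarrow> nat \<Rightarrow> nat \<Rightarrow> nat list" where
  "alt x y 0 = []"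
| "alt x y (Suc n) = x # alt y (Suc x) n"

lemma adj_simps [simp]: "adj [] = []" "adj [x] = []" "adj (x # y # zs) = (x + y) # adj (y # zs)"
  by (simp_all add: adj_def)

lemma length_alt [simp]: "length (alt x y n) = n"
  by (induction x y n rule: alt.induct) auto

lemma alt_eq_Nil_iff [simp]: "alt x y n = [] \<longleftrightarrow> n = 0"
  by (cases n) auto

lemma hd_alt [simp]: "n > 0 \<Longrightarrow> hd (alt x y n) = x"
  by (cases n) auto

lemma last_alt: "n > 0 \<Longrightarrow> last (alt x y n) = (if odd n then x + n div 2 else y + n div 2 - 1)"
proof (induction x y n rule: alt.induct)
  case (2 x y n)
  then show ?case by (cases n) (auto elim!: evenE oddE)
qed simp

lemma set_alt: "set (alt x y n) = {x..<x + Suc n div 2} \<union> {y..<y + n div 2}"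
proof (induction x y n rule: alt.induct)
  case (2 x y n)
  have "{x..<x + Suc (Suc n) div 2} = insert x {Suc x..<Suc x + n div 2}" by auto
  then show ?case using 2 by auto
qed simp

lemma distinct_alt: "x + Suc n div 2 \<le> y \<or> y + n div 2 \<le> x \<Longrightarrow> distinct (alt x y n)"
proof (induction x y n rule: alt.induct)
  case (2 x y n)
  have "y + Suc n div 2 \<le> Suc x \<or> Suc x + n div 2 \<le> y" using "2.prems" by auto
  then show ?case using 2 by (auto simp: set_alt)
qed simp

text \<open>From one adjacent pair to the next, only one of the two alternating values grows, and by
  1; hence the sums are consecutive whatever \<open>x\<close> and \<open>y\<close> are.\<close>

lemma adj_alt: "adj (alt x y n) = [x + y..<x + y + (n - 1)]"
proof (induction x y n rule: alt.induct)
  case (2 x y n)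
  show ?case
  proof (cases n)
    case (Suc k)
    have "adj (alt x y (Suc n)) = (x + y) # adj (alt y (Suc x) n)" using Suc by simp
    also have "\<dots> = [x + y..<x + y + (Suc n - 1)]"
      unfolding 2 using Suc by (simp add: upt_conv_Cons add.commute del: upt_Suc)
    finally show ?thesis .
  qed simp
qed simp

lemma prs_alt: "(u, v) \<in> set (zip (alt x y n) (tl (alt x y n))) \<Longrightarrow>
   (u \<in> {x..<x + Suc n div 2} \<and> v \<in> {y..<y + n div 2}) \<or>
   (v \<in> {x..<x + Suc n div 2} \<and> u \<in> {y..<y + n div 2})"
proof (induction x y n arbitrary: u v rule: alt.induct)
  case (2 x y n)
  show ?case
  proof (cases n)
    case (Suc k)
    with "2.prems" consider "u = x" "v = y" | "(u, v) \<in> set (zip (alt y (Suc x) n) (tl (alt y (Suc x) n)))"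
      by auto
    then show ?thesis
    proof cases
      case 1 then show ?thesis using Suc by auto
    next
      case 2
      from "2.IH"[OF this] show ?thesis by auto
    qed
  qed (use 2 in auto)
qed simp

declare alt.simps(2) [simp del]

text \<open>The labels up to \<open>\<sigma>\<close>, \<open>\<tau>\<close>, \<open>\<rho>\<close> and above \<open>\<rho>\<close> form four levels. Two consecutive labels are a first
  level label and a third level one, or a top label and a third level one that is at most \<open>l\<close> (so \<open>l = 0\<close>
  forbids this); \<open>z\<close> allows in addition a second level label next to a top label. The sums of the three
  kinds lie in disjoint intervals.\<close>

definition level_pair :: "nat \<Rightarrow> nat \<Rightarrow> nat \<Rightarrow> nat \<Rightarrow> bool \<Rightarrow> nat \<Rightarrow> nat \<Rightarrow> bool" where
  "level_pair \<sigma> \<tau> \<rho> l z x y \<longleftrightarrow>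
     x \<le> \<sigma> \<and> \<tau> < y \<and> y \<le> \<rho> \<or>
     z \<and> \<sigma> < x \<and> x \<le> \<tau> \<and> \<rho> < y \<and> x + y \<le> \<tau> + \<rho> \<or>
     \<tau> < x \<and> x \<le> \<rho> \<and> x \<le> l \<and> \<rho> < y"

definition level_path :: "nat \<Rightarrow> nat \<Rightarrow> nat \<Rightarrow> nat \<Rightarrow> bool \<Rightarrow> nat list \<Rightarrow> bool" where
  "level_path \<sigma> \<tau> \<rho> l z xs \<longleftrightarrow>
     (\<forall>(x, y) \<in> set (zip xs (tl xs)). level_pair \<sigma> \<tau> \<rho> l z x y \<or> level_pair \<sigma> \<tau> \<rho> l z y x)"

text \<open>Only the sums at vertices of degree two are controlled here. The sums at the two centres
  are followed separately, by \<open>prof\<close>.\<close>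

definition levelled :: "nat list list \<Rightarrow> nat \<Rightarrow> nat \<Rightarrow> nat \<Rightarrow> nat \<Rightarrow> nat \<Rightarrow> bool \<Rightarrow> bool" where
  "levelled Ps \<sigma> \<tau> \<rho> m l z \<longleftrightarrow> \<sigma> \<le> \<tau> \<and> \<tau> \<le> \<rho> \<and> \<rho> \<le> m \<and>
     distinct (concat Ps) \<and> set (concat Ps) = {1..m} \<and>
     (\<forall>xs\<in>set Ps. level_path \<sigma> \<tau> \<rho> l z xs) \<and> distinct (concat (map adj Ps))"

text \<open>Room is made for \<open>c\<close>, \<open>w\<close>, \<open>e\<close>, \<open>d\<close>, \<open>t\<close> new labels: at the bottom of the four levels, except for the \<open>e\<close>
  labels, which go to the top of the second level.\<close>

definition shift :: "nat \<Rightarrow> nat \<Rightarrow> nat \<Rightarrow> nat \<Rightarrow> nat \<Rightarrow> nat \<Rightarrow> nat \<Rightarrow> nat \<Rightarrow> nat \<Rightarrow> nat" where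
  "shift \<sigma> \<tau> \<rho> c w e d t x =
     (if x \<le> \<sigma> then x + c else if x \<le> \<tau> then x + c + w else if x \<le> \<rho> then x + c + w + e + d
      else x + c + w + e + d + t)"

definition fresh :: "nat \<Rightarrow> nat \<Rightarrow> nat \<Rightarrow> nat \<Rightarrow> nat \<Rightarrow> nat \<Rightarrow> nat \<Rightarrow> nat \<Rightarrow> nat set" where
  "fresh \<sigma> \<tau> \<rho> c w e d t = {1..c} \<union> {\<sigma> + c + 1..\<sigma> + c + w} \<union> {\<tau> + c + w + 1..\<tau> + c + w + e} \<union>
     {\<tau> + c + w + e + 1..\<tau> + c + w + e + d} \<union> {\<rho> + c + w + e + d + 1..\<rho> + c + w + e + d + t}"

lemma shift_mono: "x < y \<Longrightarrow> shift \<sigma> \<tau> \<rho> c w e d t x < shift \<sigma> \<tau> \<rho> c w e d t y"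
  by (simp add: shift_def)

lemma shift_inj: "inj (shift \<sigma> \<tau> \<rho> c w e d t)"
  by (rule linorder_injI) (metis shift_mono less_irrefl)

lemma shift_image:
  assumes "\<sigma> \<le> \<tau>" "\<tau> \<le> \<rho>" "\<rho> \<le> m"
  shows "shift \<sigma> \<tau> \<rho> c w e d t ` {1..m} = {1..m + c + w + e + d + t} - fresh \<sigma> \<tau> \<rho> c w e d t" (is "?l = ?r")
proof -
  have *: "(\<lambda>x. x + k) ` {i..j} = {i + k..j + k}" for i j k :: nat by simp
  have "{1..m} = {1..\<sigma>} \<union> {Suc \<sigma>..\<tau>} \<union> {Suc \<tau>..\<rho>} \<union> {Suc \<rho>..m}" using assms by auto
  moreover have "shift \<sigma> \<tau> \<rho> c w e d t ` {1..\<sigma>} = (\<lambda>x. x + c) ` {1..\<sigma>}"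
    by (intro image_cong) (auto simp: shift_def)
  moreover have "shift \<sigma> \<tau> \<rho> c w e d t ` {Suc \<sigma>..\<tau>} = (\<lambda>x. x + (c + w)) ` {Suc \<sigma>..\<tau>}"
    by (intro image_cong) (auto simp: shift_def)
  moreover have "shift \<sigma> \<tau> \<rho> c w e d t ` {Suc \<tau>..\<rho>} = (\<lambda>x. x + (c + w + e + d)) ` {Suc \<tau>..\<rho>}"
    using assms by (intro image_cong) (auto simp: shift_def)
  moreover have "shift \<sigma> \<tau> \<rho> c w e d t ` {Suc \<rho>..m} = (\<lambda>x. x + (c + w + e + d + t)) ` {Suc \<rho>..m}"
    using assms by (intro image_cong) (auto simp: shift_def)
  ultimately have l: "?l = {1 + c..\<sigma> + c} \<union> {Suc \<sigma> + (c + w)..\<tau> + (c + w)} \<union>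
      {Suc \<tau> + (c + w + e + d)..\<rho> + (c + w + e + d)} \<union> {Suc \<rho> + (c + w + e + d + t)..m + (c + w + e + d + t)}"
    by (simp only: * image_Un)
  have "y \<in> ?l \<longleftrightarrow> y \<in> ?r" for y
  proof -
    have r: "y \<in> ?r \<longleftrightarrow> 1 \<le> y \<and> y \<le> m + c + w + e + d + t \<and> \<not> y \<le> c \<and> \<not> (\<sigma> + c < y \<and> y \<le> \<sigma> + c + w) \<and>
      \<not> (\<tau> + c + w < y \<and> y \<le> \<tau> + c + w + e + d) \<and>
      \<not> (\<rho> + c + w + e + d < y \<and> y \<le> \<rho> + c + w + e + d + t)"
      unfolding fresh_def by auto
    show ?thesis unfolding l r Un_iff atLeastAtMost_iff using assms by linarith
  qed
  then show ?thesis by blast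
qed

text \<open>A second-level and a top label together rise by
  \<open>2 * c + 2 * w + e + d + t\<close>, the bound \<open>\<tau> + \<rho>\<close> by
  \<open>2 * c + 2 * w + 2 * e + d\<close>; so \<open>t \<le> e\<close> is what the \<open>z\<close>
  case needs. The bound \<open>l\<close> has to move with the third level.\<close>

lemma level_pair_sh:
  assumes "level_pair \<sigma> \<tau> \<rho> l z x y" "\<sigma> \<le> \<tau>" "\<tau> \<le> \<rho>" "z \<Longrightarrow> t \<le> e" "z \<Longrightarrow> z'"
    and "l > 0 \<Longrightarrow> l + c + w + e + d \<le> l'"
  shows "level_pair (\<sigma> + c) (\<tau> + c + w + e) (\<rho> + c + w + e + d) l' z' (shift \<sigma> \<tau> \<rho> c w e d t x) (shift \<sigma> \<tau> \<rho> c w e d t y)"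
  using assms unfolding level_pair_def shift_def by (auto split: if_splits)

text \<open>The thresholds \<open>\<sigma> + \<rho>\<close> and \<open>\<tau> + \<rho>\<close>
  separate the three kinds of pairs, so a sum alone determines how far its two labels move.\<close>

definition shift_sum :: "nat \<Rightarrow> nat \<Rightarrow> nat \<Rightarrow> nat \<Rightarrow> nat \<Rightarrow> nat \<Rightarrow> nat \<Rightarrow> nat \<Rightarrow> nat \<Rightarrow> nat" where
  "shift_sum \<sigma> \<tau> \<rho> c w e d t s =
     (if s \<le> \<sigma> + \<rho> then s + (2 * c + w + e + d) else if s \<le> \<tau> + \<rho> then s + (2 * c + 2 * w + e + d + t)
      else s + (2 * c + 2 * w + 2 * e + 2 * d + t))"

lemma shift_sum_inj: "\<sigma> \<le> \<tau> \<Longrightarrow> inj (shift_sum \<sigma> \<tau> \<rho> c w e d t)"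
  by (rule linorder_injI) (simp add: shift_sum_def)

lemma shift_add:
  assumes "level_pair \<sigma> \<tau> \<rho> l z x y \<or> level_pair \<sigma> \<tau> \<rho> l z y x" "\<sigma> \<le> \<tau>" "\<tau> \<le> \<rho>"
  shows "shift \<sigma> \<tau> \<rho> c w e d t x + shift \<sigma> \<tau> \<rho> c w e d t y = shift_sum \<sigma> \<tau> \<rho> c w e d t (x + y)"
  using assms unfolding level_pair_def shift_def shift_sum_def by (auto split: if_splits)

lemma adj_sh:
  assumes "level_path \<sigma> \<tau> \<rho> l z xs" "\<sigma> \<le> \<tau>" "\<tau> \<le> \<rho>"
  shows "adj (map (shift \<sigma> \<tau> \<rho> c w e d t) xs) = map (shift_sum \<sigma> \<tau> \<rho> c w e d t) (adj xs)"
proof -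
  have "adj (map (shift \<sigma> \<tau> \<rho> c w e d t) xs)
      = map (\<lambda>(x, y). shift \<sigma> \<tau> \<rho> c w e d t x + shift \<sigma> \<tau> \<rho> c w e d t y) (zip xs (tl xs))"
    by (simp add: adj_def map_tl[symmetric] zip_map_map split_def)
  also have "\<dots> = map (shift_sum \<sigma> \<tau> \<rho> c w e d t) (adj xs)"
    using assms shift_add by (fastforce simp: adj_def level_path_def)
  finally show ?thesis .
qed

text \<open>The level of a sum of two adjacent labels can be read off from its size, so a sum of two fresh
  labels can only collide with a sum of the same kind, and those all lie above it.\<close>

lemma level_pair_freshE:
  assumes "level_pair (\<sigma> + c) (\<tau> + c + w + e) (\<rho> + c + w + e + d) l' z' u v"
    and "u \<in> fresh \<sigma> \<tau> \<rho> c w e d t" "v \<in> fresh \<sigma> \<tau> \<rho> c w e d t" "\<sigma> \<le> \<tau>" "\<tau> \<le> \<rho>"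
    and "u \<notin> {\<tau> + c + w + 1..\<tau> + c + w + e}"
  obtains "u \<le> c" "v \<le> \<tau> + c + w + e + d"
  | "\<sigma> + c < u" "u \<le> \<sigma> + c + w" "\<rho> + c + w + e + d < v" "v \<le> \<rho> + c + w + e + d + t"
      "u + v \<le> (\<tau> + c + w + e) + (\<rho> + c + w + e + d)"
  | "\<tau> + c + w + e < u" "u \<le> \<tau> + c + w + e + d" "\<rho> + c + w + e + d < v" "v \<le> \<rho> + c + w + e + d + t"
proof -
  consider "u \<le> \<sigma> + c" "\<tau> + c + w + e < v" "v \<le> \<rho> + c + w + e + d"
    | "\<sigma> + c < u" "u \<le> \<tau> + c + w + e" "\<rho> + c + w + e + d < v"
      "u + v \<le> (\<tau> + c + w + e) + (\<rho> + c + w + e + d)"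
    | "\<tau> + c + w + e < u" "u \<le> \<rho> + c + w + e + d" "\<rho> + c + w + e + d < v"
    using assms(1) by (auto simp: level_pair_def)
  then show thesis
  proof cases
    case 1
    have "u \<le> c" using 1(1) assms(2,4,5,6) by (auto simp: fresh_def)
    moreover have "v \<le> \<tau> + c + w + e + d" using 1(2,3) assms(3,4) by (auto simp: fresh_def)
    ultimately show thesis by (rule that(1))
  next
    case 2
    have "v \<le> \<rho> + c + w + e + d + t" using 2(3) assms(3,4,5) by (auto simp: fresh_def)
    moreover have "u \<le> \<sigma> + c + w" using 2(1,2) assms(2,4,5,6) by (auto simp: fresh_def)
    ultimately show thesis using 2 by (intro that(2)) auto
  next
    case 3
    have "u \<le> \<tau> + c + w + e + d" using 3(1,2) assms(2,4) by (auto simp: fresh_def)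
    moreover have "v \<le> \<rho> + c + w + e + d + t" using 3(3) assms(3,4,5) by (auto simp: fresh_def)
    ultimately show thesis using 3 by (intro that(3)) auto
  qed
qed

text \<open>The counterpart of \<open>level_pair_freshE\<close> for old pairs: each bound from below
  exceeds the largest sum of two fresh labels of the same kind. The summand 2 comes from
  \<open>x \<ge> 1\<close> and \<open>y \<ge> \<tau> + 1\<close>.\<close>

lemma level_pair_sum_shs:
  assumes "level_pair \<sigma> \<tau> \<rho> l z x y" "\<sigma> \<le> \<tau>" "\<tau> \<le> \<rho>" "x > 0" "z \<Longrightarrow> t \<le> e"
  obtains "\<tau> + 2 * c + w + e + d + 2 \<le> shift_sum \<sigma> \<tau> \<rho> c w e d t (x + y)"
      "shift_sum \<sigma> \<tau> \<rho> c w e d t (x + y) \<le> (\<sigma> + c) + (\<rho> + c + w + e + d)"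
  | "(\<sigma> + c + w) + (\<rho> + c + w + e + d + t) < shift_sum \<sigma> \<tau> \<rho> c w e d t (x + y)"
      "shift_sum \<sigma> \<tau> \<rho> c w e d t (x + y) \<le> (\<tau> + c + w + e) + (\<rho> + c + w + e + d)"
  | "(\<tau> + c + w + e + d) + (\<rho> + c + w + e + d + t) < shift_sum \<sigma> \<tau> \<rho> c w e d t (x + y)"
  using assms unfolding level_pair_def shift_sum_def by (auto split: if_splits)

lemma fresh_sum_neq:
  assumes "level_pair \<sigma> \<tau> \<rho> l z x y" "\<sigma> \<le> \<tau>" "\<tau> \<le> \<rho>" "x > 0" "z \<Longrightarrow> t \<le> e"
    and "level_pair (\<sigma> + c) (\<tau> + c + w + e) (\<rho> + c + w + e + d) l' z' u v"
    and "u \<in> fresh \<sigma> \<tau> \<rho> c w e d t" "v \<in> fresh \<sigma> \<tau> \<rho> c w e d t"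
    and "u \<notin> {\<tau> + c + w + 1..\<tau> + c + w + e}"
  shows "u + v \<noteq> shift_sum \<sigma> \<tau> \<rho> c w e d t (x + y)"
  by (rule level_pair_sum_shs[OF assms(1-5), where c=c and w=w and d=d];
      rule level_pair_freshE[OF assms(6,7,8,2,3,9)]; use assms(2,3) in linarith)

lemma set_adj: "s \<in> set (adj xs) \<longleftrightarrow> (\<exists>(x, y) \<in> set (zip xs (tl xs)). s = x + y)"
  by (auto simp: adj_def)

lemma zip_tl_subset: "(x, y) \<in> set (zip xs (tl xs)) \<Longrightarrow> x \<in> set xs \<and> y \<in> set xs"
  by (metis list.sel(2) list.set_sel(2) set_zip_leftD set_zip_rightD)

text \<open>The step behind every operation on the four levels: \<open>N\<close> holds the new
  paths, on exactly the fresh labels. The block on top of the second level lies above the old labels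
  of that level, so a sum involving it need not stay below the old sums; it is therefore reserved
  for pendant edges, which create no adjacent pair.\<close>

lemma levelled_insert:
  assumes levelled: "levelled Ps \<sigma> \<tau> \<rho> m l z" and z: "z \<Longrightarrow> t \<le> e" "z \<Longrightarrow> z'"
    and l: "l > 0 \<Longrightarrow> l + c + w + e + d \<le> l'"
    and N: "distinct (concat N)" "set (concat N) = fresh \<sigma> \<tau> \<rho> c w e d t" "distinct (concat (map adj N))"
      "\<And>xs. xs \<in> set N \<Longrightarrow> level_path (\<sigma> + c) (\<tau> + c + w + e) (\<rho> + c + w + e + d) l' z' xs"
      "\<And>xs. xs \<in> set N \<Longrightarrow> length xs > 1 \<Longrightarrow> set xs \<inter> {\<tau> + c + w + 1..\<tau> + c + w + e} = {}"
    and Q: "mset Q = mset N + mset (map (map (shift \<sigma> \<tau> \<rho> c w e d t)) Ps)"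
  shows "levelled Q (\<sigma> + c) (\<tau> + c + w + e) (\<rho> + c + w + e + d) (m + c + w + e + d + t) l' z'"
proof -
  let ?g = "shift \<sigma> \<tau> \<rho> c w e d t" and ?G = "shift_sum \<sigma> \<tau> \<rho> c w e d t"
  have ord: "\<sigma> \<le> \<tau>" "\<tau> \<le> \<rho>" "\<rho> \<le> m" and dist: "distinct (concat Ps)" and set: "set (concat Ps) = {1..m}"
    and ok: "\<And>xs. xs \<in> set Ps \<Longrightarrow> level_path \<sigma> \<tau> \<rho> l z xs" and adj: "distinct (concat (map adj Ps))"
    using levelled by (auto simp: levelled_def)
  let ?Q = "N @ map (map ?g) Ps"
  have mQ: "mset Q = mset ?Q" using Q by simp
  have setQ: "set Q = set ?Q" using mQ by (metis set_mset_mset)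
  have fresh_le: "fresh \<sigma> \<tau> \<rho> c w e d t \<subseteq> {1..m + c + w + e + d + t}"
    using ord by (auto simp: fresh_def)
  have cg: "concat (map (map ?g) Ps) = map ?g (concat Ps)" by (simp add: map_concat)
  have im: "?g ` set (concat Ps) = {1..m + c + w + e + d + t} - fresh \<sigma> \<tau> \<rho> c w e d t"
    unfolding set by (rule shift_image[OF ord])
  have c1: "distinct (concat ?Q)" "set (concat ?Q) = {1..m + c + w + e + d + t}"
    using N(1,2) dist im fresh_le shift_inj cg
    by (simp_all add: distinct_map inj_on_subset[OF _ subset_UNIV] set_map del: set_concat) blast+
  have adjg: "concat (map adj (map (map ?g) Ps)) = map ?G (concat (map adj Ps))"
    using adj_sh[OF ok ord(1,2)] by (simp add: map_concat o_def cong: map_cong)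
  have "set (concat (map adj N)) \<inter> set (concat (map adj (map (map ?g) Ps))) = {}"
  proof (rule ccontr)
    assume "\<not> ?thesis"
    then obtain s s' where s: "s \<in> set (concat (map adj N))" "s' \<in> set (concat (map adj Ps))" "s = ?G s'"
      unfolding adjg by auto
    then obtain xs ys where xs: "xs \<in> set N" "s \<in> set (adj xs)" and ys: "ys \<in> set Ps" "s' \<in> set (adj ys)"
      by auto
    obtain u v where uv: "(u, v) \<in> set (zip xs (tl xs))" "s = u + v" using xs(2) by (auto simp: set_adj)
    obtain x y where xy: "(x, y) \<in> set (zip ys (tl ys))" "s' = x + y" using ys(2) by (auto simp: set_adj)
    have "x \<in> set (concat Ps)" "y \<in> set (concat Ps)" "u \<in> set (concat N)" "v \<in> set (concat N)"
      using zip_tl_subset[OF xy(1)] zip_tl_subset[OF uv(1)] xs(1) ys(1) by auto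
    then have "x > 0" "y > 0" "u \<in> fresh \<sigma> \<tau> \<rho> c w e d t" "v \<in> fresh \<sigma> \<tau> \<rho> c w e d t"
      unfolding set N(2) by auto
    moreover have "level_pair \<sigma> \<tau> \<rho> l z x y \<or> level_pair \<sigma> \<tau> \<rho> l z y x"
      using ok[OF ys(1)] xy(1) by (auto simp: level_path_def)
    moreover have "level_pair (\<sigma> + c) (\<tau> + c + w + e) (\<rho> + c + w + e + d) l' z' u v \<or>
         level_pair (\<sigma> + c) (\<tau> + c + w + e) (\<rho> + c + w + e + d) l' z' v u"
      using N(4)[OF xs(1)] uv(1) by (auto simp: level_path_def)
    moreover have "length xs > 1" using uv(1) by (cases xs; cases "tl xs") auto
    then have "u \<notin> {\<tau> + c + w + 1..\<tau> + c + w + e}" "v \<notin> {\<tau> + c + w + 1..\<tau> + c + w + e}"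
      using N(5)[OF xs(1)] zip_tl_subset[OF uv(1)] by blast+
    ultimately have "u + v \<noteq> ?G (x + y)"
      using fresh_sum_neq[OF _ ord(1,2) _ z(1)] by (metis add.commute)
    then show False using s uv xy by simp
  qed
  then have c2: "distinct (concat (map adj ?Q))"
    using N(3) adj unfolding map_append concat_append distinct_append adjg
    by (simp add: distinct_map inj_on_subset[OF shift_sum_inj[OF ord(1)] subset_UNIV] del: set_concat)
  have c3: "level_path (\<sigma> + c) (\<tau> + c + w + e) (\<rho> + c + w + e + d) l' z' xs" if "xs \<in> set ?Q" for xs
  proof (cases "xs \<in> set N")
    case False
    then obtain ys where ys: "ys \<in> set Ps" "xs = map ?g ys" using \<open>xs \<in> set ?Q\<close> by auto
    show ?thesis unfolding level_path_def
    proof clarify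
      fix u v assume "(u, v) \<in> set (zip xs (tl xs))"
        and n: "\<not> level_pair (\<sigma> + c) (\<tau> + c + w + e) (\<rho> + c + w + e + d) l' z' v u"
      then obtain x y where "(x, y) \<in> set (zip ys (tl ys))" "u = ?g x" "v = ?g y"
        unfolding ys(2) by (auto simp: map_tl[symmetric] zip_map_map)
      then have "level_pair \<sigma> \<tau> \<rho> l z x y \<or> level_pair \<sigma> \<tau> \<rho> l z y x" using ok[OF ys(1)] by (auto simp: level_path_def)
      then show "level_pair (\<sigma> + c) (\<tau> + c + w + e) (\<rho> + c + w + e + d) l' z' u v"
        using level_pair_sh[OF _ ord(1,2) z l] n \<open>u = ?g x\<close> \<open>v = ?g y\<close> by blast
    qed
  qed (use N(4) in auto)
  have p1: "mset (concat Q) = mset (concat ?Q)"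
    by (simp only: mset_concat sum_mset_sum_list[symmetric] mset_map mQ)
  have p2: "mset (concat (map adj Q)) = mset (concat (map adj ?Q))"
    by (simp only: mset_concat sum_mset_sum_list[symmetric] mset_map mQ)
  show ?thesis
    unfolding levelled_def using ord c1 c2 c3 setQ p1 p2
    by (smt (verit, best) add_le_mono1 le_add1 order_trans mset_eq_imp_distinct_iff set_mset_mset)
qed

section \<open>Legs, core and branch sums\<close>

lemma zip_tl_snoc: "zip (xs @ [x, y]) (tl (xs @ [x, y])) = zip (xs @ [x]) (tl (xs @ [x])) @ [(x, y)]"
proof (induction xs)
  case (Cons a xs)
  then show ?case by (cases xs) auto
qed simp

lemma zip_tl_rev: "zip (rev xs) (tl (rev xs)) = rev (map prod.swap (zip xs (tl xs)))"
proof (induction xs)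
  case (Cons x xs)
  show ?case
  proof (cases xs)
    case (Cons y ys)
    then show ?thesis using Cons.IH zip_tl_snoc[of "rev ys" y x] by simp
  qed simp
qed simp

lemma adj_rev: "adj (rev xs) = rev (adj xs)"
  by (simp add: adj_def zip_tl_rev rev_map o_def split_def add.commute)

lemma level_path_rev [simp]: "level_path \<sigma> \<tau> \<rho> l z (rev xs) \<longleftrightarrow> level_path \<sigma> \<tau> \<rho> l z xs"
  by (auto simp: level_path_def zip_tl_rev)

lemma adj_snoc: "xs \<noteq> [] \<Longrightarrow> adj (xs @ [y]) = adj xs @ [last xs + y]"
  by (cases xs rule: rev_cases) (simp_all add: adj_def zip_tl_snoc)

lemma level_path_snoc: "xs \<noteq> [] \<Longrightarrow> level_path \<sigma> \<tau> \<rho> l z (xs @ [y]) \<longleftrightarrow>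
   level_path \<sigma> \<tau> \<rho> l z xs \<and> (level_pair \<sigma> \<tau> \<rho> l z (last xs) y \<or> level_pair \<sigma> \<tau> \<rho> l z y (last xs))"
  by (cases xs rule: rev_cases) (auto simp: level_path_def zip_tl_snoc)

lemma level_path_single [simp]: "level_path \<sigma> \<tau> \<rho> l z [x]" "level_path \<sigma> \<tau> \<rho> l z []"
  by (simp_all add: level_path_def)

lemma okpI: "x \<le> \<sigma> \<Longrightarrow> \<tau> < y \<Longrightarrow> y \<le> \<rho> \<Longrightarrow> level_pair \<sigma> \<tau> \<rho> l z x y"
  by (simp add: level_pair_def)

lemma level_path_alt:
  assumes "x + Suc n div 2 \<le> Suc \<sigma> \<and> \<tau> < y \<and> y + n div 2 \<le> Suc \<rho> \<or>
    \<tau> < x \<and> x + Suc n div 2 \<le> Suc \<rho> \<and> y + n div 2 \<le> Suc \<sigma>"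
  shows "level_path \<sigma> \<tau> \<rho> l z (alt x y n)"
proof -
  have "level_pair \<sigma> \<tau> \<rho> l z u v \<or> level_pair \<sigma> \<tau> \<rho> l z v u" if "(u, v) \<in> set (zip (alt x y n) (tl (alt x y n)))" for u v
    using prs_alt[OF that] assms
  proof (elim disjE, goal_cases)
    case 1 then have "level_pair \<sigma> \<tau> \<rho> l z u v" by (intro okpI) auto then show ?case ..
  next
    case 2 then have "level_pair \<sigma> \<tau> \<rho> l z v u" by (intro okpI) auto then show ?case ..
  next
    case 3 then have "level_pair \<sigma> \<tau> \<rho> l z v u" by (intro okpI) auto then show ?case ..
  next
    case 4 then have "level_pair \<sigma> \<tau> \<rho> l z u v" by (intro okpI) auto then show ?case ..
  qed
  then show ?thesis by (auto simp: level_path_def)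
qed

type_synonym profile = "nat \<times> nat \<times> nat \<times> nat \<times> nat"

definition prof :: "nat \<Rightarrow> nat \<Rightarrow> nat \<Rightarrow> nat list \<Rightarrow> profile" where
  "prof \<sigma> \<tau> \<rho> xs =
     (length (filter (\<lambda>x. x \<le> \<sigma>) xs), length (filter (\<lambda>x. \<sigma> < x \<and> x \<le> \<tau>) xs),
      length (filter (\<lambda>x. \<tau> < x \<and> x \<le> \<rho>) xs), length (filter (\<lambda>x. \<rho> < x) xs), sum_list xs)"

fun profile_shift :: "nat \<Rightarrow> nat \<Rightarrow> nat \<Rightarrow> nat \<Rightarrow> nat \<Rightarrow> profile \<Rightarrow> profile" where
  "profile_shift c w e d t (n0, n1, n2, n3, f) =
     (n0, n1, n2, n3, f + c * n0 + (c + w) * n1 + (c + w + e + d) * n2 + (c + w + e + d + t) * n3)"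

fun profile_add :: "profile \<Rightarrow> profile \<Rightarrow> profile" where
  "profile_add (n0, n1, n2, n3, f) (k0, k1, k2, k3, g) = (n0 + k0, n1 + k1, n2 + k2, n3 + k3, f + g)"

lemma prof_Cons:
  assumes "\<sigma> \<le> \<tau>" "\<tau> \<le> \<rho>"
  shows "x \<le> \<sigma> \<Longrightarrow> prof \<sigma> \<tau> \<rho> (x # xs) = profile_add (1, 0, 0, 0, x) (prof \<sigma> \<tau> \<rho> xs)"
    "\<sigma> < x \<Longrightarrow> x \<le> \<tau> \<Longrightarrow> prof \<sigma> \<tau> \<rho> (x # xs) = profile_add (0, 1, 0, 0, x) (prof \<sigma> \<tau> \<rho> xs)"
    "\<tau> < x \<Longrightarrow> x \<le> \<rho> \<Longrightarrow> prof \<sigma> \<tau> \<rho> (x # xs) = profile_add (0, 0, 1, 0, x) (prof \<sigma> \<tau> \<rho> xs)"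
    "\<rho> < x \<Longrightarrow> prof \<sigma> \<tau> \<rho> (x # xs) = profile_add (0, 0, 0, 1, x) (prof \<sigma> \<tau> \<rho> xs)"
  using assms by (simp_all add: prof_def)

lemma prof_Nil [simp]: "prof \<sigma> \<tau> \<rho> [] = (0, 0, 0, 0, 0)"
  by (simp add: prof_def)

lemma profile_shift_padd: "profile_shift c w e d t (profile_add P Q) = profile_add (profile_shift c w e d t P) (profile_shift c w e d t Q)"
  by (cases P; cases Q) (simp add: algebra_simps)

lemma prof_sh:
  assumes "\<sigma> \<le> \<tau>" "\<tau> \<le> \<rho>"
  shows "prof (\<sigma> + c) (\<tau> + c + w + e) (\<rho> + c + w + e + d) (map (shift \<sigma> \<tau> \<rho> c w e d t) xs) = profile_shift c w e d t (prof \<sigma> \<tau> \<rho> xs)"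
proof (induction xs)
  case (Cons x xs)
  have ord: "\<sigma> + c \<le> \<tau> + c + w + e" "\<tau> + c + w + e \<le> \<rho> + c + w + e + d" using assms by auto
  consider "x \<le> \<sigma>" | "\<sigma> < x" "x \<le> \<tau>" | "\<tau> < x" "x \<le> \<rho>" | "\<rho> < x" by linarith
  then show ?case
    by cases ((use assms in \<open>simp add: Cons.IH prof_Cons[OF assms] prof_Cons[OF ord] profile_shift_padd shift_def[where x = x]; simp add: add.assoc\<close>)+)
qed simp

lemma prof_append: "prof \<sigma> \<tau> \<rho> (xs @ ys) = profile_add (prof \<sigma> \<tau> \<rho> xs) (prof \<sigma> \<tau> \<rho> ys)"
  by (simp add: prof_def)

lemma prof_mset:
  assumes "mset xs = mset ys"
  shows "prof \<sigma> \<tau> \<rho> xs = prof \<sigma> \<tau> \<rho> ys"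
proof -
  have "length (filter P xs) = length (filter P ys)" for P
    using arg_cong[OF assms, of "\<lambda>M. size (filter_mset P M)"] by (simp flip: mset_filter)
  moreover have "sum_list xs = sum_list ys"
    using arg_cong[OF assms, of sum_mset] by (simp add: sum_mset_sum_list)
  ultimately show ?thesis by (simp add: prof_def)
qed

text \<open>A leg is the list of its labels from the leaf to its centre, the core is read from the first centre to the
  second; \<open>A\<close> and \<open>B\<close> collect the lengths of the legs, and \<open>s = 0\<close> means that there is no core yet. The profiles
  \<open>P\<close> and \<open>Q\<close> of the labels at the two centres are all that is needed to follow their sums.\<close>

definition spider :: "nat multiset \<Rightarrow> nat multiset \<Rightarrow> nat \<Rightarrow> profile \<Rightarrow> profile \<Rightarrow> nat \<Rightarrow> nat \<Rightarrow> nat \<Rightarrow> nat \<Rightarrow> nat \<Rightarrow> bool \<Rightarrow> bool" where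
  "spider A B s P Q \<sigma> \<tau> \<rho> m l z \<longleftrightarrow> (\<exists>LA LB Cs. levelled (Cs @ LA @ LB) \<sigma> \<tau> \<rho> m l z \<and>
     mset (map length LA) = A \<and> mset (map length LB) = B \<and> map length Cs = (if s = 0 then [] else [s]) \<and>
     (\<forall>xs\<in>set (LA @ LB). xs \<noteq> [] \<and> hd xs \<le> \<tau>) \<and>
     prof \<sigma> \<tau> \<rho> (map last LA @ map hd Cs) = P \<and> prof \<sigma> \<tau> \<rho> (map last LB @ map last Cs) = Q)"

text \<open>The core may be inserted at any stage, but only once: by
  \<open>s = 0 \<or> s' = 0\<close> the sum \<open>s + s'\<close> is the length of the one core
  present.\<close>

lemma spider_insert:
  assumes spider: "spider A B s P Q \<sigma> \<tau> \<rho> m l z" and z: "z \<Longrightarrow> t \<le> e" "z \<Longrightarrow> z'"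
    and l: "l > 0 \<Longrightarrow> l + c + w + e + d \<le> l'"
    and N: "distinct (concat (NC @ NA @ NB))" "set (concat (NC @ NA @ NB)) = fresh \<sigma> \<tau> \<rho> c w e d t"
      "distinct (concat (map adj (NC @ NA @ NB)))"
      "\<And>xs. xs \<in> set (NC @ NA @ NB) \<Longrightarrow> level_path (\<sigma> + c) (\<tau> + c + w + e) (\<rho> + c + w + e + d) l' z' xs"
      "\<And>xs. xs \<in> set (NC @ NA @ NB) \<Longrightarrow> length xs > 1 \<Longrightarrow> set xs \<inter> {\<tau> + c + w + 1..\<tau> + c + w + e} = {}"
    and s: "map length NC = (if s' = 0 then [] else [s'])" "s = 0 \<or> s' = 0"
    and h: "\<And>xs. xs \<in> set (NA @ NB) \<Longrightarrow> xs \<noteq> [] \<and> hd xs \<le> \<tau> + c + w + e"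
  shows "spider (mset (map length NA) + A) (mset (map length NB) + B) (s + s')
     (profile_add (profile_shift c w e d t P) (prof (\<sigma> + c) (\<tau> + c + w + e) (\<rho> + c + w + e + d) (map last NA @ map hd NC)))
     (profile_add (profile_shift c w e d t Q) (prof (\<sigma> + c) (\<tau> + c + w + e) (\<rho> + c + w + e + d) (map last NB @ map last NC)))
     (\<sigma> + c) (\<tau> + c + w + e) (\<rho> + c + w + e + d) (m + c + w + e + d + t) l' z'"
proof -
  let ?g = "shift \<sigma> \<tau> \<rho> c w e d t"
  obtain LA LB Cs where levelled: "levelled (Cs @ LA @ LB) \<sigma> \<tau> \<rho> m l z" and
     A: "mset (map length LA) = A" and B: "mset (map length LB) = B" and C: "map length Cs = (if s = 0 then [] else [s])"
     and hd: "\<And>xs. xs \<in> set (LA @ LB) \<Longrightarrow> xs \<noteq> [] \<and> hd xs \<le> \<tau>"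
     and P: "prof \<sigma> \<tau> \<rho> (map last LA @ map hd Cs) = P" and Q: "prof \<sigma> \<tau> \<rho> (map last LB @ map last Cs) = Q"
    using spider unfolding spider_def by blast
  have ord: "\<sigma> \<le> \<tau>" "\<tau> \<le> \<rho>" using levelled by (auto simp: levelled_def)
  let ?LA = "NA @ map (map ?g) LA" and ?LB = "NB @ map (map ?g) LB" and ?C = "NC @ map (map ?g) Cs"
  have Cne: "xs \<noteq> []" if "xs \<in> set Cs" for xs using C that by (auto split: if_splits)
  have lasts: "map last (map (map ?g) L) = map ?g (map last L)" if "\<And>xs. xs \<in> set L \<Longrightarrow> xs \<noteq> []" for L
    using that by (auto simp: last_map)
  have hds: "map hd (map (map ?g) L) = map ?g (map hd L)" if "\<And>xs. xs \<in> set L \<Longrightarrow> xs \<noteq> []" for L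
    using that by (auto simp: hd_map)
  have St': "levelled (?C @ ?LA @ ?LB) (\<sigma> + c) (\<tau> + c + w + e) (\<rho> + c + w + e + d) (m + c + w + e + d + t) l' z'"
    by (rule levelled_insert[OF levelled z l N]) auto
  have "hd (map ?g xs) \<le> \<tau> + c + w + e" if "xs \<in> set (LA @ LB)" for xs
    using hd[OF that] by (auto simp: hd_map shift_def)
  then have hd': "\<forall>xs\<in>set (?LA @ ?LB). xs \<noteq> [] \<and> hd xs \<le> \<tau> + c + w + e"
    using h hd by auto
  have len: "map length (map (map ?g) L) = map length L" for L by simp
  have mP: "prof (\<sigma> + c) (\<tau> + c + w + e) (\<rho> + c + w + e + d) (map last ?LA @ map hd ?C) =
    profile_add (profile_shift c w e d t P) (prof (\<sigma> + c) (\<tau> + c + w + e) (\<rho> + c + w + e + d) (map last NA @ map hd NC))"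
  proof -
    have eq: "map last ?LA @ map hd ?C = map last NA @ map ?g (map last LA) @ map hd NC @ map ?g (map hd Cs)"
      using lasts[of LA] hds[of Cs] hd Cne by simp
    have "prof (\<sigma> + c) (\<tau> + c + w + e) (\<rho> + c + w + e + d) (map last ?LA @ map hd ?C) =
      prof (\<sigma> + c) (\<tau> + c + w + e) (\<rho> + c + w + e + d) (map ?g (map last LA @ map hd Cs) @ (map last NA @ map hd NC))"
      unfolding eq by (intro prof_mset) simp
    then show ?thesis unfolding prof_append[of _ _ _ "map ?g _"] prof_sh[OF ord] P .
  qed
  have mQ: "prof (\<sigma> + c) (\<tau> + c + w + e) (\<rho> + c + w + e + d) (map last ?LB @ map last ?C) =
    profile_add (profile_shift c w e d t Q) (prof (\<sigma> + c) (\<tau> + c + w + e) (\<rho> + c + w + e + d) (map last NB @ map last NC))"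
  proof -
    have eq: "map last ?LB @ map last ?C = map last NB @ map ?g (map last LB) @ map last NC @ map ?g (map last Cs)"
      using lasts[of LB] lasts[of Cs] hd Cne by simp
    have "prof (\<sigma> + c) (\<tau> + c + w + e) (\<rho> + c + w + e + d) (map last ?LB @ map last ?C) =
      prof (\<sigma> + c) (\<tau> + c + w + e) (\<rho> + c + w + e + d) (map ?g (map last LB @ map last Cs) @ (map last NB @ map last NC))"
      unfolding eq by (intro prof_mset) simp
    then show ?thesis unfolding prof_append[of _ _ _ "map ?g _"] prof_sh[OF ord] Q .
  qed
  show ?thesis unfolding spider_def
    by (rule exI[of _ ?LA], rule exI[of _ ?LB], rule exI[of _ ?C])
       (use St' A B C hd' mP mQ s in \<open>simp add: len[unfolded map_map] split: if_splits\<close>)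
qed

lemma spider_empty: "spider {#} {#} 0 (0, 0, 0, 0, 0) (0, 0, 0, 0, 0) 0 0 0 0 0 False"
  unfolding spider_def by (rule exI[of _ "[]"], rule exI[of _ "[]"], rule exI[of _ "[]"]) (simp add: levelled_def prof_def)

lemma spider_ord: "spider A B s P Q \<sigma> \<tau> \<rho> m l z \<Longrightarrow> \<sigma> \<le> \<tau> \<and> \<tau> \<le> \<rho> \<and> \<rho> \<le> m"
  unfolding spider_def levelled_def by blast

section \<open>Inserting a leg or a core\<close>

text \<open>A single new path that leaves the second level alone (\<open>w = e = 0\<close>), whence
  the flag \<open>False\<close>; \<open>l\<close> bounds the third-level labels next to its top
  label, if it has one.\<close>

definition newpath :: "nat \<Rightarrow> nat \<Rightarrow> nat \<Rightarrow> nat \<Rightarrow> nat \<Rightarrow> nat \<Rightarrow> nat \<Rightarrow> nat list \<Rightarrow> bool" where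
  "newpath \<sigma> \<tau> \<rho> c d t l p \<longleftrightarrow> distinct p \<and> set p = fresh \<sigma> \<tau> \<rho> c 0 0 d t \<and> distinct (adj p) \<and>
     level_path (\<sigma> + c) (\<tau> + c) (\<rho> + c + d) l False p \<and> p \<noteq> []"

lemma level_pair_mono: "level_pair \<sigma> \<tau> \<rho> l False x y \<Longrightarrow> l \<le> l' \<Longrightarrow> level_pair \<sigma> \<tau> \<rho> l' z x y"
  by (auto simp: level_pair_def)

lemma level_path_mono: "level_path \<sigma> \<tau> \<rho> l False p \<Longrightarrow> l \<le> l' \<Longrightarrow> level_path \<sigma> \<tau> \<rho> l' z p"
  unfolding level_path_def by (blast intro: level_pair_mono)

lemma newpath_rev: "newpath \<sigma> \<tau> \<rho> c d t l p \<Longrightarrow> newpath \<sigma> \<tau> \<rho> c d t l (rev p)"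
  by (simp add: newpath_def adj_rev)

lemma profile_add_0 [simp]: "profile_add P (0, 0, 0, 0, 0) = P"
  by (cases P) simp

lemma spider_newpath:
  assumes spider: "spider A B s P Q \<sigma> \<tau> \<rho> m l z" and z: "z \<Longrightarrow> t = 0"
    and l: "l > 0 \<Longrightarrow> l + c + d \<le> l'" "l0 \<le> l'"
    and p: "newpath \<sigma> \<tau> \<rho> c d t l0 p"
  shows "hd p \<le> \<tau> + c \<Longrightarrow> spider (add_mset (length p) A) B s
     (profile_add (profile_shift c 0 0 d t P) (prof (\<sigma> + c) (\<tau> + c) (\<rho> + c + d) [last p])) (profile_shift c 0 0 d t Q)
     (\<sigma> + c) (\<tau> + c) (\<rho> + c + d) (m + c + d + t) l' z"
    and "hd p \<le> \<tau> + c \<Longrightarrow> spider A (add_mset (length p) B) s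
     (profile_shift c 0 0 d t P) (profile_add (profile_shift c 0 0 d t Q) (prof (\<sigma> + c) (\<tau> + c) (\<rho> + c + d) [last p]))
     (\<sigma> + c) (\<tau> + c) (\<rho> + c + d) (m + c + d + t) l' z"
    and "s = 0 \<Longrightarrow> spider A B (length p)
     (profile_add (profile_shift c 0 0 d t P) (prof (\<sigma> + c) (\<tau> + c) (\<rho> + c + d) [hd p]))
     (profile_add (profile_shift c 0 0 d t Q) (prof (\<sigma> + c) (\<tau> + c) (\<rho> + c + d) [last p]))
     (\<sigma> + c) (\<tau> + c) (\<rho> + c + d) (m + c + d + t) l' z"
proof -
  have ok: "level_path (\<sigma> + c) (\<tau> + c) (\<rho> + c + d) l' z p" and pp: "distinct p" "set p = fresh \<sigma> \<tau> \<rho> c 0 0 d t"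
      "distinct (adj p)" "p \<noteq> []"
    using p level_path_mono[OF _ l(2)] by (auto simp: newpath_def)
  show "hd p \<le> \<tau> + c \<Longrightarrow> spider (add_mset (length p) A) B s
     (profile_add (profile_shift c 0 0 d t P) (prof (\<sigma> + c) (\<tau> + c) (\<rho> + c + d) [last p])) (profile_shift c 0 0 d t Q)
     (\<sigma> + c) (\<tau> + c) (\<rho> + c + d) (m + c + d + t) l' z"
    using spider_insert[OF spider, where c=c and w=0 and e=0 and d=d and t=t and l'=l' and z'=z and NA="[p]" and NB="[]" and NC="[]" and s'=0]
      ok pp l z by simp
  show "hd p \<le> \<tau> + c \<Longrightarrow> spider A (add_mset (length p) B) s
     (profile_shift c 0 0 d t P) (profile_add (profile_shift c 0 0 d t Q) (prof (\<sigma> + c) (\<tau> + c) (\<rho> + c + d) [last p]))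
     (\<sigma> + c) (\<tau> + c) (\<rho> + c + d) (m + c + d + t) l' z"
    using spider_insert[OF spider, where c=c and w=0 and e=0 and d=d and t=t and l'=l' and z'=z and NA="[]" and NB="[p]" and NC="[]" and s'=0]
      ok pp l z by simp
  show "s = 0 \<Longrightarrow> spider A B (length p)
     (profile_add (profile_shift c 0 0 d t P) (prof (\<sigma> + c) (\<tau> + c) (\<rho> + c + d) [hd p]))
     (profile_add (profile_shift c 0 0 d t Q) (prof (\<sigma> + c) (\<tau> + c) (\<rho> + c + d) [last p]))
     (\<sigma> + c) (\<tau> + c) (\<rho> + c + d) (m + c + d + t) l' z"
    using spider_insert[OF spider, where c=c and w=0 and e=0 and d=d and t=t and l'=l' and z'=z and NA="[]" and NB="[]" and NC="[p]" and s'="length p"]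
      ok pp l z by simp
qed

text \<open>\<open>spider_newpath\<close> with its indices replaced by equations, so that the
  operations below can be stated with simplified indices such as
  \<open>\<rho> + (2 * k + 1)\<close>.\<close>

lemma spider_newpath_eq:
  assumes spider: "spider A B s P Q \<sigma> \<tau> \<rho> m l z" and p: "newpath \<sigma> \<tau> \<rho> c d t l0 p" and z: "z \<Longrightarrow> t = 0"
    and l: "l > 0 \<Longrightarrow> l + c + d \<le> l'" "l0 \<le> l'"
    and eq: "\<sigma>' = \<sigma> + c" "\<tau>' = \<tau> + c" "\<rho>' = \<rho> + c + d" "m' = m + c + d + t" "length p = n"
  shows "hd p \<le> \<tau> + c \<Longrightarrow> prof (\<sigma> + c) (\<tau> + c) (\<rho> + c + d) [last p] = u \<Longrightarrow>
      spider (add_mset n A) B s (profile_add (profile_shift c 0 0 d t P) u) (profile_shift c 0 0 d t Q) \<sigma>' \<tau>' \<rho>' m' l' z"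
    and "hd p \<le> \<tau> + c \<Longrightarrow> prof (\<sigma> + c) (\<tau> + c) (\<rho> + c + d) [last p] = u \<Longrightarrow>
      spider A (add_mset n B) s (profile_shift c 0 0 d t P) (profile_add (profile_shift c 0 0 d t Q) u) \<sigma>' \<tau>' \<rho>' m' l' z"
    and "s = 0 \<Longrightarrow> prof (\<sigma> + c) (\<tau> + c) (\<rho> + c + d) [hd p] = u \<Longrightarrow>
      prof (\<sigma> + c) (\<tau> + c) (\<rho> + c + d) [last p] = v \<Longrightarrow>
      spider A B n (profile_add (profile_shift c 0 0 d t P) u) (profile_add (profile_shift c 0 0 d t Q) v) \<sigma>' \<tau>' \<rho>' m' l' z"
  using spider_newpath[OF spider z l p] unfolding eq(1-4) eq(5)[symmetric] by auto

section \<open>The shapes of new legs and cores\<close>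

lemma fresh_bottom: "fresh \<sigma> \<tau> \<rho> c 0 0 d 0 = {1..c} \<union> {\<tau> + c + 1..\<tau> + c + d}"
  "fresh \<sigma> \<tau> \<rho> c 0 0 d (Suc 0) = insert (\<rho> + c + d + 1) ({1..c} \<union> {\<tau> + c + 1..\<tau> + c + d})"
  by (auto simp: fresh_def)

lemma newpathI:
  assumes "distinct p" "set p = fresh \<sigma> \<tau> \<rho> c 0 0 d t" "distinct (adj p)"
    "level_path (\<sigma> + c) (\<tau> + c) (\<rho> + c + d) l False p" "p \<noteq> []"
  shows "newpath \<sigma> \<tau> \<rho> c d t l p"
  using assms by (simp add: newpath_def)

text \<open>Odd length with first-level labels at both ends: a leg that may be read in either
  direction.\<close>

lemma newpath_S: "\<tau> \<le> \<rho> \<Longrightarrow> newpath \<sigma> \<tau> \<rho> (Suc k) k 0 0 (alt 1 (\<tau> + Suc k + 1) (2 * k + 1))"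
proof (rule newpathI, unfold fresh_bottom set_alt adj_alt)
  show "{1..<1 + Suc (2 * k + 1) div 2} \<union> {\<tau> + Suc k + 1..<\<tau> + Suc k + 1 + (2 * k + 1) div 2}
      = {1..Suc k} \<union> {\<tau> + Suc k + 1..\<tau> + Suc k + k}" by auto
qed (auto intro!: distinct_alt level_path_alt)

text \<open>Even length with the low end for the leaf, so that the centre gets a third-level
  label.\<close>

lemma newpath_E: "\<tau> \<le> \<rho> \<Longrightarrow> newpath \<sigma> \<tau> \<rho> (Suc k) (Suc k) 0 0 (alt 1 (\<tau> + Suc k + 1) (2 * k + 2))"
proof (rule newpathI, unfold fresh_bottom set_alt adj_alt)
  show "{1..<1 + Suc (2 * k + 2) div 2} \<union> {\<tau> + Suc k + 1..<\<tau> + Suc k + 1 + (2 * k + 2) div 2}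
      = {1..Suc k} \<union> {\<tau> + Suc k + 1..\<tau> + Suc k + Suc k}" by auto
qed (auto intro!: distinct_alt level_path_alt)

text \<open>Odd length with third-level labels at both ends; this suits the core only, which has no
  leaf.\<close>

lemma newpath_CO: "\<tau> \<le> \<rho> \<Longrightarrow> newpath \<sigma> \<tau> \<rho> k (Suc k) 0 0 (alt (\<tau> + k + 1) 1 (2 * k + 1))"
proof (rule newpathI, unfold fresh_bottom set_alt adj_alt)
  show "{\<tau> + k + 1..<\<tau> + k + 1 + Suc (2 * k + 1) div 2} \<union> {1..<1 + (2 * k + 1) div 2}
      = {1..k} \<union> {\<tau> + k + 1..\<tau> + k + Suc k}" by auto
qed (auto intro!: distinct_alt level_path_alt)

text \<open>An even core that gives one centre a third-level label and the other a first-level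
  one.\<close>

lemma newpath_CP: "\<tau> \<le> \<rho> \<Longrightarrow> newpath \<sigma> \<tau> \<rho> (Suc k) (Suc k) 0 0 (alt (\<tau> + Suc k + 1) 1 (2 * k + 2))"
proof (rule newpathI, unfold fresh_bottom set_alt adj_alt)
  show "{\<tau> + Suc k + 1..<\<tau> + Suc k + 1 + Suc (2 * k + 2) div 2} \<union> {1..<1 + (2 * k + 2) div 2}
      = {1..Suc k} \<union> {\<tau> + Suc k + 1..\<tau> + Suc k + Suc k}" by auto
qed (auto intro!: distinct_alt level_path_alt)

text \<open>The appended label is the only top label, so the previous last label is the only one
  that \<open>l\<close> has to cover. Since \<open>p\<close> ends on the third level, the additional
  sum exceeds \<open>\<sigma> + c + (\<rho> + c + d)\<close> and so all sums along
  \<open>p\<close>.\<close>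

lemma newpath_snoc:
  assumes "newpath \<sigma> \<tau> \<rho> c d 0 0 p" "\<tau> + c < last p" "last p \<le> \<rho> + c + d" "\<sigma> \<le> \<tau>" "\<tau> \<le> \<rho>"
    "\<forall>s\<in>set (adj p). s \<le> \<sigma> + c + (\<rho> + c + d)"
  shows "newpath \<sigma> \<tau> \<rho> c d (Suc 0) (last p) (p @ [\<rho> + c + d + 1])"
proof (rule newpathI)
  have p: "distinct p" "set p = {1..c} \<union> {\<tau> + c + 1..\<tau> + c + d}" "distinct (adj p)"
    "level_path (\<sigma> + c) (\<tau> + c) (\<rho> + c + d) 0 False p" "p \<noteq> []"
    using assms(1) by (auto simp: newpath_def fresh_bottom)
  show "distinct (p @ [\<rho> + c + d + 1])" using p assms(5) by auto
  show "set (p @ [\<rho> + c + d + 1]) = fresh \<sigma> \<tau> \<rho> c 0 0 d (Suc 0)" using p(2) by (simp add: fresh_bottom)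
  show "distinct (adj (p @ [\<rho> + c + d + 1]))"
    unfolding adj_snoc[OF p(5)] using p(3) assms(2,4,6) by force
  show "level_path (\<sigma> + c) (\<tau> + c) (\<rho> + c + d) (last p) False (p @ [\<rho> + c + d + 1])"
    unfolding level_path_snoc[OF p(5)] using level_path_mono[OF p(4)] assms(2,3) by (simp add: level_pair_def)
  show "p @ [\<rho> + c + d + 1] \<noteq> []" by simp
qed

text \<open>The alternative to \<open>newpath_S\<close> for odd lengths from 3 on: the centre
  receives a top label instead of a low one.\<close>

lemma newpath_LL:
  assumes "\<sigma> \<le> \<tau>" "\<tau> \<le> \<rho>"
  shows "newpath \<sigma> \<tau> \<rho> (Suc k) (Suc k) (Suc 0) (\<tau> + 2 * k + 2)
   (alt 1 (\<tau> + Suc k + 1) (2 * k + 2) @ [\<rho> + 2 * k + 3])"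
proof -
  have l: "last (alt 1 (\<tau> + Suc k + 1) (2 * k + 2)) = \<tau> + 2 * k + 2" by (simp add: last_alt)
  have "newpath \<sigma> \<tau> \<rho> (Suc k) (Suc k) (Suc 0) (last (alt 1 (\<tau> + Suc k + 1) (2 * k + 2)))
    (alt 1 (\<tau> + Suc k + 1) (2 * k + 2) @ [\<rho> + Suc k + Suc k + 1])"
    using assms by (intro newpath_snoc newpath_E) (auto simp: last_alt adj_alt)
  moreover have "\<rho> + Suc k + Suc k + 1 = \<rho> + 2 * k + 3" by simp
  ultimately show ?thesis unfolding l by metis
qed

text \<open>An even core with high labels at both ends, one of the third level and one on top, where
  \<open>newpath_CP\<close> has a low end.\<close>

lemma newpath_CL:
  assumes "\<sigma> \<le> \<tau>" "\<tau> \<le> \<rho>"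
  shows "newpath \<sigma> \<tau> \<rho> k (Suc k) (Suc 0) (\<tau> + 2 * k + 1)
   (alt (\<tau> + k + 1) 1 (2 * k + 1) @ [\<rho> + 2 * k + 2])"
proof -
  have l: "last (alt (\<tau> + k + 1) 1 (2 * k + 1)) = \<tau> + 2 * k + 1" by (simp add: last_alt)
  have "newpath \<sigma> \<tau> \<rho> k (Suc k) (Suc 0) (last (alt (\<tau> + k + 1) 1 (2 * k + 1)))
    (alt (\<tau> + k + 1) 1 (2 * k + 1) @ [\<rho> + k + Suc k + 1])"
    using assms by (intro newpath_snoc newpath_CO) (auto simp: last_alt adj_alt)
  moreover have "\<rho> + k + Suc k + 1 = \<rho> + 2 * k + 2" by simp
  ultimately show ?thesis unfolding l by metis
qed

section \<open>The operations on spiders\<close>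

lemma prof_1:
  assumes "\<sigma> \<le> \<tau>" "\<tau> \<le> \<rho>"
  shows "x \<le> \<sigma> \<Longrightarrow> prof \<sigma> \<tau> \<rho> [x] = (1, 0, 0, 0, x)"
    "\<sigma> < x \<Longrightarrow> x \<le> \<tau> \<Longrightarrow> prof \<sigma> \<tau> \<rho> [x] = (0, 1, 0, 0, x)"
    "\<tau> < x \<Longrightarrow> x \<le> \<rho> \<Longrightarrow> prof \<sigma> \<tau> \<rho> [x] = (0, 0, 1, 0, x)"
    "\<rho> < x \<Longrightarrow> prof \<sigma> \<tau> \<rho> [x] = (0, 0, 0, 1, x)"
  using assms by (simp_all add: prof_def)

text \<open>The value 0 says that no third-level label is next to a top label, and an insertion has
  to preserve this; any other bound moves with the third level.\<close>

definition lift_bound :: "nat \<Rightarrow> nat \<Rightarrow> nat" where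
  "lift_bound l c = (if l = 0 then 0 else l + c)"

context
  fixes A B s P Q \<sigma> \<tau> \<rho> m l z
  assumes spider: "spider A B s P Q \<sigma> \<tau> \<rho> m l z"
begin

lemma ords: "\<sigma> \<le> \<tau>" "\<tau> \<le> \<rho>" "\<rho> \<le> m" using spider_ord[OF spider] by auto

lemma spider_S:
  assumes v: "v = 1 \<or> v = Suc k"
  shows spider_Sa: "spider (add_mset (2 * k + 1) A) B s (profile_add (profile_shift (Suc k) 0 0 k 0 P) (1, 0, 0, 0, v)) (profile_shift (Suc k) 0 0 k 0 Q)
      (\<sigma> + Suc k) (\<tau> + Suc k) (\<rho> + (2 * k + 1)) (m + (2 * k + 1)) (lift_bound l (2 * k + 1)) z" (is ?a)
    and spider_Sb: "spider A (add_mset (2 * k + 1) B) s (profile_shift (Suc k) 0 0 k 0 P) (profile_add (profile_shift (Suc k) 0 0 k 0 Q) (1, 0, 0, 0, v))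
      (\<sigma> + Suc k) (\<tau> + Suc k) (\<rho> + (2 * k + 1)) (m + (2 * k + 1)) (lift_bound l (2 * k + 1)) z" (is ?b)
proof -
  let ?p = "alt 1 (\<tau> + Suc k + 1) (2 * k + 1)"
  \<comment> \<open>Both ends are low, so reversing the path decides whether 1 or
    \<open>Suc k\<close> lies at the centre.\<close>
  obtain p where p: "newpath \<sigma> \<tau> \<rho> (Suc k) k 0 0 p" "length p = 2 * k + 1" "last p = v" "hd p \<le> \<tau> + Suc k"
  proof (cases "v = 1")
    case True
    show ?thesis
      by (rule that[of "rev ?p"], rule newpath_rev[OF newpath_S[OF ords(2)]])
         (use True in \<open>simp_all add: last_rev hd_rev last_alt\<close>)
  next
    case False
    show ?thesis
      by (rule that[of ?p], rule newpath_S[OF ords(2)]) (use False v in \<open>simp_all add: last_alt\<close>)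
  qed
  have pr: "prof (\<sigma> + Suc k) (\<tau> + Suc k) (\<rho> + Suc k + k) [last p] = (1, 0, 0, 0, v)"
    unfolding p(3) using v ords by (intro prof_1) auto
  show ?a by (rule spider_newpath_eq(1)[OF spider p(1) _ _ _ _ _ _ _ p(2,4) pr]) (auto simp: lift_bound_def)
  show ?b by (rule spider_newpath_eq(2)[OF spider p(1) _ _ _ _ _ _ _ p(2,4) pr]) (auto simp: lift_bound_def)
qed

lemma spider_E:
  shows spider_Ea: "spider (add_mset (2 * k + 2) A) B s (profile_add (profile_shift (Suc k) 0 0 (Suc k) 0 P) (0, 0, 1, 0, \<tau> + (2 * k + 2))) (profile_shift (Suc k) 0 0 (Suc k) 0 Q)
      (\<sigma> + Suc k) (\<tau> + Suc k) (\<rho> + (2 * k + 2)) (m + (2 * k + 2)) (lift_bound l (2 * k + 2)) z" (is ?a)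
    and spider_Eb: "spider A (add_mset (2 * k + 2) B) s (profile_shift (Suc k) 0 0 (Suc k) 0 P) (profile_add (profile_shift (Suc k) 0 0 (Suc k) 0 Q) (0, 0, 1, 0, \<tau> + (2 * k + 2)))
      (\<sigma> + Suc k) (\<tau> + Suc k) (\<rho> + (2 * k + 2)) (m + (2 * k + 2)) (lift_bound l (2 * k + 2)) z" (is ?b)
proof -
  let ?p = "alt 1 (\<tau> + Suc k + 1) (2 * k + 2)"
  have p: "last ?p = \<tau> + (2 * k + 2)" "hd ?p \<le> \<tau> + Suc k" "length ?p = 2 * k + 2" by (simp_all add: last_alt)
  have pr: "prof (\<sigma> + Suc k) (\<tau> + Suc k) (\<rho> + Suc k + Suc k) [last ?p] = (0, 0, 1, 0, \<tau> + (2 * k + 2))"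
    unfolding p(1) using ords by (intro prof_1) auto
  show ?a by (rule spider_newpath_eq(1)[OF spider newpath_E[OF ords(2)] _ _ _ _ _ _ _ p(3,2) pr]) (auto simp: lift_bound_def)
  show ?b by (rule spider_newpath_eq(2)[OF spider newpath_E[OF ords(2)] _ _ _ _ _ _ _ p(3,2) pr]) (auto simp: lift_bound_def)
qed

lemma spider_L:
  assumes z: "\<not> z"
  shows spider_La: "spider (add_mset (2 * k + 3) A) B s (profile_add (profile_shift (Suc k) 0 0 (Suc k) 1 P) (0, 0, 0, 1, \<rho> + (2 * k + 3))) (profile_shift (Suc k) 0 0 (Suc k) 1 Q)
      (\<sigma> + Suc k) (\<tau> + Suc k) (\<rho> + (2 * k + 2)) (m + (2 * k + 3)) (max (lift_bound l (2 * k + 2)) (\<tau> + (2 * k + 2))) z" (is ?a)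
    and spider_Lb: "spider A (add_mset (2 * k + 3) B) s (profile_shift (Suc k) 0 0 (Suc k) 1 P) (profile_add (profile_shift (Suc k) 0 0 (Suc k) 1 Q) (0, 0, 0, 1, \<rho> + (2 * k + 3)))
      (\<sigma> + Suc k) (\<tau> + Suc k) (\<rho> + (2 * k + 2)) (m + (2 * k + 3)) (max (lift_bound l (2 * k + 2)) (\<tau> + (2 * k + 2))) z" (is ?b)
proof -
  let ?p = "alt 1 (\<tau> + Suc k + 1) (2 * k + 2) @ [\<rho> + 2 * k + 3]"
  have p: "last ?p = \<rho> + (2 * k + 3)" "hd ?p \<le> \<tau> + Suc k" "length ?p = 2 * k + 3" by simp_all
  have pr: "prof (\<sigma> + Suc k) (\<tau> + Suc k) (\<rho> + Suc k + Suc k) [last ?p] = (0, 0, 0, 1, \<rho> + (2 * k + 3))"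
    unfolding p(1) using ords by (intro prof_1) auto
  have np: "newpath \<sigma> \<tau> \<rho> (Suc k) (Suc k) 1 (\<tau> + 2 * k + 2) ?p" using newpath_LL[OF ords(1,2)] by simp
  show ?a by (rule spider_newpath_eq(1)[OF spider np _ _ _ _ _ _ _ p(3,2) pr]) (use z in \<open>auto simp: lift_bound_def\<close>)
  show ?b by (rule spider_newpath_eq(2)[OF spider np _ _ _ _ _ _ _ p(3,2) pr]) (use z in \<open>auto simp: lift_bound_def\<close>)
qed

text \<open>A pendant edge with the largest label that a leaf may have, the new top of the second
  level. It contributes more to its centre than \<open>spider_S\<close> with \<open>k = 0\<close>,
  which would use the label 1.\<close>

lemma spider_M:
  shows spider_Ma: "spider (add_mset 1 A) B s (profile_add (profile_shift 0 0 1 0 0 P) (0, 1, 0, 0, Suc \<tau>)) (profile_shift 0 0 1 0 0 Q) \<sigma> (Suc \<tau>) (Suc \<rho>) (Suc m) (lift_bound l 1) z"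
    and spider_Mb: "spider A (add_mset 1 B) s (profile_shift 0 0 1 0 0 P) (profile_add (profile_shift 0 0 1 0 0 Q) (0, 1, 0, 0, Suc \<tau>)) \<sigma> (Suc \<tau>) (Suc \<rho>) (Suc m) (lift_bound l 1) z"
proof -
  have fr: "fresh \<sigma> \<tau> \<rho> 0 0 (Suc 0) 0 0 = {Suc \<tau>}" by (auto simp: fresh_def)
  have pr: "prof \<sigma> (Suc \<tau>) (Suc \<rho>) [Suc \<tau>] = (0, 1, 0, 0, Suc \<tau>)"
    using ords by (simp add: prof_1)
  show "spider (add_mset 1 A) B s (profile_add (profile_shift 0 0 1 0 0 P) (0, 1, 0, 0, Suc \<tau>)) (profile_shift 0 0 1 0 0 Q) \<sigma> (Suc \<tau>) (Suc \<rho>) (Suc m) (lift_bound l 1) z"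
    using spider_insert[OF spider, where c=0 and w=0 and e=1 and d=0 and t=0 and l'="lift_bound l 1" and z'=z and NA="[[Suc \<tau>]]" and NB="[]" and NC="[]" and s'=0]
    by (simp add: fr pr lift_bound_def)
  show "spider A (add_mset 1 B) s (profile_shift 0 0 1 0 0 P) (profile_add (profile_shift 0 0 1 0 0 Q) (0, 1, 0, 0, Suc \<tau>)) \<sigma> (Suc \<tau>) (Suc \<rho>) (Suc m) (lift_bound l 1) z"
    using spider_insert[OF spider, where c=0 and w=0 and e=1 and d=0 and t=0 and l'="lift_bound l 1" and z'=z and NA="[]" and NB="[[Suc \<tau>]]" and NC="[]" and s'=0]
    by (simp add: fr pr lift_bound_def)
qed

lemma spider_COa:
  assumes s: "s = 0"
  shows "spider A B (2 * k + 1) (profile_add (profile_shift k 0 0 (Suc k) 0 P) (0, 0, 1, 0, \<tau> + (2 * k + 1))) (profile_add (profile_shift k 0 0 (Suc k) 0 Q) (0, 0, 1, 0, \<tau> + (k + 1)))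
      (\<sigma> + k) (\<tau> + k) (\<rho> + (2 * k + 1)) (m + (2 * k + 1)) (lift_bound l (2 * k + 1)) z" (is ?a)
proof -
  let ?p = "alt (\<tau> + k + 1) 1 (2 * k + 1)"
  have p: "hd ?p = \<tau> + (k + 1)" "last ?p = \<tau> + (2 * k + 1)" "length ?p = 2 * k + 1" "length (rev ?p) = 2 * k + 1"
      "hd (rev ?p) = \<tau> + (2 * k + 1)" "last (rev ?p) = \<tau> + (k + 1)"
    by (simp_all add: hd_rev last_rev last_alt)
  have pr: "prof (\<sigma> + k) (\<tau> + k) (\<rho> + k + Suc k) [\<tau> + (k + 1)] = (0, 0, 1, 0, \<tau> + (k + 1))"
     "prof (\<sigma> + k) (\<tau> + k) (\<rho> + k + Suc k) [\<tau> + (2 * k + 1)] = (0, 0, 1, 0, \<tau> + (2 * k + 1))"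
    using ords by (simp_all add: prof_1)
  show ?a
  proof (rule spider_newpath_eq(3)[OF spider newpath_rev[OF newpath_CO[OF ords(2)]] _ _ _ _ _ _ _ p(4) s], unfold p pr)
  qed (auto simp: lift_bound_def)
qed

lemma spider_CL:
  assumes s: "s = 0" and z: "\<not> z"
  shows spider_CLb: "spider A B (2 * k + 2) (profile_add (profile_shift k 0 0 (Suc k) 1 P) (0, 0, 1, 0, \<tau> + (k + 1))) (profile_add (profile_shift k 0 0 (Suc k) 1 Q) (0, 0, 0, 1, \<rho> + (2 * k + 2)))
      (\<sigma> + k) (\<tau> + k) (\<rho> + (2 * k + 1)) (m + (2 * k + 2)) (max (lift_bound l (2 * k + 1)) (\<tau> + (2 * k + 1))) z" (is ?b)
    and spider_CLa: "spider A B (2 * k + 2) (profile_add (profile_shift k 0 0 (Suc k) 1 P) (0, 0, 0, 1, \<rho> + (2 * k + 2))) (profile_add (profile_shift k 0 0 (Suc k) 1 Q) (0, 0, 1, 0, \<tau> + (k + 1)))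
      (\<sigma> + k) (\<tau> + k) (\<rho> + (2 * k + 1)) (m + (2 * k + 2)) (max (lift_bound l (2 * k + 1)) (\<tau> + (2 * k + 1))) z" (is ?a)
proof -
  let ?p = "alt (\<tau> + k + 1) 1 (2 * k + 1) @ [\<rho> + 2 * k + 2]"
  have np: "newpath \<sigma> \<tau> \<rho> k (Suc k) 1 (\<tau> + 2 * k + 1) ?p" using newpath_CL[OF ords(1,2)] by simp
  have p: "hd ?p = \<tau> + (k + 1)" "last ?p = \<rho> + (2 * k + 2)" "length ?p = 2 * k + 2"
     "length (rev ?p) = 2 * k + 2" "hd (rev ?p) = \<rho> + (2 * k + 2)" "last (rev ?p) = \<tau> + (k + 1)"
    by (simp_all add: last_rev hd_rev)
  have pr: "prof (\<sigma> + k) (\<tau> + k) (\<rho> + k + Suc k) [\<rho> + (2 * k + 2)] = (0, 0, 0, 1, \<rho> + (2 * k + 2))"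
    "prof (\<sigma> + k) (\<tau> + k) (\<rho> + k + Suc k) [\<tau> + (k + 1)] = (0, 0, 1, 0, \<tau> + (k + 1))"
    using ords by (simp_all add: prof_1)
  show ?b
  proof (rule spider_newpath_eq(3)[OF spider np _ _ _ _ _ _ _ p(3) s], unfold p pr)
  qed (use z in \<open>auto simp: lift_bound_def\<close>)
  show ?a
  proof (rule spider_newpath_eq(3)[OF spider newpath_rev[OF np] _ _ _ _ _ _ _ p(4) s], unfold p pr)
  qed (use z in \<open>auto simp: lift_bound_def\<close>)
qed

lemma spider_CP:
  assumes s: "s = 0"
  shows spider_CPa: "spider A B (2 * k + 2) (profile_add (profile_shift (Suc k) 0 0 (Suc k) 0 P) (1, 0, 0, 0, Suc k)) (profile_add (profile_shift (Suc k) 0 0 (Suc k) 0 Q) (0, 0, 1, 0, \<tau> + (k + 2)))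
      (\<sigma> + Suc k) (\<tau> + Suc k) (\<rho> + (2 * k + 2)) (m + (2 * k + 2)) (lift_bound l (2 * k + 2)) z" (is ?a)
    and spider_CPb: "spider A B (2 * k + 2) (profile_add (profile_shift (Suc k) 0 0 (Suc k) 0 P) (0, 0, 1, 0, \<tau> + (k + 2))) (profile_add (profile_shift (Suc k) 0 0 (Suc k) 0 Q) (1, 0, 0, 0, Suc k))
      (\<sigma> + Suc k) (\<tau> + Suc k) (\<rho> + (2 * k + 2)) (m + (2 * k + 2)) (lift_bound l (2 * k + 2)) z" (is ?b)
proof -
  let ?p = "alt (\<tau> + Suc k + 1) 1 (2 * k + 2)"
  have p: "length ?p = 2 * k + 2" "last ?p = Suc k" "hd ?p = \<tau> + (k + 2)"
    "length (rev ?p) = 2 * k + 2" "hd (rev ?p) = Suc k" "last (rev ?p) = \<tau> + (k + 2)"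
    by (simp_all add: last_rev hd_rev last_alt)
  have pr: "prof (\<sigma> + Suc k) (\<tau> + Suc k) (\<rho> + Suc k + Suc k) [Suc k] = (1, 0, 0, 0, Suc k)"
    "prof (\<sigma> + Suc k) (\<tau> + Suc k) (\<rho> + Suc k + Suc k) [\<tau> + (k + 2)] = (0, 0, 1, 0, \<tau> + (k + 2))"
    using ords by (simp_all add: prof_1)
  show ?a
  proof (rule spider_newpath_eq(3)[OF spider newpath_rev[OF newpath_CP[OF ords(2)]] _ _ _ _ _ _ _ p(4) s], unfold p pr)
  qed (auto simp: lift_bound_def)
  show ?b
  proof (rule spider_newpath_eq(3)[OF spider newpath_CP[OF ords(2)] _ _ _ _ _ _ _ p(1) s], unfold p pr)
  qed (auto simp: lift_bound_def)
qed

text \<open>This is the only operation that joins a label of the second level to a top label, hence the flag \<open>z\<close>.\<close>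

lemma spider_Z:
  "spider (add_mset (2 * k + 4) A) (add_mset 1 B) s
     (profile_add (profile_shift (Suc k) 1 1 (Suc k) 1 P) (0, 1, 0, 0, \<sigma> + (k + 2))) (profile_add (profile_shift (Suc k) 1 1 (Suc k) 1 Q) (0, 1, 0, 0, \<tau> + (k + 3)))
     (\<sigma> + Suc k) (\<tau> + (k + 3)) (\<rho> + (2 * k + 4)) (m + (2 * k + 5)) (max (lift_bound l (2 * k + 4)) (\<tau> + (2 * k + 4))) True"
proof -
  \<comment> \<open>The leg alternates up to \<open>\<tau> + (2 * k + 4)\<close>, visits the one
    fresh top label and returns to the fresh label at the bottom of the second level: although its
    length is even, it ends low. The pendant edge takes the fresh label on top of the second level,
    and \<open>t = e = 1\<close> respects the condition of \<open>levelled_insert\<close> in case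
    \<open>z\<close> already holds.\<close>
  let ?q = "alt 1 (\<tau> + (k + 4)) (2 * k + 2)"
  let ?q1 = "?q @ [\<rho> + (2 * k + 5)]"
  let ?p = "?q1 @ [\<sigma> + (k + 2)]"
  let ?l = "max (lift_bound l (2 * k + 4)) (\<tau> + (2 * k + 4))"
  have q: "last ?q = \<tau> + (2 * k + 4)" "?q \<noteq> []" by (simp_all add: last_alt)
  have e: "\<tau> + Suc k + 1 + 1 = \<tau> + (k + 3)" "\<rho> + Suc k + 1 + 1 + Suc k = \<rho> + (2 * k + 4)"
    "m + Suc k + 1 + 1 + Suc k + 1 = m + (2 * k + 5)" by auto
  have fr: "x \<in> fresh \<sigma> \<tau> \<rho> (Suc k) 1 1 (Suc k) 1 \<longleftrightarrow> (1 \<le> x \<and> x \<le> Suc k) \<or> (\<tau> + (k + 4) \<le> x \<and> x \<le> \<tau> + (2 * k + 4)) \<or>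
      x = \<sigma> + (k + 2) \<or> x = \<rho> + (2 * k + 5) \<or> x = \<tau> + (k + 3)" for x
    unfolding fresh_def Un_iff atLeastAtMost_iff by linarith
  have setq: "x \<in> set ?q \<longleftrightarrow> (1 \<le> x \<and> x \<le> Suc k) \<or> (\<tau> + (k + 4) \<le> x \<and> x \<le> \<tau> + (2 * k + 4))" for x
    unfolding set_alt Un_iff atLeastLessThan_iff by simp linarith
  have d1: "distinct ?p" "\<tau> + (k + 3) \<notin> set ?p"
  proof -
    have "distinct ?q" by (rule distinct_alt) simp
    moreover have "\<rho> + (2 * k + 5) \<notin> set ?q" "\<sigma> + (k + 2) \<notin> set ?q" "\<tau> + (k + 3) \<notin> set ?q"
      unfolding setq using ords by linarith+
    ultimately show "distinct ?p" "\<tau> + (k + 3) \<notin> set ?p" using ords by auto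
  qed
  have a: "adj ?p = adj ?q @ [\<tau> + (2 * k + 4) + (\<rho> + (2 * k + 5)), \<rho> + (2 * k + 5) + (\<sigma> + (k + 2))]"
    using adj_snoc[of ?q1] adj_snoc[of ?q] q by simp
  have d2: "distinct (adj ?p)" unfolding a adj_alt using ords by simp
  have ok: "level_path (\<sigma> + Suc k) (\<tau> + (k + 3)) (\<rho> + (2 * k + 4)) ?l True ?p"
  proof -
    have "level_path (\<sigma> + Suc k) (\<tau> + (k + 3)) (\<rho> + (2 * k + 4)) ?l True ?q"
      by (rule level_path_alt) (use ords in simp)
    moreover have "level_pair (\<sigma> + Suc k) (\<tau> + (k + 3)) (\<rho> + (2 * k + 4)) ?l True (last ?q) (\<rho> + (2 * k + 5))"
      unfolding q level_pair_def using ords by simp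
    moreover have "level_pair (\<sigma> + Suc k) (\<tau> + (k + 3)) (\<rho> + (2 * k + 4)) ?l True (\<sigma> + (k + 2)) (last ?q1)"
      unfolding level_pair_def using ords by simp
    ultimately show ?thesis using level_path_snoc[of ?q1] level_path_snoc[of ?q] q by blast
  qed
  have pr: "prof (\<sigma> + Suc k) (\<tau> + (k + 3)) (\<rho> + (2 * k + 4)) [\<sigma> + (k + 2)] = (0, 1, 0, 0, \<sigma> + (k + 2))"
    "prof (\<sigma> + Suc k) (\<tau> + (k + 3)) (\<rho> + (2 * k + 4)) [\<tau> + (k + 3)] = (0, 1, 0, 0, \<tau> + (k + 3))"
    using ords by (simp_all add: prof_1)
  let ?NA = "[?p]" and ?NB = "[[\<tau> + (k + 3)]]"
  have c1: "distinct (concat ([] @ ?NA @ ?NB))" using d1 by simp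
  have c2: "set (concat ([] @ ?NA @ ?NB)) = fresh \<sigma> \<tau> \<rho> (Suc k) 1 1 (Suc k) 1"
  proof (rule set_eqI)
    fix x
    have "x \<in> set (concat ([] @ ?NA @ ?NB)) \<longleftrightarrow> x \<in> set ?q \<or> x = \<rho> + (2 * k + 5) \<or> x = \<sigma> + (k + 2) \<or> x = \<tau> + (k + 3)"
      by auto
    then show "x \<in> set (concat ([] @ ?NA @ ?NB)) \<longleftrightarrow> x \<in> fresh \<sigma> \<tau> \<rho> (Suc k) 1 1 (Suc k) 1"
      unfolding fr setq by blast
  qed
  have c3: "distinct (concat (map adj ([] @ ?NA @ ?NB)))" using d2 by simp
  have c4: "level_path (\<sigma> + Suc k) (\<tau> + Suc k + 1 + 1) (\<rho> + Suc k + 1 + 1 + Suc k) ?l True xs" if "xs \<in> set ([] @ ?NA @ ?NB)" for xs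
    unfolding e using that ok by auto
  have c5: "set xs \<inter> {\<tau> + Suc k + 1 + 1..\<tau> + Suc k + 1 + 1} = {}" if "xs \<in> set ([] @ ?NA @ ?NB)" "length xs > 1" for xs
    unfolding e using that d1(2) by auto
  have c6: "xs \<noteq> [] \<and> hd xs \<le> \<tau> + Suc k + 1 + 1" if "xs \<in> set (?NA @ ?NB)" for xs
    using that by auto
  have "spider (mset (map length ?NA) + A) (mset (map length ?NB) + B) (s + 0)
     (profile_add (profile_shift (Suc k) 1 1 (Suc k) 1 P) (prof (\<sigma> + Suc k) (\<tau> + Suc k + 1 + 1) (\<rho> + Suc k + 1 + 1 + Suc k) (map last ?NA @ map hd [])))
     (profile_add (profile_shift (Suc k) 1 1 (Suc k) 1 Q) (prof (\<sigma> + Suc k) (\<tau> + Suc k + 1 + 1) (\<rho> + Suc k + 1 + 1 + Suc k) (map last ?NB @ map last [])))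
     (\<sigma> + Suc k) (\<tau> + Suc k + 1 + 1) (\<rho> + Suc k + 1 + 1 + Suc k) (m + Suc k + 1 + 1 + Suc k + 1) ?l True"
    by (rule spider_insert[OF spider _ _ _ c1 c2 c3 c4 c5 _ _ c6]) (auto simp: lift_bound_def)
  moreover have "length ?p = 2 * k + 4" by simp
  ultimately show ?thesis unfolding e by (simp only: list.map mset.simps append_Nil append_Nil2 append_Cons last.simps pr
     add_0_right last_snoc list.size add_mset_add_single[symmetric] union_mset_add_mset_left empty_neutral) (simp add: pr[simplified])
qed

end

section \<open>Centre sums in terms of counts\<close>

fun counts :: "profile \<Rightarrow> profile" where
  "counts (n0, n1, n2, n3, f) = (n0 + n1 + n2 + n3, n2 + n3, n1, n3, f)"

text \<open>At the first centre, \<open>N\<close> counts all labels, \<open>H\<close> those above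
  \<open>\<tau>\<close>, \<open>W\<close> those of the second level and \<open>T\<close> those above
  \<open>\<rho>\<close>; primes refer to the second centre. These are the coefficients with which
  insertions raise \<open>f\<close> and \<open>g\<close>.\<close>

definition counted :: "nat multiset \<Rightarrow> nat multiset \<Rightarrow> nat \<Rightarrow> nat \<Rightarrow> nat \<Rightarrow> nat \<Rightarrow> nat \<Rightarrow> nat \<Rightarrow>
    nat \<Rightarrow> nat \<Rightarrow> nat \<Rightarrow> nat \<Rightarrow> nat \<Rightarrow> nat \<Rightarrow> nat \<Rightarrow> nat \<Rightarrow> nat \<Rightarrow> nat \<Rightarrow> bool \<Rightarrow> bool" where
  "counted A B s N H W T f N' H' W' T' g \<sigma> \<tau> \<rho> m l z \<longleftrightarrow> (\<exists>P Q. spider A B s P Q \<sigma> \<tau> \<rho> m l z \<and>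
     counts P = (N, H, W, T, f) \<and> counts Q = (N', H', W', T', g))"

lemma countedE:
  assumes "counted A B s N H W T f N' H' W' T' g \<sigma> \<tau> \<rho> m l z"
  obtains P Q where "spider A B s P Q \<sigma> \<tau> \<rho> m l z" "counts P = (N, H, W, T, f)" "counts Q = (N', H', W', T', g)"
  using assms unfolding counted_def by blast

lemma countedI:
  assumes "spider A B s P Q \<sigma> \<tau> \<rho> m l z" "counts P = (N, H, W, T, f)" "counts Q = (N', H', W', T', g)"
  shows "counted A B s N H W T f N' H' W' T' g \<sigma> \<tau> \<rho> m l z"
  using assms unfolding counted_def by blast

lemma counts_upd: "counts (profile_shift c w e d t P) =
   (case counts P of (N, H, W, T, f) \<Rightarrow> (N, H, W, T, f + c * N + w * (W + H) + (e + d) * H + t * T))"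
  by (cases P) (auto simp: algebra_simps)

lemma counts_padd: "counts (profile_add P Q) = profile_add (counts P) (counts Q)"
  by (cases P; cases Q) simp

lemma counted_empty: "counted {#} {#} 0 0 0 0 0 0 0 0 0 0 0 0 0 0 0 0 False"
  by (rule countedI[OF spider_empty]) auto

context
  fixes A B s N H W T f N' H' W' T' g \<sigma> \<tau> \<rho> m l z
  assumes counted: "counted A B s N H W T f N' H' W' T' g \<sigma> \<tau> \<rho> m l z"
begin

lemma counted_Sa:
  assumes "v = 1 \<or> v = Suc k"
  shows "counted (add_mset (2 * k + 1) A) B s (Suc N) H W T (f + k * (N + H) + N + v) N' H' W' T' (g + k * (N' + H') + N')
      (\<sigma> + Suc k) (\<tau> + Suc k) (\<rho> + (2 * k + 1)) (m + (2 * k + 1)) (lift_bound l (2 * k + 1)) z"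
proof -
  obtain P Q where *: "spider A B s P Q \<sigma> \<tau> \<rho> m l z" "counts P = (N, H, W, T, f)" "counts Q = (N', H', W', T', g)"
    by (rule countedE[OF counted])
  show ?thesis by (rule countedI[OF spider_Sa[OF *(1) assms]]) (simp_all add: counts_padd counts_upd * algebra_simps)
qed

lemma counted_Sb:
  assumes "v = 1 \<or> v = Suc k"
  shows "counted A (add_mset (2 * k + 1) B) s N H W T (f + k * (N + H) + N) (Suc N') H' W' T' (g + k * (N' + H') + N' + v)
      (\<sigma> + Suc k) (\<tau> + Suc k) (\<rho> + (2 * k + 1)) (m + (2 * k + 1)) (lift_bound l (2 * k + 1)) z"
proof -
  obtain P Q where *: "spider A B s P Q \<sigma> \<tau> \<rho> m l z" "counts P = (N, H, W, T, f)" "counts Q = (N', H', W', T', g)"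
    by (rule countedE[OF counted])
  show ?thesis by (rule countedI[OF spider_Sb[OF *(1) assms]]) (simp_all add: counts_padd counts_upd * algebra_simps)
qed

lemma counted_Ea:
  "counted (add_mset (2 * k + 2) A) B s (Suc N) (Suc H) W T (f + Suc k * (N + H) + (\<tau> + (2 * k + 2))) N' H' W' T' (g + Suc k * (N' + H'))
      (\<sigma> + Suc k) (\<tau> + Suc k) (\<rho> + (2 * k + 2)) (m + (2 * k + 2)) (lift_bound l (2 * k + 2)) z"
proof -
  obtain P Q where *: "spider A B s P Q \<sigma> \<tau> \<rho> m l z" "counts P = (N, H, W, T, f)" "counts Q = (N', H', W', T', g)"
    by (rule countedE[OF counted])
  show ?thesis by (rule countedI[OF spider_Ea[OF *(1), where k=k]]) (simp_all add: counts_padd counts_upd * algebra_simps)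
qed

lemma counted_Eb:
  "counted A (add_mset (2 * k + 2) B) s N H W T (f + Suc k * (N + H)) (Suc N') (Suc H') W' T' (g + Suc k * (N' + H') + (\<tau> + (2 * k + 2)))
      (\<sigma> + Suc k) (\<tau> + Suc k) (\<rho> + (2 * k + 2)) (m + (2 * k + 2)) (lift_bound l (2 * k + 2)) z"
proof -
  obtain P Q where *: "spider A B s P Q \<sigma> \<tau> \<rho> m l z" "counts P = (N, H, W, T, f)" "counts Q = (N', H', W', T', g)"
    by (rule countedE[OF counted])
  show ?thesis by (rule countedI[OF spider_Eb[OF *(1), where k=k]]) (simp_all add: counts_padd counts_upd * algebra_simps)
qed

lemma counted_La:
  assumes "\<not> z"
  shows "counted (add_mset (2 * k + 3) A) B s (Suc N) (Suc H) W (Suc T) (f + Suc k * (N + H) + T + (\<rho> + (2 * k + 3))) N' H' W' T' (g + Suc k * (N' + H') + T')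
      (\<sigma> + Suc k) (\<tau> + Suc k) (\<rho> + (2 * k + 2)) (m + (2 * k + 3)) (max (lift_bound l (2 * k + 2)) (\<tau> + (2 * k + 2))) z"
proof -
  obtain P Q where *: "spider A B s P Q \<sigma> \<tau> \<rho> m l z" "counts P = (N, H, W, T, f)" "counts Q = (N', H', W', T', g)"
    by (rule countedE[OF counted])
  show ?thesis by (rule countedI[OF spider_La[OF *(1) assms, where k=k]]) (simp_all add: counts_padd counts_upd * algebra_simps)
qed

lemma counted_Lb:
  assumes "\<not> z"
  shows "counted A (add_mset (2 * k + 3) B) s N H W T (f + Suc k * (N + H) + T) (Suc N') (Suc H') W' (Suc T') (g + Suc k * (N' + H') + T' + (\<rho> + (2 * k + 3)))
      (\<sigma> + Suc k) (\<tau> + Suc k) (\<rho> + (2 * k + 2)) (m + (2 * k + 3)) (max (lift_bound l (2 * k + 2)) (\<tau> + (2 * k + 2))) z"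
proof -
  obtain P Q where *: "spider A B s P Q \<sigma> \<tau> \<rho> m l z" "counts P = (N, H, W, T, f)" "counts Q = (N', H', W', T', g)"
    by (rule countedE[OF counted])
  show ?thesis by (rule countedI[OF spider_Lb[OF *(1) assms, where k=k]]) (simp_all add: counts_padd counts_upd * algebra_simps)
qed

lemma counted_Ma: "counted (add_mset 1 A) B s (Suc N) H (Suc W) T (f + H + Suc \<tau>) N' H' W' T' (g + H') \<sigma> (Suc \<tau>) (Suc \<rho>) (Suc m) (lift_bound l 1) z"
proof -
  obtain P Q where *: "spider A B s P Q \<sigma> \<tau> \<rho> m l z" "counts P = (N, H, W, T, f)" "counts Q = (N', H', W', T', g)"
    by (rule countedE[OF counted])
  show ?thesis by (rule countedI[OF spider_Ma[OF *(1)]]) (simp_all add: counts_padd counts_upd * algebra_simps)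
qed

lemma counted_Mb: "counted A (add_mset 1 B) s N H W T (f + H) (Suc N') H' (Suc W') T' (g + H' + Suc \<tau>) \<sigma> (Suc \<tau>) (Suc \<rho>) (Suc m) (lift_bound l 1) z"
proof -
  obtain P Q where *: "spider A B s P Q \<sigma> \<tau> \<rho> m l z" "counts P = (N, H, W, T, f)" "counts Q = (N', H', W', T', g)"
    by (rule countedE[OF counted])
  show ?thesis by (rule countedI[OF spider_Mb[OF *(1)]]) (simp_all add: counts_padd counts_upd * algebra_simps)
qed

lemma counted_COa:
  assumes "s = 0"
  shows "counted A B (2 * k + 1) (Suc N) (Suc H) W T (f + k * (N + H) + H + (\<tau> + (2 * k + 1))) (Suc N') (Suc H') W' T' (g + k * (N' + H') + H' + (\<tau> + (k + 1)))
      (\<sigma> + k) (\<tau> + k) (\<rho> + (2 * k + 1)) (m + (2 * k + 1)) (lift_bound l (2 * k + 1)) z"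
proof -
  obtain P Q where *: "spider A B s P Q \<sigma> \<tau> \<rho> m l z" "counts P = (N, H, W, T, f)" "counts Q = (N', H', W', T', g)"
    by (rule countedE[OF counted])
  show ?thesis by (rule countedI[OF spider_COa[OF *(1) assms, where k=k]]) (simp_all add: counts_padd counts_upd * algebra_simps)
qed

lemma counted_CLa:
  assumes "s = 0" "\<not> z"
  shows "counted A B (2 * k + 2) (Suc N) (Suc H) W (Suc T) (f + k * (N + H) + H + T + (\<rho> + (2 * k + 2))) (Suc N') (Suc H') W' T' (g + k * (N' + H') + H' + T' + (\<tau> + (k + 1)))
      (\<sigma> + k) (\<tau> + k) (\<rho> + (2 * k + 1)) (m + (2 * k + 2)) (max (lift_bound l (2 * k + 1)) (\<tau> + (2 * k + 1))) z"
proof -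
  obtain P Q where *: "spider A B s P Q \<sigma> \<tau> \<rho> m l z" "counts P = (N, H, W, T, f)" "counts Q = (N', H', W', T', g)"
    by (rule countedE[OF counted])
  show ?thesis by (rule countedI[OF spider_CLa[OF *(1) assms, where k=k]]) (simp_all add: counts_padd counts_upd * algebra_simps)
qed

lemma counted_CLb:
  assumes "s = 0" "\<not> z"
  shows "counted A B (2 * k + 2) (Suc N) (Suc H) W T (f + k * (N + H) + H + T + (\<tau> + (k + 1))) (Suc N') (Suc H') W' (Suc T') (g + k * (N' + H') + H' + T' + (\<rho> + (2 * k + 2)))
      (\<sigma> + k) (\<tau> + k) (\<rho> + (2 * k + 1)) (m + (2 * k + 2)) (max (lift_bound l (2 * k + 1)) (\<tau> + (2 * k + 1))) z"
proof -
  obtain P Q where *: "spider A B s P Q \<sigma> \<tau> \<rho> m l z" "counts P = (N, H, W, T, f)" "counts Q = (N', H', W', T', g)"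
    by (rule countedE[OF counted])
  show ?thesis by (rule countedI[OF spider_CLb[OF *(1) assms, where k=k]]) (simp_all add: counts_padd counts_upd * algebra_simps)
qed

lemma counted_CPa:
  assumes "s = 0"
  shows "counted A B (2 * k + 2) (Suc N) H W T (f + Suc k * (N + H) + Suc k) (Suc N') (Suc H') W' T' (g + Suc k * (N' + H') + (\<tau> + (k + 2)))
      (\<sigma> + Suc k) (\<tau> + Suc k) (\<rho> + (2 * k + 2)) (m + (2 * k + 2)) (lift_bound l (2 * k + 2)) z"
proof -
  obtain P Q where *: "spider A B s P Q \<sigma> \<tau> \<rho> m l z" "counts P = (N, H, W, T, f)" "counts Q = (N', H', W', T', g)"
    by (rule countedE[OF counted])
  show ?thesis by (rule countedI[OF spider_CPa[OF *(1) assms, where k=k]]) (simp_all add: counts_padd counts_upd * algebra_simps)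
qed

lemma counted_CPb:
  assumes "s = 0"
  shows "counted A B (2 * k + 2) (Suc N) (Suc H) W T (f + Suc k * (N + H) + (\<tau> + (k + 2))) (Suc N') H' W' T' (g + Suc k * (N' + H') + Suc k)
      (\<sigma> + Suc k) (\<tau> + Suc k) (\<rho> + (2 * k + 2)) (m + (2 * k + 2)) (lift_bound l (2 * k + 2)) z"
proof -
  obtain P Q where *: "spider A B s P Q \<sigma> \<tau> \<rho> m l z" "counts P = (N, H, W, T, f)" "counts Q = (N', H', W', T', g)"
    by (rule countedE[OF counted])
  show ?thesis by (rule countedI[OF spider_CPb[OF *(1) assms, where k=k]]) (simp_all add: counts_padd counts_upd * algebra_simps)
qed

lemma counted_Z:
  "counted (add_mset (2 * k + 4) A) (add_mset 1 B) s
      (Suc N) H (Suc W) T (f + Suc k * (N + H) + W + 2 * H + T + (\<sigma> + (k + 2)))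
      (Suc N') H' (Suc W') T' (g + Suc k * (N' + H') + W' + 2 * H' + T' + (\<tau> + (k + 3)))
     (\<sigma> + Suc k) (\<tau> + (k + 3)) (\<rho> + (2 * k + 4)) (m + (2 * k + 5)) (max (lift_bound l (2 * k + 4)) (\<tau> + (2 * k + 4))) True"
proof -
  obtain P Q where *: "spider A B s P Q \<sigma> \<tau> \<rho> m l z" "counts P = (N, H, W, T, f)" "counts Q = (N', H', W', T', g)"
    by (rule countedE[OF counted])
  show ?thesis by (rule countedI[OF spider_Z[OF *(1), where k=k]]) (simp_all add: counts_padd counts_upd * algebra_simps)
qed

lemma counted_ord: "\<sigma> \<le> \<tau>" "\<tau> \<le> \<rho>" "\<rho> \<le> m"
  using counted by (auto elim!: countedE dest: spider_ord)

end

section \<open>Inequalities that survive insertions\<close>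

text \<open>\<open>\<sigma> + \<rho>\<close>, \<open>\<tau> + \<rho>\<close> and
  \<open>l + m\<close> bound the three intervals of adjacent sums from above; an interval that is
  not in use imposes nothing on \<open>f\<close>.\<close>

definition finished :: "nat multiset \<Rightarrow> nat multiset \<Rightarrow> nat \<Rightarrow> bool" where
  "finished A B s \<longleftrightarrow> s > 0 \<and> (\<exists>N H W T f N' H' W' T' g \<sigma> \<tau> \<rho> m l z.
     counted A B s N H W T f N' H' W' T' g \<sigma> \<tau> \<rho> m l z \<and>
     \<sigma> + \<rho> < f \<and> (z \<longrightarrow> \<tau> + \<rho> < f) \<and> (l > 0 \<longrightarrow> l + m < f) \<and> f < g)"

text \<open>The last four conditions are what \<open>wide_lists_insert\<close> consumes and
  reproduces.\<close>

definition finished_wide :: "nat multiset \<Rightarrow> nat multiset \<Rightarrow> nat \<Rightarrow> bool" where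
  "finished_wide A B s \<longleftrightarrow> s > 0 \<and> (\<exists>N H W T f N' H' W' T' g \<sigma> \<tau> \<rho> m l z.
     counted A B s N H W T f N' H' W' T' g \<sigma> \<tau> \<rho> m l z \<and>
     \<tau> + \<rho> < f \<and> l + m < f \<and> f < g \<and> 2 \<le> N \<and> 1 \<le> H \<and> N \<le> N' \<and> N + H \<le> N' + H' + 1)"

text \<open>Every operation changes the two centre sums by fixed multiples of these counts, so the conditions on the
  counts keep \<open>f < g\<close> true; \<open>e\<close> is the number of odd legs that may still be added at the first centre before
  the second one gets another leg.\<close>

definition even_bounds :: "nat \<Rightarrow> nat \<Rightarrow> nat \<Rightarrow> nat \<Rightarrow> nat \<Rightarrow> nat \<Rightarrow> nat \<Rightarrow> nat \<Rightarrow> nat \<Rightarrow> nat \<Rightarrow> nat \<Rightarrow> nat \<Rightarrow> nat \<Rightarrow> nat \<Rightarrow> nat \<Rightarrow> nat \<Rightarrow> bool" where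
  "even_bounds e N H W T f N' H' W' T' g \<sigma> \<tau> \<rho> m l \<longleftrightarrow>
     \<tau> + \<rho> < f \<and> l + m < f \<and> f < g \<and> 2 \<le> H \<and> H \<le> N \<and> N + 1 + e \<le> N' \<and> N + H + e \<le> N' + H' \<and> T \<le> T' + 1 \<and>
     2 * H + W + T + \<sigma> \<le> 2 * H' + W' + T' + \<tau> + 1 \<and> m \<le> \<rho> + \<sigma> + 1"

definition even_state :: "nat \<Rightarrow> nat multiset \<Rightarrow> nat multiset \<Rightarrow> nat \<Rightarrow> bool \<Rightarrow> bool" where
  "even_state e A B s z \<longleftrightarrow> s > 0 \<and> (\<exists>N H W T f N' H' W' T' g \<sigma> \<tau> \<rho> m l.
     counted A B s N H W T f N' H' W' T' g \<sigma> \<tau> \<rho> m l z \<and> even_bounds e N H W T f N' H' W' T' g \<sigma> \<tau> \<rho> m l)"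

lemma even_stateI: "counted A B s N H W T f N' H' W' T' g \<sigma> \<tau> \<rho> m l z \<Longrightarrow> even_bounds e N H W T f N' H' W' T' g \<sigma> \<tau> \<rho> m l \<Longrightarrow> s > 0 \<Longrightarrow> even_state e A B s z"
  unfolding even_state_def by blast

lemma even_stateE:
  assumes "even_state e A B s z"
  obtains N H W T f N' H' W' T' g \<sigma> \<tau> \<rho> m l where "counted A B s N H W T f N' H' W' T' g \<sigma> \<tau> \<rho> m l z"
    "even_bounds e N H W T f N' H' W' T' g \<sigma> \<tau> \<rho> m l" "s > 0"
  using assms unfolding even_state_def by blast

lemma lift_bound_le: "lift_bound l c \<le> l + c" by (simp add: lift_bound_def)

lemma even_state_weaken: "even_state (Suc e) A B s z \<Longrightarrow> even_state e A B s z"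
  by (elim even_stateE, erule even_stateI) (auto simp: even_bounds_def)

text \<open>An insertion with parameter \<open>k\<close> raises \<open>l + m\<close> by about
  \<open>4 * k\<close> and \<open>f\<close> by at least \<open>k * (N + H)\<close>; this is why the
  bounds make \<open>N + H\<close> at least 4.\<close>

lemma even_bounds_facts:
  assumes "even_bounds e N H W T f N' H' W' T' g \<sigma> \<tau> \<rho> m l"
  shows "k * (N + H) \<le> k * (N' + H')" "4 * k \<le> k * (N + H)"
proof -
  have "N + H \<le> N' + H'" "4 \<le> N + H" using assms by (auto simp: even_bounds_def)
  then show "k * (N + H) \<le> k * (N' + H')" "4 * k \<le> k * (N + H)"
    by (simp_all add: mult.commute[of 4])
qed

text \<open>Here and below, \<open>X\<close>, \<open>Y\<close>, \<open>U\<close>, \<open>V\<close>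
  stand for products such as \<open>k * (N + H)\<close>, so that only linear arithmetic
  remains.\<close>

lemma even_bounds_Sb:
  assumes "even_bounds e N H W T f N' H' W' T' g \<sigma> \<tau> \<rho> m l" "X \<le> Y" "4 * k \<le> X" "l' \<le> l + (2 * k + 1)"
  shows "even_bounds (Suc e) N H W T (f + X + N) (Suc N') H' W' T' (g + Y + N' + 1)
    (\<sigma> + Suc k) (\<tau> + Suc k) (\<rho> + (2 * k + 1)) (m + (2 * k + 1)) l'"
  using assms unfolding even_bounds_def by auto

lemma even_bounds_Sa:
  assumes "even_bounds (Suc e) N H W T f N' H' W' T' g \<sigma> \<tau> \<rho> m l" "X \<le> Y" "4 * k \<le> X" "l' \<le> l + (2 * k + 1)"
  shows "even_bounds e (Suc N) H W T (f + X + N + 1) N' H' W' T' (g + Y + N')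
    (\<sigma> + Suc k) (\<tau> + Suc k) (\<rho> + (2 * k + 1)) (m + (2 * k + 1)) l'"
  using assms unfolding even_bounds_def by auto

lemma even_bounds_Eb:
  assumes "even_bounds e N H W T f N' H' W' T' g \<sigma> \<tau> \<rho> m l" "X \<le> Y" "4 * Suc k \<le> X" "l' \<le> l + (2 * k + 2)"
  shows "even_bounds (Suc e) N H W T (f + X) (Suc N') (Suc H') W' T' (g + Y + (\<tau> + (2 * k + 2)))
    (\<sigma> + Suc k) (\<tau> + Suc k) (\<rho> + (2 * k + 2)) (m + (2 * k + 2)) l'"
  using assms unfolding even_bounds_def by auto

text \<open>The order matters: the second centre gets its leg first and so has two more counted
  labels when the other leg is inserted. The resulting gain of \<open>2 * Suc j\<close> makes up for
  the later, larger label at the first centre.\<close>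

lemma even_bounds_EE:
  assumes "even_bounds e N H W T f N' H' W' T' g \<sigma> \<tau> \<rho> m l" "X \<le> Y" "4 * Suc k \<le> X" "U + 2 * Suc j \<le> V" "4 * Suc j \<le> U"
    "l' \<le> l + (2 * k + 2) + (2 * j + 2)"
  shows "even_bounds e (Suc N) (Suc H) W T (f + X + U + (\<tau> + Suc k + (2 * j + 2))) (Suc N') (Suc H') W' T'
    (g + Y + (\<tau> + (2 * k + 2)) + V) (\<sigma> + Suc k + Suc j) (\<tau> + Suc k + Suc j)
    (\<rho> + (2 * k + 2) + (2 * j + 2)) (m + (2 * k + 2) + (2 * j + 2)) l'"
  using assms unfolding even_bounds_def by auto

lemma even_bounds_EL:
  assumes "even_bounds e N H W T f N' H' W' T' g \<sigma> \<tau> \<rho> m l" "X \<le> Y" "4 * Suc k \<le> X" "U + 2 * Suc j \<le> V" "4 * Suc j \<le> U"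
    "l' \<le> l + (2 * k + 2) + (2 * j + 2) \<or> l' \<le> \<tau> + (2 * k + 2) + (2 * j + 2)" "\<tau> \<le> \<rho>"
  shows "even_bounds e (Suc N) (Suc H) W T (f + X + T + U + (\<tau> + Suc k + (2 * j + 2))) (Suc N') (Suc H') W' (Suc T')
    (g + Y + T' + (\<rho> + (2 * k + 3)) + V) (\<sigma> + Suc k + Suc j) (\<tau> + Suc k + Suc j)
    (\<rho> + (2 * k + 2) + (2 * j + 2)) (m + (2 * k + 3) + (2 * j + 2)) l'"
  using assms(6)
proof
  assume "l' \<le> l + (2 * k + 2) + (2 * j + 2)"
  then show ?thesis using assms(1-5,7) unfolding even_bounds_def by auto
next
  assume "l' \<le> \<tau> + (2 * k + 2) + (2 * j + 2)"
  then show ?thesis using assms(1-5,7) unfolding even_bounds_def by auto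
qed

text \<open>Two clauses of \<open>even_bounds\<close> are made for this step. The comparison of
  \<open>2 * H + W + T + \<sigma>\<close> with its counterpart is what \<open>f < g\<close> needs
  here. If the new bound \<open>l'\<close> comes from \<open>\<tau>\<close>, then
  \<open>m \<le> \<rho> + \<sigma> + 1\<close>, a bound on the number of top labels, reduces
  \<open>\<tau> + m\<close> to \<open>\<tau> + \<rho>\<close> and \<open>\<sigma>\<close>, and
  \<open>f\<close> gains \<open>\<sigma>\<close>.\<close>

lemma even_bounds_Z:
  assumes "even_bounds e N H W T f N' H' W' T' g \<sigma> \<tau> \<rho> m l" "X \<le> Y" "4 * Suc k \<le> X"
    "l' \<le> l + (2 * k + 4) \<or> l' \<le> \<tau> + (2 * k + 4)" "\<sigma> \<le> \<tau>"
  shows "even_bounds e (Suc N) H (Suc W) T (f + X + W + 2 * H + T + (\<sigma> + (k + 2))) (Suc N') H' (Suc W') T'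
    (g + Y + W' + 2 * H' + T' + (\<tau> + (k + 3))) (\<sigma> + Suc k) (\<tau> + (k + 3)) (\<rho> + (2 * k + 4)) (m + (2 * k + 5)) l'"
  using assms(4)
proof
  assume "l' \<le> l + (2 * k + 4)"
  then show ?thesis using assms(1-3,5) unfolding even_bounds_def by auto
next
  assume "l' \<le> \<tau> + (2 * k + 4)"
  then show ?thesis using assms(1-3,5) unfolding even_bounds_def by auto
qed

lemma even_state_Sb: "even_state e A B s z \<Longrightarrow> even_state (Suc e) A (add_mset (2 * k + 1) B) s z"
  by (elim even_stateE) (rule even_stateI[OF counted_Sb[where v=1] even_bounds_Sb]; (assumption | rule even_bounds_facts lift_bound_le | simp))

lemma even_state_Sa: "even_state (Suc e) A B s z \<Longrightarrow> even_state e (add_mset (2 * k + 1) A) B s z"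
  by (elim even_stateE) (rule even_stateI[OF counted_Sa[where v=1] even_bounds_Sa]; (assumption | rule even_bounds_facts lift_bound_le | simp))

lemma even_state_Eb: "even_state e A B s z \<Longrightarrow> even_state (Suc e) A (add_mset (2 * k + 2) B) s z"
  by (elim even_stateE) (rule even_stateI[OF counted_Eb even_bounds_Eb]; (assumption | rule even_bounds_facts lift_bound_le))

lemma even_state_EE:
  assumes "even_state e A B s z"
  shows "even_state e (add_mset (2 * j + 2) A) (add_mset (2 * k + 2) B) s z"
  using assms
proof (rule even_stateE)
  fix N H W T f N' H' W' T' g \<sigma> \<tau> \<rho> m l
  assume spider: "counted A B s N H W T f N' H' W' T' g \<sigma> \<tau> \<rho> m l z" and c: "even_bounds e N H W T f N' H' W' T' g \<sigma> \<tau> \<rho> m l" and s: "s > 0"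
  have "Suc j * (N + H) + 2 * Suc j \<le> Suc j * (Suc N' + Suc H')"
    using even_bounds_facts(1)[OF c, of "Suc j"] by (simp add: algebra_simps)
  then show ?thesis
    by (rule even_stateI[OF counted_Ea[OF counted_Eb[OF spider, of k], of j] even_bounds_EE[OF c even_bounds_facts(1)[OF c] even_bounds_facts(2)[OF c] _ even_bounds_facts(2)[OF c]] s])
      (use lift_bound_le[of l "2 * k + 2"] lift_bound_le[of "lift_bound l (2 * k + 2)" "2 * j + 2"] in linarith)
qed

lemma even_state_EL:
  assumes "even_state e A B s False"
  shows "even_state e (add_mset (2 * j + 2) A) (add_mset (2 * k + 3) B) s False"
  using assms
proof (rule even_stateE)
  fix N H W T f N' H' W' T' g \<sigma> \<tau> \<rho> m l
  assume spider: "counted A B s N H W T f N' H' W' T' g \<sigma> \<tau> \<rho> m l False" and c: "even_bounds e N H W T f N' H' W' T' g \<sigma> \<tau> \<rho> m l" and s: "s > 0"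
  let ?l = "max (lift_bound l (2 * k + 2)) (\<tau> + (2 * k + 2))"
  have "Suc j * (N + H) + 2 * Suc j \<le> Suc j * (Suc N' + Suc H')"
    using even_bounds_facts(1)[OF c, of "Suc j"] by (simp add: algebra_simps)
  moreover have "lift_bound ?l (2 * j + 2) \<le> l + (2 * k + 2) + (2 * j + 2) \<or> lift_bound ?l (2 * j + 2) \<le> \<tau> + (2 * k + 2) + (2 * j + 2)"
    using lift_bound_le[of l "2 * k + 2"] lift_bound_le[of ?l "2 * j + 2"] by linarith
  ultimately show ?thesis
    by (intro even_stateI[OF counted_Ea[OF counted_Lb[OF spider, of k], of j] even_bounds_EL[OF c even_bounds_facts(1)[OF c] even_bounds_facts(2)[OF c] _ even_bounds_facts(2)[OF c]] s])
      (use counted_ord[OF spider] in simp_all)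
qed

lemma even_state_Z:
  assumes "even_state e A B s z"
  shows "even_state e (add_mset (2 * k + 4) A) (add_mset 1 B) s True"
  using assms
proof (rule even_stateE)
  fix N H W T f N' H' W' T' g \<sigma> \<tau> \<rho> m l
  assume spider: "counted A B s N H W T f N' H' W' T' g \<sigma> \<tau> \<rho> m l z" and c: "even_bounds e N H W T f N' H' W' T' g \<sigma> \<tau> \<rho> m l" and s: "s > 0"
  have "max (lift_bound l (2 * k + 4)) (\<tau> + (2 * k + 4)) \<le> l + (2 * k + 4) \<or> max (lift_bound l (2 * k + 4)) (\<tau> + (2 * k + 4)) \<le> \<tau> + (2 * k + 4)"
    using lift_bound_le[of l "2 * k + 4"] by linarith
  then show ?thesis
    by (rule even_stateI[OF counted_Z[OF spider, of k] even_bounds_Z[OF c even_bounds_facts(1)[OF c] even_bounds_facts(2)[OF c]] s]) (rule counted_ord[OF spider])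
qed

lemma even_state_finished_wide:
  assumes "even_state e A B s z"
  shows "finished_wide A B s"
  using assms unfolding finished_wide_def
  by (elim even_stateE) (rule conjI, assumption, (rule exI)+, rule conjI, assumption, auto simp: even_bounds_def)

text \<open>This spends the surplus \<open>N + 1 \<le> N'\<close>: the bounds of
  \<open>even_state\<close> are given up, but those of \<open>finished_wide\<close> are still
  reached.\<close>

lemma even_state_lone:
  assumes "even_state e A B s z"
  shows "finished_wide (add_mset (2 * k + 1) A) B s"
  using assms
proof (rule even_stateE)
  fix N H W T f N' H' W' T' g \<sigma> \<tau> \<rho> m l
  assume spider: "counted A B s N H W T f N' H' W' T' g \<sigma> \<tau> \<rho> m l z" and c: "even_bounds e N H W T f N' H' W' T' g \<sigma> \<tau> \<rho> m l" and s: "s > 0"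
  define X Y l' where d: "X = k * (N + H)" "Y = k * (N' + H')" "l' = lift_bound l (2 * k + 1)"
  have "X \<le> Y" "4 * k \<le> X" "l' \<le> l + (2 * k + 1)" unfolding d by (rule even_bounds_facts[OF c] lift_bound_le)+
  then have "\<tau> + Suc k + (\<rho> + (2 * k + 1)) < f + X + N + 1 \<and> l' + (m + (2 * k + 1)) < f + X + N + 1 \<and>
      f + X + N + 1 < g + Y + N' \<and> 2 \<le> Suc N \<and> 1 \<le> H \<and> Suc N \<le> N' \<and> Suc N + H \<le> N' + H' + 1"
    using c unfolding even_bounds_def by auto
  with counted_Sa[OF spider, of 1 k] s show ?thesis unfolding finished_wide_def d by blast
qed

text \<open>With \<open>z\<close> never set and \<open>l = 0\<close>, the sum \<open>f\<close> only
  has to stay above \<open>\<sigma> + \<rho>\<close>, which an odd leg raises by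
  \<open>3 * k + 2\<close>; hence \<open>3 \<le> N + H\<close> and \<open>2 \<le> N\<close>. Once
  \<open>l > 0\<close>, the faster growth of \<open>l + m\<close> asks for
  \<open>N + H \<ge> 4\<close>. Unlike in \<open>even_bounds\<close>, equal numbers of edges at the
  centres are allowed.\<close>

definition odd_bounds :: "nat \<Rightarrow> nat \<Rightarrow> nat \<Rightarrow> nat \<Rightarrow> nat \<Rightarrow> nat \<Rightarrow> nat \<Rightarrow> nat \<Rightarrow> nat \<Rightarrow> nat \<Rightarrow> nat \<Rightarrow> bool" where
  "odd_bounds e N H f N' H' g \<sigma> \<rho> m l \<longleftrightarrow>
     \<sigma> + \<rho> < f \<and> f < g \<and> 2 \<le> N \<and> 3 \<le> N + H \<and> N + e \<le> N' \<and> N + H + e \<le> N' + H' \<and>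
     (l = 0 \<or> 3 \<le> N \<and> 1 \<le> H \<and> l + m < f)"

definition odd_state :: "nat \<Rightarrow> nat multiset \<Rightarrow> nat multiset \<Rightarrow> nat \<Rightarrow> bool" where
  "odd_state e A B s \<longleftrightarrow> s > 0 \<and> (\<exists>N H W T f N' H' W' T' g \<sigma> \<tau> \<rho> m l.
     counted A B s N H W T f N' H' W' T' g \<sigma> \<tau> \<rho> m l False \<and> odd_bounds e N H f N' H' g \<sigma> \<rho> m l)"

lemma odd_stateI: "counted A B s N H W T f N' H' W' T' g \<sigma> \<tau> \<rho> m l False \<Longrightarrow> odd_bounds e N H f N' H' g \<sigma> \<rho> m l \<Longrightarrow> s > 0 \<Longrightarrow> odd_state e A B s"
  unfolding odd_state_def by blast

lemma odd_stateE:
  assumes "odd_state e A B s"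
  obtains N H W T f N' H' W' T' g \<sigma> \<tau> \<rho> m l where "counted A B s N H W T f N' H' W' T' g \<sigma> \<tau> \<rho> m l False"
    "odd_bounds e N H f N' H' g \<sigma> \<rho> m l" "s > 0"
  using assms unfolding odd_state_def by blast

lemma lift_bound_0 [simp]: "lift_bound 0 c = 0" by (simp add: lift_bound_def)

lemma lift_bound_cases: "l = 0 \<and> lift_bound l c = 0 \<or> l > 0 \<and> lift_bound l c = l + c" by (simp add: lift_bound_def)

lemma odd_bounds_facts:
  assumes "odd_bounds e N H f N' H' g \<sigma> \<rho> m l"
  shows "k * (N + H) \<le> k * (N' + H')" "3 * k \<le> k * (N + H) \<and> (l > 0 \<longrightarrow> 4 * k \<le> k * (N + H))"
proof -
  have "N + H \<le> N' + H'" "3 \<le> N + H" "l > 0 \<longrightarrow> 4 \<le> N + H" using assms by (auto simp: odd_bounds_def)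
  then show "k * (N + H) \<le> k * (N' + H')" "3 * k \<le> k * (N + H) \<and> (l > 0 \<longrightarrow> 4 * k \<le> k * (N + H))"
    by (simp_all add: mult.commute[of 3] mult.commute[of 4])
qed

lemma odd_bounds_Sb:
  assumes "odd_bounds e N H f N' H' g \<sigma> \<rho> m l" "X \<le> Y" "3 * k \<le> X \<and> (l > 0 \<longrightarrow> 4 * k \<le> X)"
    "l = 0 \<and> l' = 0 \<or> l > 0 \<and> l' = l + (2 * k + 1)"
  shows "odd_bounds (Suc e) N H (f + X + N) (Suc N') H' (g + Y + N' + 1)
    (\<sigma> + Suc k) (\<rho> + (2 * k + 1)) (m + (2 * k + 1)) l'"
  using assms unfolding odd_bounds_def by auto

lemma odd_bounds_Sa:
  assumes "odd_bounds (Suc e) N H f N' H' g \<sigma> \<rho> m l" "X \<le> Y" "3 * k \<le> X \<and> (l > 0 \<longrightarrow> 4 * k \<le> X)"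
    "l = 0 \<and> l' = 0 \<or> l > 0 \<and> l' = l + (2 * k + 1)"
  shows "odd_bounds e (Suc N) H (f + X + N + 1) N' H' (g + Y + N')
    (\<sigma> + Suc k) (\<rho> + (2 * k + 1)) (m + (2 * k + 1)) l'"
  using assms unfolding odd_bounds_def by auto

lemma odd_bounds_Eb:
  assumes "odd_bounds e N H f N' H' g \<sigma> \<rho> m l" "X \<le> Y" "3 * Suc k \<le> X \<and> (l > 0 \<longrightarrow> 4 * Suc k \<le> X)"
    "l = 0 \<and> l' = 0 \<or> l > 0 \<and> l' = l + (2 * k + 2)"
  shows "odd_bounds (Suc e) N H (f + X) (Suc N') (Suc H') (g + Y + (\<tau> + (2 * k + 2)))
    (\<sigma> + Suc k) (\<rho> + (2 * k + 2)) (m + (2 * k + 2)) l'"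
  using assms unfolding odd_bounds_def by auto

lemma odd_state_Sb: "odd_state e A B s \<Longrightarrow> odd_state (Suc e) A (add_mset (2 * k + 1) B) s"
  by (elim odd_stateE) (rule odd_stateI[OF counted_Sb[where v=1] odd_bounds_Sb]; (assumption | rule odd_bounds_facts lift_bound_cases | simp))

lemma odd_state_Sa: "odd_state (Suc e) A B s \<Longrightarrow> odd_state e (add_mset (2 * k + 1) A) B s"
  by (elim odd_stateE) (rule odd_stateI[OF counted_Sa[where v=1] odd_bounds_Sa]; (assumption | rule odd_bounds_facts lift_bound_cases | simp))

lemma odd_state_Eb: "odd_state e A B s \<Longrightarrow> odd_state (Suc e) A (add_mset (2 * k + 2) B) s"
  by (elim odd_stateE) (rule odd_stateI[OF counted_Eb odd_bounds_Eb]; (assumption | rule odd_bounds_facts lift_bound_cases))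

lemma odd_bounds_EE:
  assumes "odd_bounds e N H f N' H' g \<sigma> \<rho> m l" "X \<le> Y" "3 * Suc k \<le> X \<and> (l > 0 \<longrightarrow> 4 * Suc k \<le> X)"
    "U + 2 * Suc j \<le> V" "3 * Suc j \<le> U \<and> (l > 0 \<longrightarrow> 4 * Suc j \<le> U)"
    "l = 0 \<and> l' = 0 \<or> l > 0 \<and> l' = l + (2 * k + 2)" "l' = 0 \<and> l'' = 0 \<or> l' > 0 \<and> l'' = l' + (2 * j + 2)"
  shows "odd_bounds e (Suc N) (Suc H) (f + X + U + (\<tau> + Suc k + (2 * j + 2))) (Suc N') (Suc H')
    (g + Y + (\<tau> + (2 * k + 2)) + V) (\<sigma> + Suc k + Suc j) (\<rho> + (2 * k + 2) + (2 * j + 2)) (m + (2 * k + 2) + (2 * j + 2)) l''"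
  using assms unfolding odd_bounds_def by auto

lemma odd_state_EE:
  assumes "odd_state e A B s"
  shows "odd_state e (add_mset (2 * j + 2) A) (add_mset (2 * k + 2) B) s"
  using assms
proof (rule odd_stateE)
  fix N H W T f N' H' W' T' g \<sigma> \<tau> \<rho> m l
  assume spider: "counted A B s N H W T f N' H' W' T' g \<sigma> \<tau> \<rho> m l False" and c: "odd_bounds e N H f N' H' g \<sigma> \<rho> m l" and s: "s > 0"
  have "Suc j * (N + H) + 2 * Suc j \<le> Suc j * (Suc N' + Suc H')"
    using odd_bounds_facts(1)[OF c, of "Suc j"] by (simp add: algebra_simps)
  then show ?thesis
    by (rule odd_stateI[OF counted_Ea[OF counted_Eb[OF spider, of k], of j] odd_bounds_EE[OF c odd_bounds_facts(1)[OF c] odd_bounds_facts(2)[OF c] _ odd_bounds_facts(2)[OF c]] s])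
      (rule lift_bound_cases)+
qed

lemma odd_state_finished:
  assumes "odd_state e A B s"
  shows "finished A B s"
  using assms unfolding finished_def
  by (elim odd_stateE) (rule conjI, assumption, (rule exI)+, rule conjI, assumption, auto simp: odd_bounds_def)

section \<open>Small double spiders\<close>

lemma not_False: "\<not> False" by simp

text \<open>The names of the base cases give the parity of the core and then the legs at the two
  centres: \<open>E\<close> even, \<open>W\<close> odd, \<open>O\<close> odd and at least 3,
  \<open>1\<close> a pendant edge. Read from the inside, the nested rules are the order of
  insertion; this order and the choice of the end label at the centre (\<open>disjI1\<close> for 1,
  \<open>disjI2\<close> for \<open>Suc k\<close>) are made so that the bounds hold for all
  parameters at once.\<close>

lemma base_odd_E_11: "even_state 0 {#2 * k1 + 2#} {#1, 1#} (2 * k + 1) False"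
  by (rule even_stateI[OF counted_Mb[OF counted_Mb[OF counted_Ea[OF counted_COa[OF counted_empty refl, of k], of k1]]]])
    (simp_all add: even_bounds_def lift_bound_def max_def algebra_simps)

lemma base_odd_E_1E: "even_state 0 {#2 * k1 + 2#} {#1, 2 * k3 + 2#} (2 * k + 1) False"
  by (rule even_stateI[OF counted_Mb[OF counted_COa[OF counted_Eb[OF counted_Ea[OF counted_empty, of k1], of k3] refl, of k]]])
    (simp_all add: even_bounds_def lift_bound_def max_def algebra_simps)

lemma base_odd_E_OO: "even_state 0 {#2 * k1 + 2#} {#2 * k3 + 3, 2 * Suc k2 + 1#} (2 * k + 1) False"
  by (rule even_stateI[OF counted_Lb[OF counted_Sb[OF counted_Ea[OF counted_COa[OF counted_empty refl, of k], of k1] disjI1[OF refl], of "Suc k2"] not_False, of k3]])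
    (simp_all add: even_bounds_def lift_bound_def max_def algebra_simps)

lemma base_odd_E_OE: "even_state 0 {#2 * k1 + 2#} {#2 * k2 + 3, 2 * k3 + 2#} (2 * k + 1) False"
  by (rule even_stateI[OF counted_Lb[OF counted_Eb[OF counted_COa[OF counted_Ea[OF counted_empty, of k1] refl, of k], of k3] not_False, of k2]])
    (simp_all add: even_bounds_def lift_bound_def max_def algebra_simps)

lemma base_odd_E_EE: "even_state 0 {#2 * k1 + 2#} {#2 * k3 + 2, 2 * k2 + 2#} (2 * k + 1) False"
  by (rule even_stateI[OF counted_COa[OF counted_Eb[OF counted_Eb[OF counted_Ea[OF counted_empty, of k1], of k2], of k3] refl, of k]])
    (simp_all add: even_bounds_def lift_bound_def max_def algebra_simps)

lemma base_odd_OW_OW: "odd_state 0 {#2 * k2 + 1, 2 * k1 + 3#} {#2 * k3 + 3, 2 * k4 + 1#} (2 * k + 1)"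
  by (rule odd_stateI[OF counted_Lb[OF counted_Sa[OF counted_La[OF counted_COa[OF counted_Sb[OF counted_empty disjI1[OF refl], of k4] refl, of k] not_False, of k1] disjI1[OF refl], of k2] not_False, of k3]])
    (simp_all add: odd_bounds_def lift_bound_def max_def algebra_simps)

lemma base_odd_OW_EW: "odd_state 0 {#2 * k2 + 1, 2 * k1 + 3#} {#2 * k4 + 1, 2 * k3 + 2#} (2 * k + 1)"
  by (rule odd_stateI[OF counted_Sa[OF counted_La[OF counted_COa[OF counted_Sb[OF counted_Eb[OF counted_empty, of k3] disjI1[OF refl], of k4] refl, of k] not_False, of k1] disjI1[OF refl], of k2]])
    (simp_all add: odd_bounds_def lift_bound_def max_def algebra_simps)

lemma base_odd_OW_EE: "odd_state 0 {#2 * k1 + 3, 2 * k2 + 1#} {#2 * k4 + 2, 2 * k3 + 2#} (2 * k + 1)"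
  by (rule odd_stateI[OF counted_COa[OF counted_Eb[OF counted_La[OF counted_Eb[OF counted_Sa[OF counted_empty disjI1[OF refl], of k2], of k3] not_False, of k1], of k4] refl, of k]])
    (simp_all add: odd_bounds_def lift_bound_def max_def algebra_simps)

lemma base_odd_11_OW: "odd_state 0 {#1, 1#} {#2 * k3 + 3, 2 * k4 + 1#} (2 * k + 1)"
  by (rule odd_stateI[OF counted_Ma[OF counted_Ma[OF counted_Lb[OF counted_COa[OF counted_Sb[OF counted_empty disjI1[OF refl], of k4] refl, of k] not_False, of k3]]]])
    (simp_all add: odd_bounds_def lift_bound_def max_def algebra_simps)

lemma base_odd_11_EW: "odd_state 0 {#1, 1#} {#2 * k3 + 2, 2 * k4 + 1#} (2 * k + 1)"
  by (rule odd_stateI[OF counted_Ma[OF counted_Ma[OF counted_COa[OF counted_Eb[OF counted_Sb[OF counted_empty disjI2[OF refl], of k4], of k3] refl, of k]]]])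
    (simp_all add: odd_bounds_def lift_bound_def max_def algebra_simps)

lemma base_odd_11_EE: "odd_state 0 {#1, 1#} {#2 * k4 + 2, 2 * k3 + 2#} (2 * k + 1)"
  by (rule odd_stateI[OF counted_Ma[OF counted_Ma[OF counted_COa[OF counted_Eb[OF counted_Eb[OF counted_empty, of k3], of k4] refl, of k]]]])
    (simp_all add: odd_bounds_def lift_bound_def max_def algebra_simps)

text \<open>One pendant edge short at the first centre, in exchange for slack 1, which lets another
  odd leg be added there without a partner.\<close>

lemma base_odd_1_11: "odd_state 1 {#1#} {#1, 1#} (2 * k + 1)"
  by (rule odd_stateI[OF counted_Mb[OF counted_Mb[OF counted_Ma[OF counted_COa[OF counted_empty refl, of k]]]]])
    (simp_all add: odd_bounds_def lift_bound_def max_def algebra_simps)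

lemma base_odd_OW_111: "odd_state 0 {#2 * k2 + 1, 2 * k1 + 3#} {#1, 1, 1#} (2 * k + 1)"
  by (rule odd_stateI[OF counted_Mb[OF counted_Mb[OF counted_Mb[OF counted_Sa[OF counted_La[OF counted_COa[OF counted_empty refl, of k] not_False, of k1] disjI1[OF refl], of k2]]]]])
    (simp_all add: odd_bounds_def lift_bound_def max_def algebra_simps)

lemma base_odd_EE_EE: "odd_state 0 {#2 * k2 + 2, 2 * k1 + 2#} {#2 * k4 + 2, 2 * k3 + 2#} (2 * k + 1)"
  by (rule odd_stateI[OF counted_Ea[OF counted_COa[OF counted_Eb[OF counted_Ea[OF counted_Eb[OF counted_empty, of k3], of k1], of k4] refl, of k], of k2]])
    (simp_all add: odd_bounds_def lift_bound_def max_def algebra_simps)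

section \<open>Base cases with an even core\<close>

lemma base_even_E_OW: "even_state 0 {#2 * k1 + 2#} {#2 * k2 + 3, 2 * k3 + 1#} (2 * k + 2) False"
  by (rule even_stateI[OF counted_Lb[OF counted_CLa[OF counted_Ea[OF counted_Sb[OF counted_empty disjI1[OF refl], of k3], of k1] refl not_False, of k] not_False, of k2]])
    (simp_all add: even_bounds_def lift_bound_def max_def algebra_simps)

lemma base_even_E_EW: "even_state 0 {#2 * k1 + 2#} {#2 * k2 + 2, 2 * k3 + 1#} (2 * k + 2) False"
  by (rule even_stateI[OF counted_CLa[OF counted_Ea[OF counted_Eb[OF counted_Sb[OF counted_empty disjI2[OF refl], of k3], of k2], of k1] refl not_False, of k]])
    (simp_all add: even_bounds_def lift_bound_def max_def algebra_simps)

lemma base_even_E_EE: "even_state 0 {#2 * k1 + 2#} {#2 * k3 + 2, 2 * k2 + 2#} (2 * k + 2) False"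
  by (rule even_stateI[OF counted_CLa[OF counted_Eb[OF counted_Ea[OF counted_Eb[OF counted_empty, of k2], of k1], of k3] refl not_False, of k]])
    (simp_all add: even_bounds_def lift_bound_def max_def algebra_simps)

lemma base_even_EW_111: "even_state 0 {#2 * k2 + 1, 2 * k1 + 2#} {#1, 1, 1#} (2 * k + 2) False"
  by (rule even_stateI[OF counted_Mb[OF counted_Mb[OF counted_Mb[OF counted_Sa[OF counted_CLa[OF counted_Ea[OF counted_empty, of k1] refl not_False, of k] disjI1[OF refl], of k2]]]]])
    (simp_all add: even_bounds_def lift_bound_def max_def algebra_simps)

lemma base_even_EE_111: "even_state 0 {#2 * k2 + 2, 2 * k1 + 2#} {#1, 1, 1#} (2 * k + 2) False"
  by (rule even_stateI[OF counted_Mb[OF counted_Mb[OF counted_Mb[OF counted_Ea[OF counted_CPa[OF counted_Ea[OF counted_empty, of k1] refl, of k], of k2]]]]])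
    (simp_all add: even_bounds_def lift_bound_def max_def algebra_simps)

lemma base_even_OW_OW: "odd_state 0 {#2 * Suc k1 + 1, 2 * k2 + 1#} {#2 * k3 + 3, 2 * k4 + 1#} (2 * k + 2)"
  by (rule odd_stateI[OF counted_Lb[OF counted_CLa[OF counted_Sa[OF counted_Sb[OF counted_Sa[OF counted_empty disjI2[OF refl], of k2] disjI1[OF refl], of k4] disjI2[OF refl], of "Suc k1"] refl not_False, of k] not_False, of k3]])
    (simp_all add: odd_bounds_def lift_bound_def max_def algebra_simps)

lemma base_even_OW_EW: "odd_state 0 {#2 * k1 + 3, 2 * k2 + 1#} {#2 * k4 + 1, 2 * k3 + 2#} (2 * k + 2)"
  by (rule odd_stateI[OF counted_La[OF counted_CLb[OF counted_Sb[OF counted_Sa[OF counted_Eb[OF counted_empty, of k3] disjI1[OF refl], of k2] disjI1[OF refl], of k4] refl not_False, of k] not_False, of k1]])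
    (simp_all add: odd_bounds_def lift_bound_def max_def algebra_simps)

lemma base_even_OW_EE: "odd_state 0 {#2 * Suc k1 + 1, 2 * k2 + 1#} {#2 * k4 + 2, 2 * k3 + 2#} (2 * k + 2)"
  by (rule odd_stateI[OF counted_CLa[OF counted_Eb[OF counted_Eb[OF counted_Sa[OF counted_Sa[OF counted_empty disjI2[OF refl], of k2] disjI1[OF refl], of "Suc k1"], of k3], of k4] refl not_False, of k]])
    (simp_all add: odd_bounds_def lift_bound_def max_def algebra_simps)

lemma base_even_11_EW: "odd_state 0 {#1, 2 * 0 + 1#} {#2 * k3 + 2, 2 * k4 + 1#} (2 * k + 2)"
  by (rule odd_stateI[OF counted_Ma[OF counted_CLa[OF counted_Eb[OF counted_Sa[OF counted_Sb[OF counted_empty disjI2[OF refl], of k4] disjI1[OF refl], of 0], of k3] refl not_False, of k]]])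
    (simp_all add: odd_bounds_def lift_bound_def max_def algebra_simps)

lemma base_even_11_EE: "odd_state 0 {#1, 1#} {#2 * k4 + 2, 2 * k3 + 2#} (2 * k + 2)"
  by (rule odd_stateI[OF counted_Ma[OF counted_Ma[OF counted_CLa[OF counted_Eb[OF counted_Eb[OF counted_empty, of k3], of k4] refl not_False, of k]]]])
    (simp_all add: odd_bounds_def lift_bound_def max_def algebra_simps)

lemma base_even_11_OO: "odd_state 0 {#1, 1#} {#2 * k4 + 3, 2 * Suc k3 + 1#} (2 * k + 2)"
  by (rule odd_stateI[OF counted_Ma[OF counted_Ma[OF counted_CLa[OF counted_Lb[OF counted_Sb[OF counted_empty disjI2[OF refl], of "Suc k3"] not_False, of k4] refl not_False, of k]]]])
    (simp_all add: odd_bounds_def lift_bound_def max_def algebra_simps)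

lemma base_even_11_11: "odd_state 0 {#1, 1#} {#1, 1#} (2 * k + 2)"
  by (rule odd_stateI[OF counted_Ma[OF counted_Mb[OF counted_Mb[OF counted_Ma[OF counted_CPa[OF counted_empty refl, of k]]]]]])
    (simp_all add: odd_bounds_def lift_bound_def max_def algebra_simps)

lemma base_even_OW_111: "odd_state 0 {#2 * k2 + 1, 2 * k1 + 3#} {#1, 1, 1#} (2 * k + 2)"
  by (rule odd_stateI[OF counted_Mb[OF counted_Mb[OF counted_Mb[OF counted_Sa[OF counted_La[OF counted_CLa[OF counted_empty refl not_False, of k] not_False, of k1] disjI1[OF refl], of k2]]]]])
    (simp_all add: odd_bounds_def lift_bound_def max_def algebra_simps)

lemma base_even_EE_EE: "odd_state 0 {#2 * k2 + 2, 2 * k1 + 2#} {#2 * k4 + 2, 2 * k3 + 2#} (2 * k + 2)"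
  by (rule odd_stateI[OF counted_Ea[OF counted_CLa[OF counted_Ea[OF counted_Eb[OF counted_Eb[OF counted_empty, of k3], of k4], of k1] refl not_False, of k], of k2]])
    (simp_all add: odd_bounds_def lift_bound_def max_def algebra_simps)

lemma base_even_11_1O5: "odd_state 0 {#1, 1#} {#1, 2 * Suc k4 + 3#} (2 * k + 2)"
  by (rule odd_stateI[OF counted_Ma[OF counted_Ma[OF counted_Mb[OF counted_Lb[OF counted_CLa[OF counted_empty refl not_False, of k] not_False, of "Suc k4"]]]]])
    (simp_all add: odd_bounds_def lift_bound_def max_def algebra_simps)

text \<open>Together with \<open>base_even_11_1O5\<close> this covers two pendant edges against a
  pendant edge and a longer odd leg: there the long leg has length at least 5, here the core has
  length at least 6. A leg of length 3 with a core of length 2 or 4 is left over.\<close>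

lemma base_even_11_13: "odd_state 0 {#1, 1#} {#1, 2 * k4 + 3#} (2 * Suc (Suc k) + 2)"
  by (rule odd_stateI[OF counted_Ma[OF counted_Mb[OF counted_Ma[OF counted_Lb[OF counted_CPb[OF counted_empty refl, of "Suc (Suc k)"] not_False, of k4]]]]])
    (simp_all add: odd_bounds_def lift_bound_def max_def algebra_simps)

section \<open>Labellings by lists\<close>

text \<open>The sums are ordered by kind: leaves, whose sum is the label \<open>hd xs\<close>, then
  vertices of degree two, then the first centre, then the second. This respects degrees as long as
  the second centre has at least as many legs.\<close>

definition antimagic_lists :: "nat multiset \<Rightarrow> nat multiset \<Rightarrow> nat \<Rightarrow> bool" where
  "antimagic_lists A B s \<longleftrightarrow> (\<exists>LA LB C m. mset (map length LA) = A \<and> mset (map length LB) = B \<and> length C = s \<and>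
     distinct (concat (C # LA @ LB)) \<and> set (concat (C # LA @ LB)) = {1..m} \<and>
     distinct (concat (map adj (C # LA @ LB))) \<and> (\<forall>xs\<in>set (LA @ LB). xs \<noteq> []) \<and>
     (\<forall>xs\<in>set (LA @ LB). hd xs < sum_list (map last LA) + hd C \<and>
        (\<forall>t\<in>set (concat (map adj (C # LA @ LB))). hd xs < t)) \<and>
     (\<forall>t\<in>set (concat (map adj (C # LA @ LB))). t < sum_list (map last LA) + hd C) \<and>
     sum_list (map last LA) + hd C < sum_list (map last LB) + last C)"

lemma antimagic_listsI:
  assumes "mset (map length LA) = A" "mset (map length LB) = B" "length C = s"
    "distinct (concat (C # LA @ LB))" "set (concat (C # LA @ LB)) = {1..m}"
    "distinct (concat (map adj (C # LA @ LB)))" "\<And>xs. xs \<in> set (LA @ LB) \<Longrightarrow> xs \<noteq> [] \<and> hd xs \<le> \<tau>"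
    "\<tau> < sum_list (map last LA) + hd C"
    "\<And>t. t \<in> set (concat (map adj (C # LA @ LB))) \<Longrightarrow> \<tau> < t \<and> t < sum_list (map last LA) + hd C"
    "sum_list (map last LA) + hd C < sum_list (map last LB) + last C"
  shows "antimagic_lists A B s"
  unfolding antimagic_lists_def
  apply (rule exI[of _ LA], rule exI[of _ LB], rule exI[of _ C], rule exI[of _ m])
  apply (intro conjI ballI)
  subgoal using assms(1) .
  subgoal using assms(2) .
  subgoal using assms(3) .
  subgoal using assms(4) .
  subgoal using assms(5) .
  subgoal using assms(6) .
  subgoal using assms(7) by blast
  subgoal using assms(7,8) by (blast intro: le_less_trans)
  subgoal using assms(7,9) by (blast intro: le_less_trans)
  subgoal using assms(9) by blast
  subgoal using assms(10) .
  done

lemma levelled_adj: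
  assumes "levelled Ps \<sigma> \<tau> \<rho> m l z" "xs \<in> set Ps" "t \<in> set (adj xs)"
  shows "\<tau> < t" "t \<le> \<sigma> + \<rho> \<or> z \<and> t \<le> \<tau> + \<rho> \<or> l > 0 \<and> t \<le> l + m"
proof -
  obtain x y where xy: "(x, y) \<in> set (zip xs (tl xs))" "t = x + y" using assms(3) by (auto simp: set_adj)
  have "x \<in> set (concat Ps)" "y \<in> set (concat Ps)" using zip_tl_subset[OF xy(1)] assms(2) by auto
  then have m: "x \<le> m" "y \<le> m" using assms(1) unfolding levelled_def by auto
  have ord: "\<sigma> \<le> \<tau>" "\<tau> \<le> \<rho>" using assms(1) by (auto simp: levelled_def)
  have "level_pair \<sigma> \<tau> \<rho> l z x y \<or> level_pair \<sigma> \<tau> \<rho> l z y x" using assms(1,2) xy(1) by (auto simp: levelled_def level_path_def)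
  then have "\<tau> < t \<and> (t \<le> \<sigma> + \<rho> \<or> z \<and> t \<le> \<tau> + \<rho> \<or> l > 0 \<and> t \<le> l + m)"
  proof
    assume "level_pair \<sigma> \<tau> \<rho> l z x y"
    then show ?thesis unfolding level_pair_def xy(2) using m ord by auto
  next
    assume "level_pair \<sigma> \<tau> \<rho> l z y x"
    then show ?thesis unfolding level_pair_def xy(2) using m ord by auto
  qed
  then show "\<tau> < t" "t \<le> \<sigma> + \<rho> \<or> z \<and> t \<le> \<tau> + \<rho> \<or> l > 0 \<and> t \<le> l + m" by auto
qed

lemma finished_antimagic:
  assumes "finished A B s"
  shows "antimagic_lists A B s"
proof -
  obtain N H K T f N' H' W' T' g \<sigma> \<tau> \<rho> m l z where s: "s > 0" and counted: "counted A B s N H K T f N' H' W' T' g \<sigma> \<tau> \<rho> m l z"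
     and b: "\<sigma> + \<rho> < f" "z \<longrightarrow> \<tau> + \<rho> < f" "l > 0 \<longrightarrow> l + m < f" "f < g"
    using assms unfolding finished_def by blast
  obtain P Q where spider: "spider A B s P Q \<sigma> \<tau> \<rho> m l z" and counts: "counts P = (N, H, K, T, f)" "counts Q = (N', H', W', T', g)"
    by (rule countedE[OF counted])
  obtain LA LB Cs where levelled: "levelled (Cs @ LA @ LB) \<sigma> \<tau> \<rho> m l z" and
     A: "mset (map length LA) = A" and B: "mset (map length LB) = B" and C: "map length Cs = (if s = 0 then [] else [s])"
     and hd: "\<forall>xs\<in>set (LA @ LB). xs \<noteq> [] \<and> hd xs \<le> \<tau>"
     and P: "prof \<sigma> \<tau> \<rho> (map last LA @ map hd Cs) = P" and Q: "prof \<sigma> \<tau> \<rho> (map last LB @ map last Cs) = Q"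
    using spider unfolding spider_def by blast
  obtain C where C: "Cs = [C]" "length C = s" using C s by auto
  have f: "f = sum_list (map last LA) + hd C" "g = sum_list (map last LB) + last C"
    using counts P Q unfolding C by (auto simp: prof_def)
  have St': "levelled (C # LA @ LB) \<sigma> \<tau> \<rho> m l z" using levelled C by simp
  have adj: "\<tau> < t \<and> t < f" if t: "t \<in> set (concat (map adj (C # LA @ LB)))" for t
  proof -
    from t obtain xs where "xs \<in> set (C # LA @ LB)" "t \<in> set (adj xs)" by auto
    from levelled_adj[OF St' this] b show ?thesis by auto
  qed
  have "\<tau> < f" using b levelled unfolding levelled_def by linarith
  have d: "distinct (concat (C # LA @ LB))" "set (concat (C # LA @ LB)) = {1..m}" "distinct (concat (map adj (C # LA @ LB)))"
    using St' unfolding levelled_def by blast+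
  show ?thesis
    using antimagic_listsI[OF A B C(2) d, of \<tau>] hd \<open>\<tau> < f\<close> adj b(4) unfolding f by blast
qed

section \<open>Labellings with two heights, for legs of length 2\<close>

definition num_high :: "nat \<Rightarrow> nat list \<Rightarrow> nat" where
  "num_high \<tau> xs = length (filter (\<lambda>x. \<tau> < x) xs)"

text \<open>Here sums of two low labels are allowed as well: a leg of length 2 at the first centre together with a
  pendant edge at the second centre can be added in no other way, and only as a last step.\<close>

definition wide_pair :: "nat \<Rightarrow> nat \<Rightarrow> nat \<Rightarrow> nat \<Rightarrow> nat \<Rightarrow> bool" where
  "wide_pair \<tau> T1 T2 x y \<longleftrightarrow> \<tau> < x + y \<and> (x \<le> \<tau> \<and> y \<le> \<tau> \<longrightarrow> x + y \<le> T1) \<and> (x \<le> \<tau> \<and> \<tau> < y \<or> y \<le> \<tau> \<and> \<tau> < x \<longrightarrow> T1 < x + y \<and> x + y \<le> T2) \<and>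
     (\<tau> < x \<and> \<tau> < y \<longrightarrow> T2 < x + y)"

text \<open>The last four clauses are those of \<open>finished_wide\<close>; the core is not counted
  in \<open>length LA\<close> and \<open>length LB\<close>, so \<open>2 \<le> N\<close> turns into
  \<open>1 \<le> length LA\<close>.\<close>

definition wide_labels :: "nat list list \<Rightarrow> nat list list \<Rightarrow> nat list \<Rightarrow> nat \<Rightarrow> nat \<Rightarrow> nat \<Rightarrow> nat \<Rightarrow> bool" where
  "wide_labels LA LB C m \<tau> T1 T2 \<longleftrightarrow> C \<noteq> [] \<and>
     distinct (concat (C # LA @ LB)) \<and> set (concat (C # LA @ LB)) = {1..m} \<and>
     distinct (concat (map adj (C # LA @ LB))) \<and> (\<forall>xs\<in>set (LA @ LB). xs \<noteq> [] \<and> hd xs \<le> \<tau>) \<and>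
     \<tau> \<le> m \<and> \<tau> \<le> T1 \<and> T1 \<le> T2 \<and>
     (\<forall>xs\<in>set (C # LA @ LB). \<forall>(x, y)\<in>set (zip xs (tl xs)). wide_pair \<tau> T1 T2 x y) \<and>
     (\<forall>t\<in>set (concat (map adj (C # LA @ LB))). t < sum_list (map last LA) + hd C) \<and>
     sum_list (map last LA) + hd C < sum_list (map last LB) + last C \<and>
     1 \<le> length LA \<and> 1 \<le> num_high \<tau> (map last LA @ [hd C]) \<and> length LA \<le> length LB \<and>
     length LA + num_high \<tau> (map last LA @ [hd C]) \<le> length LB + num_high \<tau> (map last LB @ [last C]) + 1"

definition wide_lists :: "nat multiset \<Rightarrow> nat multiset \<Rightarrow> nat \<Rightarrow> bool" where
  "wide_lists A B s \<longleftrightarrow> (\<exists>LA LB C m \<tau> T1 T2. mset (map length LA) = A \<and> mset (map length LB) = B \<and> length C = s \<and> wide_labels LA LB C m \<tau> T1 T2)"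

lemma finished_wide_lists:
  assumes "finished_wide A B s"
  shows "wide_lists A B s"
proof -
  obtain N H K T f N' H' W' T' g \<sigma> \<tau> \<rho> m l z where s: "s > 0" and counted: "counted A B s N H K T f N' H' W' T' g \<sigma> \<tau> \<rho> m l z"
     and b: "\<tau> + \<rho> < f" "l + m < f" "f < g" "2 \<le> N" "1 \<le> H" "N \<le> N'" "N + H \<le> N' + H' + 1"
    using assms unfolding finished_wide_def by blast
  obtain P Q where spider: "spider A B s P Q \<sigma> \<tau> \<rho> m l z" and counts: "counts P = (N, H, K, T, f)" "counts Q = (N', H', W', T', g)"
    by (rule countedE[OF counted])
  obtain LA LB Cs where levelled: "levelled (Cs @ LA @ LB) \<sigma> \<tau> \<rho> m l z" and
     A: "mset (map length LA) = A" and B: "mset (map length LB) = B" and C: "map length Cs = (if s = 0 then [] else [s])"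
     and hd: "\<forall>xs\<in>set (LA @ LB). xs \<noteq> [] \<and> hd xs \<le> \<tau>"
     and P: "prof \<sigma> \<tau> \<rho> (map last LA @ map hd Cs) = P" and Q: "prof \<sigma> \<tau> \<rho> (map last LB @ map last Cs) = Q"
    using spider unfolding spider_def by blast
  obtain C where C: "Cs = [C]" "length C = s" using C s by auto
  have ord: "\<sigma> \<le> \<tau>" "\<tau> \<le> \<rho>" "\<rho> \<le> m" using levelled by (auto simp: levelled_def)
  have pr: "counts (prof \<sigma> \<tau> \<rho> xs) = (length xs, num_high \<tau> xs, fst (snd (prof \<sigma> \<tau> \<rho> xs)), fst (snd (snd (snd (prof \<sigma> \<tau> \<rho> xs)))), sum_list xs)" for xs
  proof (induction xs)
    case (Cons x xs)
    consider "x \<le> \<sigma>" | "\<sigma> < x" "x \<le> \<tau>" | "\<tau> < x" "x \<le> \<rho>" | "\<rho> < x" by linarith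
    then show ?case by cases (use Cons ord in \<open>auto simp: prof_def num_high_def\<close>)
  qed (simp add: prof_def num_high_def)
  have f: "f = sum_list (map last LA) + hd C" "N = Suc (length LA)" "H = num_high \<tau> (map last LA @ [hd C])"
    using counts(1) unfolding P[symmetric] C(1) pr by auto
  have g: "g = sum_list (map last LB) + last C" "N' = Suc (length LB)" "H' = num_high \<tau> (map last LB @ [last C])"
    using counts(2) unfolding Q[symmetric] C(1) pr by auto
  have St': "levelled (C # LA @ LB) \<sigma> \<tau> \<rho> m l z" using levelled C by simp
  have adj: "\<tau> < t \<and> t < f" if t: "t \<in> set (concat (map adj (C # LA @ LB)))" for t
  proof -
    from t obtain xs where "xs \<in> set (C # LA @ LB)" "t \<in> set (adj xs)" by auto
    from levelled_adj[OF St' this] b ord show ?thesis by auto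
  qed
  \<comment> \<open>The initial thresholds: two low labels are never adjacent on the four levels, so
    \<open>T1\<close> can be \<open>\<tau>\<close>, and \<open>\<tau> + \<rho>\<close> separates the
    pairs containing a low label from those of two high ones.\<close>
  have okw: "wide_pair \<tau> \<tau> (\<tau> + \<rho>) x y" if "level_pair \<sigma> \<tau> \<rho> l z x y \<or> level_pair \<sigma> \<tau> \<rho> l z y x" for x y
    using that
  proof
    assume "level_pair \<sigma> \<tau> \<rho> l z x y"
    then show ?thesis using ord unfolding level_pair_def wide_pair_def by (elim disjE conjE) simp_all
  next
    assume "level_pair \<sigma> \<tau> \<rho> l z y x"
    then show ?thesis using ord unfolding level_pair_def wide_pair_def by (elim disjE conjE) simp_all
  qed
  have okps: "\<forall>xs\<in>set (C # LA @ LB). level_path \<sigma> \<tau> \<rho> l z xs" using St' unfolding levelled_def by blast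
  have wps: "\<forall>xs\<in>set (C # LA @ LB). \<forall>(x, y)\<in>set (zip xs (tl xs)). wide_pair \<tau> \<tau> (\<tau> + \<rho>) x y"
    using okps okw unfolding level_path_def by blast
  have d: "distinct (concat (C # LA @ LB))" "set (concat (C # LA @ LB)) = {1..m}" "distinct (concat (map adj (C # LA @ LB)))"
    using St' unfolding levelled_def by blast+
  have "wide_labels LA LB C m \<tau> \<tau> (\<tau> + \<rho>)" unfolding wide_labels_def f(1)[symmetric] g(1)[symmetric] f(3)[symmetric] g(3)[symmetric]
    apply (intro conjI ballI)
    subgoal using C s by auto
    subgoal using d(1) .
    subgoal using d(2) .
    subgoal using d(3) .
    subgoal using hd by blast
    subgoal using hd by blast
    subgoal using ord by simp
    subgoal by simp
    subgoal by simp
    subgoal using wps by blast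
    subgoal using adj by blast
    subgoal using b by simp
    subgoal using b f(2) by simp
    subgoal using b by simp
    subgoal using b f(2) g(2) by simp
    subgoal using b f(2) g(2) by simp
    done
  then show ?thesis unfolding wide_lists_def using A B C(2) by blast
qed

lemma num_high_gt: "1 \<le> num_high \<tau> xs \<Longrightarrow> \<tau> < sum_list xs"
  by (induction xs) (auto simp: num_high_def split: if_splits)

lemma wide_lists_antimagic:
  assumes "wide_lists A B s"
  shows "antimagic_lists A B s"
proof -
  obtain LA LB C m \<tau> T1 T2 where A: "mset (map length LA) = A" "mset (map length LB) = B" "length C = s" and w: "wide_labels LA LB C m \<tau> T1 T2"
    using assms unfolding wide_lists_def by blast
  note w = w[unfolded wide_labels_def]
  have d: "distinct (concat (C # LA @ LB))" "set (concat (C # LA @ LB)) = {1..m}" "distinct (concat (map adj (C # LA @ LB)))"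
    and hd: "\<forall>xs\<in>set (LA @ LB). xs \<noteq> [] \<and> hd xs \<le> \<tau>"
    and wps: "\<forall>xs\<in>set (C # LA @ LB). \<forall>(x, y)\<in>set (zip xs (tl xs)). wide_pair \<tau> T1 T2 x y"
    and t: "\<forall>t\<in>set (concat (map adj (C # LA @ LB))). t < sum_list (map last LA) + hd C"
    and fg: "sum_list (map last LA) + hd C < sum_list (map last LB) + last C" and h: "1 \<le> num_high \<tau> (map last LA @ [hd C])"
    using w by blast+
  have "\<tau> < sum_list (map last LA) + hd C" using num_high_gt[OF h] by simp
  moreover have "\<tau> < t" if "t \<in> set (concat (map adj (C # LA @ LB)))" for t
  proof -
    from that obtain xs where x: "xs \<in> set (C # LA @ LB)" "t \<in> set (adj xs)" by auto
    then obtain x y where "(x, y) \<in> set (zip xs (tl xs))" "t = x + y" by (auto simp: set_adj)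
    then have "wide_pair \<tau> T1 T2 x y" using wps x(1) by blast
    then show ?thesis using \<open>t = x + y\<close> by (simp add: wide_pair_def)
  qed
  ultimately show ?thesis using antimagic_listsI[OF A d, of \<tau>] hd t fg by blast
qed

lemma adj_map_shift:
  assumes "\<forall>(x, y)\<in>set (zip xs (tl xs)). g x + g y = (h (x + y) :: nat)"
  shows "adj (map g xs) = map h (adj xs)"
proof -
  have "adj (map g xs) = map (\<lambda>(x, y). g x + g y) (zip xs (tl xs))"
    by (simp add: adj_def map_tl[symmetric] zip_map_map split_def)
  also have "\<dots> = map (\<lambda>(x, y). h (x + y)) (zip xs (tl xs))" using assms by (intro map_cong) auto
  finally show ?thesis by (simp add: adj_def split_def comp_def)
qed

text \<open>The new labels are 1, 2 and \<open>\<tau> + 3\<close>. The leg of length 2 has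
  \<open>\<tau> + 3\<close> at its leaf and 1 at the centre, the pendant edge gets 2. The new sum
  \<open>\<tau> + 4\<close> exceeds the new leaf bound \<open>\<tau> + 3\<close> by 1 and is smaller
  than every shifted sum.\<close>

lemma wide_lists_insert:
  assumes "wide_lists A B s"
  shows "wide_lists (add_mset 2 A) (add_mset 1 B) s"
proof -
  obtain LA LB C m \<tau> T1 T2 where A: "mset (map length LA) = A" "mset (map length LB) = B" "length C = s" and w: "wide_labels LA LB C m \<tau> T1 T2"
    using assms unfolding wide_lists_def by blast
  note w = w[unfolded wide_labels_def]
  have d: "distinct (concat (C # LA @ LB))" "set (concat (C # LA @ LB)) = {1..m}" "distinct (concat (map adj (C # LA @ LB)))"
    and C: "C \<noteq> []" and hd: "\<forall>xs\<in>set (LA @ LB). xs \<noteq> [] \<and> hd xs \<le> \<tau>"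
    and wps: "\<forall>xs\<in>set (C # LA @ LB). \<forall>(x, y)\<in>set (zip xs (tl xs)). wide_pair \<tau> T1 T2 x y"
    and t: "\<forall>t\<in>set (concat (map adj (C # LA @ LB))). t < sum_list (map last LA) + hd C"
    and fg: "sum_list (map last LA) + hd C < sum_list (map last LB) + last C" and h: "1 \<le> num_high \<tau> (map last LA @ [hd C])"
    and ord: "\<tau> \<le> m" "\<tau> \<le> T1" "T1 \<le> T2"
    and N: "1 \<le> length LA" "length LA \<le> length LB"
     "length LA + num_high \<tau> (map last LA @ [hd C]) \<le> length LB + num_high \<tau> (map last LB @ [last C]) + 1"
    using w by blast+
  \<comment> \<open>Low labels rise by 2 and high ones by 3, so a sum rises by 4, 5 or 6 according
    to the number of its high labels, which \<open>T1\<close> and \<open>T2\<close> read off from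
    its size.\<close>
  define g where "g x = (if x \<le> \<tau> then x + 2 else x + 3)" for x
  define k where "k t = (if t \<le> T1 then t + 4 else if t \<le> T2 then t + 5 else t + 6)" for t
  have gk: "g x + g y = k (x + y)" if "wide_pair \<tau> T1 T2 x y" for x y
    using that ord unfolding wide_pair_def g_def k_def by auto
  have ik: "inj k" "\<And>x. k x \<le> x + 6" "\<And>x. x + 4 \<le> k x" and ig: "inj g" using ord by (auto simp: inj_def k_def g_def)
  have adj: "map (adj \<circ> map g) Ls = map (map k \<circ> adj) Ls" if "set Ls \<subseteq> set (C # LA @ LB)" for Ls
  proof (rule map_cong[OF refl])
    fix xs assume "xs \<in> set Ls"
    then have "\<forall>(x, y)\<in>set (zip xs (tl xs)). g x + g y = k (x + y)" using wps that gk by blast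
    then show "(adj \<circ> map g) xs = (map k \<circ> adj) xs" by (simp add: adj_map_shift)
  qed
  let ?S = "concat (map adj (C # LA @ LB))"
  define LA' LB' C' where L: "LA' = [\<tau> + 3, 1] # map (map g) LA" "LB' = [2] # map (map g) LB" "C' = map g C"
  have c1: "mset (concat (C' # LA' @ LB')) = mset ([\<tau> + 3, 1, 2] @ map g (concat (C # LA @ LB)))"
    unfolding L by (simp add: map_concat)
  have "map adj (map (map g) (C # LA @ LB)) = map (map k) (map adj (C # LA @ LB))"
    using adj[of "C # LA @ LB"] by simp
  then have "concat (map adj (map (map g) (C # LA @ LB))) = map k ?S" by (simp only: map_concat)
  then have "mset (concat (map adj (map (map g) (C # LA @ LB)))) = mset (map k ?S)" by (rule arg_cong)
  then have c2: "mset (concat (map adj (C' # LA' @ LB'))) = mset ((\<tau> + 4) # map k ?S)"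
    unfolding L by (simp add: ac_simps)
  have g3: "g x \<noteq> 1 \<and> g x \<noteq> 2 \<and> g x \<noteq> \<tau> + 3" if "x \<in> {1..m}" for x using that by (auto simp: g_def)
  have gim: "g ` {1..m} = {3..\<tau> + 2} \<union> {\<tau> + 4..m + 3}"
  proof -
    have u: "{1..m} = {1..\<tau>} \<union> {\<tau> + 1..m}" using ord by auto
    have "g ` {1..\<tau>} = (\<lambda>x. x + 2) ` {1..\<tau>}" "g ` {\<tau> + 1..m} = (\<lambda>x. x + 3) ` {\<tau> + 1..m}"
      by (auto simp: g_def)
    then have "g ` {1..m} = (\<lambda>x. x + 2) ` {1..\<tau>} \<union> (\<lambda>x. x + 3) ` {\<tau> + 1..m}"
      unfolding u image_Un by simp
    then show ?thesis by (simp only: image_add_atLeastAtMost') (simp add: numeral_eq_Suc)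
  qed
  have len: "mset (map length LA') = add_mset 2 A" "mset (map length LB') = add_mset 1 B" "length C' = s"
    unfolding L using A by (auto simp: comp_def)
  have dap: "distinct ([x, y, z] @ M)" if "distinct M" "\<forall>u\<in>set M. u \<noteq> y \<and> u \<noteq> z \<and> u \<noteq> x" "x \<noteq> y" "x \<noteq> z" "y \<noteq> z" for x y z :: nat and M
    using that by auto
  have d1: "distinct (concat (C' # LA' @ LB'))"
  proof -
    have "inj_on g (set (concat (C # LA @ LB)))" using ig by (rule inj_on_subset) simp
    then have "distinct (map g (concat (C # LA @ LB)))" using d(1) by (simp only: distinct_map)
    moreover have "\<forall>u\<in>set (map g (concat (C # LA @ LB))). u \<noteq> 1 \<and> u \<noteq> 2 \<and> u \<noteq> \<tau> + 3"
    proof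
      fix u assume "u \<in> set (map g (concat (C # LA @ LB)))"
      then have "u \<in> g ` {1..m}" unfolding set_map d(2) .
      then obtain v where "v \<in> {1..m}" "u = g v" by (rule imageE)
      then show "u \<noteq> 1 \<and> u \<noteq> 2 \<and> u \<noteq> \<tau> + 3" using g3[of v] by simp
    qed
    ultimately have "distinct ([\<tau> + 3, 1, 2] @ map g (concat (C # LA @ LB)))" by (rule dap) simp_all
    then show ?thesis using mset_eq_imp_distinct_iff[OF c1] by blast
  qed
  have d2: "set (concat (C' # LA' @ LB')) = {1..m + 3}"
  proof -
    have "set (concat (C' # LA' @ LB')) = {\<tau> + 3, 1, 2} \<union> g ` {1..m}"
    proof -
      have "set (concat (C' # LA' @ LB')) = set ([\<tau> + 3, 1, 2] @ map g (concat (C # LA @ LB)))" by (rule mset_eq_setD[OF c1])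
      also have "\<dots> = set [\<tau> + 3, 1, 2] \<union> g ` set (concat (C # LA @ LB))" by (simp only: set_append set_map)
      also have "\<dots> = {\<tau> + 3, 1, 2} \<union> g ` {1..m}" unfolding d(2) by simp
      finally show ?thesis .
    qed
    also have "\<dots> = {1..m + 3}" unfolding gim using ord by auto
    finally show ?thesis .
  qed
  have tlow: "\<tau> < t" if t: "t \<in> set ?S" for t
  proof -
    from that obtain xs where x: "xs \<in> set (C # LA @ LB)" "t \<in> set (adj xs)" by auto
    then obtain x y where "(x, y) \<in> set (zip xs (tl xs))" "t = x + y" by (auto simp: set_adj)
    then have "wide_pair \<tau> T1 T2 x y" using wps x(1) by blast
    then show ?thesis using \<open>t = x + y\<close> by (simp add: wide_pair_def)
  qed
  have d3: "distinct (concat (map adj (C' # LA' @ LB')))"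
  proof -
    have "inj_on k (set ?S)" using ik(1) by (rule inj_on_subset) simp
    then have "distinct (map k ?S)" using d(3) by (simp only: distinct_map)
    moreover have "\<tau> + 4 \<notin> set (map k ?S)"
    proof
      assume "\<tau> + 4 \<in> set (map k ?S)"
      then obtain t where "t \<in> set ?S" "\<tau> + 4 = k t" unfolding set_map by blast
      then show False using ik(3)[of t] tlow[of t] by linarith
    qed
    ultimately have "distinct ((\<tau> + 4) # map k ?S)" by (simp only: distinct.simps) simp
    then show ?thesis using mset_eq_imp_distinct_iff[OF c2] by blast
  qed
  have gl: "last (map g xs) = g (last xs)" "hd (map g xs) = g (hd xs)" if "xs \<noteq> []" for xs using that by (auto simp: last_map hd_map)
  have ml: "map last (map (map g) LA) = map g (map last LA)" "map last (map (map g) LB) = map g (map last LB)"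
    using hd gl by auto
  have sg: "sum_list (map g xs) = sum_list xs + 2 * length xs + num_high \<tau> xs" for xs
    by (induction xs) (auto simp: g_def num_high_def)
  have hg: "num_high (\<tau> + 3) (map g xs) = num_high \<tau> xs" for xs
    by (induction xs) (auto simp: g_def num_high_def)
  have hsh: "num_high n (x # xs) = num_high n xs" if "x \<le> n" for n x xs using that by (simp add: num_high_def)
  have HA: "num_high (\<tau> + 3) (map last LA' @ [hd C']) = num_high \<tau> (map last LA @ [hd C])"
    and HB: "num_high (\<tau> + 3) (map last LB' @ [last C']) = num_high \<tau> (map last LB @ [last C])"
    using hg[of "map last LA @ [hd C]"] hg[of "map last LB @ [last C]"] unfolding L by (simp_all add: ml gl C hsh del: map_map)
  have fa: "sum_list (map last LA') + hd C' = sum_list (map last LA) + hd C + 2 * Suc (length LA) + num_high \<tau> (map last LA @ [hd C]) + 1"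
    using sg[of "map last LA @ [hd C]"] unfolding L by (simp add: ml gl C del: map_map)
  have fb: "sum_list (map last LB') + last C' = sum_list (map last LB) + last C + 2 * Suc (length LB) + num_high \<tau> (map last LB @ [last C]) + 2"
    using sg[of "map last LB @ [last C]"] unfolding L by (simp add: ml gl C del: map_map)
  \<comment> \<open>Adding the inequalities for \<open>n\<close> and for \<open>n + h\<close> leaves
    a deficit of at most 1, and the new labels, 1 at the first centre and 2 at the second, make up
    for it.\<close>
  have fg': "sum_list (map last LA') + hd C' < sum_list (map last LB') + last C'"
  proof -
    have "f + 2 * Suc n + h + 1 < f' + 2 * Suc n' + h' + 2" if "f < f'" "n \<le> n'" "n + h \<le> n' + h' + 1" for f f' n n' h h' :: nat
      using that by simp
    from this[OF fg N(2,3)] show ?thesis unfolding fa fb .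
  qed
  \<comment> \<open>Adjacent sums rise by up to 6, so the first centre has to gain at least 6: two
    old labels give 4, the high one among them 1 more, and the new label is 1.\<close>
  have f6: "sum_list (map last LA) + hd C + 6 \<le> sum_list (map last LA') + hd C'"
    unfolding fa using N(1) h by simp
  have t': "t < sum_list (map last LA') + hd C'" if "t \<in> set (concat (map adj (C' # LA' @ LB')))" for t
  proof -
    have "t \<in> set ((\<tau> + 4) # map k ?S)" using that unfolding mset_eq_setD[OF c2] .
    then consider "t = \<tau> + 4" | u where "u \<in> set ?S" "t = k u" by (simp only: set_map list.set) blast
    then show ?thesis
    proof cases
      case 1 then show ?thesis using f6 num_high_gt[OF h] by simp
    next
      case 2 then show ?thesis using f6 ik(2)[of u] t by fastforce
    qed
  qed
  have hd': "xs \<noteq> [] \<and> hd xs \<le> \<tau> + 3" if xs: "xs \<in> set (LA' @ LB')" for xs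
  proof -
    consider "xs = [\<tau> + 3, 1]" | "xs = [2]" | ys where "ys \<in> set (LA @ LB)" "xs = map g ys" using xs unfolding L by auto
    then show ?thesis
    proof cases
      case 3
      then have "ys \<noteq> []" "hd ys \<le> \<tau>" using hd by blast+
      then show ?thesis using 3(2) gl by (simp add: g_def)
    qed auto
  qed
  have wps': "wide_pair (\<tau> + 3) (T1 + 4) (T2 + 5) x y" if xs: "xs \<in> set (C' # LA' @ LB')" "(x, y) \<in> set (zip xs (tl xs))" for xs x y
  proof -
    consider "xs = [\<tau> + 3, 1]" | "xs = [2]" | ys where "ys \<in> set (C # LA @ LB)" "xs = map g ys" using xs(1) unfolding L by auto
    then show ?thesis
    proof cases
      case 1 then show ?thesis using xs(2) ord by (simp add: wide_pair_def)
    next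
      case 3
      have "(x, y) \<in> set (map (map_prod g g) (zip ys (tl ys)))" using xs(2) unfolding 3(2) map_tl[symmetric] by (simp add: zip_map_map map_prod_def)
      then obtain u v where uv: "(u, v) \<in> set (zip ys (tl ys))" "x = g u" "y = g v" by auto
      then have "wide_pair \<tau> T1 T2 u v" using wps 3(1) by blast
      then show ?thesis unfolding uv(2,3) wide_pair_def g_def by auto
    qed (use xs in simp)
  qed
  have "wide_labels LA' LB' C' (m + 3) (\<tau> + 3) (T1 + 4) (T2 + 5)" unfolding wide_labels_def HA HB
    apply (intro conjI ballI)
    subgoal using C L by simp
    subgoal using d1 .
    subgoal using d2 .
    subgoal using d3 .
    subgoal using hd' by blast
    subgoal using hd' by blast
    subgoal using ord by simp
    subgoal using ord by simp
    subgoal using ord by simp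
    subgoal using wps' by blast
    subgoal using t' by blast
    subgoal using fg' .
    subgoal unfolding L by simp
    subgoal using h .
    subgoal using N unfolding L by simp
    subgoal using N unfolding L by simp
    done
  then show ?thesis unfolding wide_lists_def using len by blast
qed

text \<open>With the next lemma, the two double spiders that the base cases for an even core leave
  over.\<close>

lemma antimagic_lists_11_13_2: "antimagic_lists {#1, 1#} {#1, 3#} 2"
  by (rule antimagic_listsI[where LA = "[[4], [6]]" and LB = "[[3], [5, 2, 8]]" and C = "[1, 7]" and m = 8 and \<tau> = 6]) (auto | presburger)+

lemma antimagic_lists_11_13_4: "antimagic_lists {#1, 1#} {#1, 3#} 4"
  by (rule antimagic_listsI[where LA = "[[6], [7]]" and LB = "[[4], [5, 3, 10]]" and C = "[1, 8, 2, 9]" and m = 10 and \<tau> = 7]) (auto | presburger)+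

section \<open>Arbitrary legs\<close>

lemma odd_ge3E:
  assumes "odd (n::nat)" "n \<noteq> 1" obtains k where "n = 2 * k + 3"
proof -
  obtain j where "n = 2 * j + 1" using assms(1) by (rule oddE)
  then show ?thesis using assms(2) that[of "j - 1"] by (cases j) auto
qed

lemma even_pos_natE:
  assumes "even (n::nat)" "0 < n" obtains k where "n = 2 * k + 2"
proof -
  obtain j where "n = 2 * j" using assms(1) by (rule evenE)
  then show ?thesis using assms(2) that[of "j - 1"] by (cases j) auto
qed

lemma even_state_b: "even_state e A B s z \<Longrightarrow> 0 < b \<Longrightarrow> even_state (Suc e) A (add_mset b B) s z"
  by (cases "even b") (auto elim!: even_pos_natE oddE simp del: add_2_eq_Suc' intro: even_state_Eb even_state_Sb[simplified] simp: even_state_Eb)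

lemma odd_state_b: "odd_state e A B s \<Longrightarrow> 0 < b \<Longrightarrow> odd_state (Suc e) A (add_mset b B) s"
  by (cases "even b") (auto elim!: even_pos_natE oddE simp del: add_2_eq_Suc' intro: odd_state_Eb odd_state_Sb[simplified] simp: odd_state_Eb)

lemma even_state_weaken0: "even_state e A B s z \<Longrightarrow> even_state 0 A B s z"
  by (induction e) (auto dest: even_state_weaken)

lemma even_state_b_many: "even_state e A B s z \<Longrightarrow> \<forall>x\<in>#X. 0 < x \<Longrightarrow> even_state (e + size X) A (B + X) s z"
  by (induction X) (auto intro: even_state_b)

lemma odd_state_b_many: "odd_state e A B s \<Longrightarrow> \<forall>x\<in>#X. 0 < x \<Longrightarrow> odd_state (e + size X) A (B + X) s"
  by (induction X) (auto intro: odd_state_b)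

text \<open>Each leg at the first centre is paired with one at the second. An odd leg spends the
  slack that its partner has just created. An even leg enters through \<open>even_state_EE\<close>
  or \<open>even_state_EL\<close>; the partner must then not be a pendant edge, and the second
  operation asks for \<open>z\<close> to be unset.\<close>

lemma even_state_extend:
  assumes "even_state 0 A0 B0 s z" "size A \<le> size B" "\<forall>x\<in>#A. 0 < x" "\<forall>x\<in>#B. 0 < x" "(\<forall>x\<in>#A. odd x) \<or> \<not> z \<and> 1 \<notin># B"
  shows "even_state 0 (A0 + A) (B0 + B) s z"
  using assms(2-)
proof (induction A arbitrary: B)
  case empty
  then show ?case using even_state_weaken0[OF even_state_b_many[OF assms(1)]] by simp
next
  case (add a A)
  from add.prems(1) obtain b where "b \<in># B" by (metis multiset_nonemptyE not_one_le_zero size_add_mset size_empty Suc_le_eq not_less_zero)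
  then obtain B' where B: "B = add_mset b B'" by (rule mset_add)
  have IH: "even_state 0 (A0 + A) (B0 + B') s z" using add.prems unfolding B by (intro add.IH) auto
  have b: "0 < b" "0 < a" using add.prems B by auto
  show ?case
  proof (cases "odd a")
    case True
    then obtain k where "a = 2 * k + 1" by (rule oddE)
    then show ?thesis using even_state_Sa[OF even_state_b[OF IH b(1)]] unfolding B by simp
  next
    case False
    then obtain k where k: "a = 2 * k + 2" using b(2) by (auto elim: even_pos_natE)
    have z: "\<not> z" "b \<noteq> 1" using add.prems(4) False unfolding B by auto
    show ?thesis
    proof (cases "even b")
      case True
      then obtain j where "b = 2 * j + 2" using b(1) by (rule even_pos_natE)
      then show ?thesis using even_state_EE[OF IH, of k j] k unfolding B by simp
    next
      case False
      then obtain j where "b = 2 * j + 3" using z(2) by (rule odd_ge3E)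
      then show ?thesis using even_state_EL[of 0 "A0 + A" "B0 + B'" s k j] IH z k unfolding B by simp
    qed
  qed
qed

text \<open>The recursion first splits off the pairs of an even leg and a pendant edge, so these are
  inserted last: they set \<open>z\<close>, after which \<open>even_state_EL\<close> would no longer
  be available.\<close>

lemma even_state_extend_Z:
  assumes "even_state 0 A0 B0 s False" "size A \<le> size B" "\<forall>x\<in>#A. 0 < x" "\<forall>x\<in>#B. 0 < x" "2 \<notin># A \<or> 1 \<notin># B"
  shows "\<exists>z. even_state 0 (A0 + A) (B0 + B) s z"
  using assms(2-)
proof (induction "size A" arbitrary: A B rule: less_induct)
  case less
  show ?case
  proof (cases "1 \<in># B \<and> (\<exists>a\<in>#A. even a)")
    case True
    then obtain a where a: "a \<in># A" "even a" and o: "1 \<in># B" by blast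
    obtain A' where A: "A = add_mset a A'" using a(1) by (rule mset_add)
    obtain B' where B: "B = add_mset 1 B'" using o by (rule mset_add)
    have "\<exists>z. even_state 0 (A0 + A') (B0 + B') s z" using less.prems unfolding A B by (intro less.hyps) (auto simp: A)
    then obtain z where z: "even_state 0 (A0 + A') (B0 + B') s z" ..
    obtain k where k: "a = 2 * k + 2" using a less.prems(2) by (auto elim: even_pos_natE)
    then obtain j where "k = Suc j" using less.prems(4) o a by (cases k) (auto simp: numeral_2_eq_2)
    then have "a = 2 * j + 4" using k by simp
    then show ?thesis using even_state_Z[OF z, of j] unfolding A B by auto
  next
    case False
    then have "even_state 0 (A0 + A) (B0 + B) s False" using less.prems by (intro even_state_extend[OF assms(1)]) auto
    then show ?thesis ..
  qed
qed

text \<open>The second conjunct keeps room for one more odd leg at the first centre, for the case of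
  equally many legs at both.\<close>

definition wide_both :: "nat multiset \<Rightarrow> nat multiset \<Rightarrow> nat \<Rightarrow> bool" where
  "wide_both A B s \<longleftrightarrow> wide_lists A B s \<and> (\<forall>y. odd y \<longrightarrow> wide_lists (add_mset y A) B s)"

text \<open>Pairs of a leg of length 2 and a pendant edge are split off first and thus inserted
  last. The additional odd leg has to enter before them, on the four levels; hence the induction
  carries both parts of \<open>wide_both\<close>.\<close>

lemma wide_both_extend:
  assumes "even_state 0 A0 B0 s False" "size A \<le> size B" "\<forall>x\<in>#A. 0 < x" "\<forall>x\<in>#B. 0 < x"
  shows "wide_both (A0 + A) (B0 + B) s"
  using assms(2-)
proof (induction "size A" arbitrary: A B rule: less_induct)
  case less
  show ?case
  proof (cases "1 \<in># B \<and> 2 \<in># A")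
    case True
    obtain A' where A: "A = add_mset 2 A'" using True mset_add by metis
    obtain B' where B: "B = add_mset 1 B'" using True mset_add by metis
    have "wide_both (A0 + A') (B0 + B') s" using less.prems unfolding A B by (intro less.hyps) (auto simp: A)
    then have "wide_lists (A0 + A') (B0 + B') s" "\<And>y. odd y \<Longrightarrow> wide_lists (add_mset y (A0 + A')) (B0 + B') s" unfolding wide_both_def by blast+
    from this[THEN wide_lists_insert] show ?thesis unfolding wide_both_def A B by (simp add: add_mset_commute)
  next
    case False
    then obtain z where z: "even_state 0 (A0 + A) (B0 + B) s z" using even_state_extend_Z[OF assms(1) less.prems] by blast
    show ?thesis unfolding wide_both_def
    proof (intro conjI allI impI)
      show "wide_lists (A0 + A) (B0 + B) s" by (rule finished_wide_lists[OF even_state_finished_wide[OF z]])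
      fix y :: nat assume "odd y"
      then obtain k where "y = 2 * k + 1" by (rule oddE)
      then show "wide_lists (add_mset y (A0 + A)) (B0 + B) s" using finished_wide_lists[OF even_state_lone[OF z, of k]] by simp
    qed
  qed
qed

lemma odd_state_a_many: "odd_state e A B s \<Longrightarrow> \<forall>x\<in>#X. odd x \<Longrightarrow> size X \<le> e \<Longrightarrow> odd_state (e - size X) (A + X) B s"
proof (induction X)
  case (add x X)
  then have "odd_state (Suc (e - size (add_mset x X))) (A + X) B s" by (simp add: Suc_diff_Suc)
  moreover obtain k where "x = 2 * k + 1" using add.prems(2) by (auto elim: oddE)
  ultimately show ?case using odd_state_Sa[of "e - size (add_mset x X)" "A + X" B s k] by simp
qed simp

text \<open>All legs of the second centre are added before those of the first: each of them creates
  one unit of slack, and each odd leg at the first centre spends one.\<close>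

lemma odd_state_extend:
  assumes "odd_state e A0 B0 s" "\<forall>x\<in>#A. odd x" "\<forall>x\<in>#B. 0 < x" "size A \<le> size B + e"
  shows "antimagic_lists (A0 + A) (B0 + B) s"
  by (rule finished_antimagic[OF odd_state_finished[OF odd_state_a_many[OF odd_state_b_many[OF assms(1)]]]]) (use assms in auto)

lemma odd_state_extend_even:
  assumes "odd_state 0 A0 B0 s" "\<forall>x\<in>#A. even x \<and> 0 < x" "\<forall>x\<in>#B. even x \<and> 0 < x" "size A = size B"
  shows "odd_state 0 (A0 + A) (B0 + B) s"
  using assms(2-)
proof (induction A arbitrary: B)
  case (add a A)
  from add.prems(3) obtain b B' where B: "B = add_mset b B'" by (metis size_add_mset size_eq_Suc_imp_eq_union)
  have IH: "odd_state 0 (A0 + A) (B0 + B') s" using add.prems unfolding B by (intro add.IH) auto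
  obtain k where "a = 2 * k + 2" using add.prems by (auto elim: even_pos_natE)
  moreover obtain j where "b = 2 * j + 2" using add.prems B by (auto elim: even_pos_natE)
  ultimately show ?case using odd_state_EE[OF IH, of k j] unfolding B by simp
qed (use assms(1) in simp)

section \<open>Choosing a base case by parity\<close>

lemma posE:
  assumes "0 < (n::nat)"
  obtains (even) k where "n = 2 * k + 2" | (one) "n = 1" | (odd3) k where "n = 2 * k + 3"
  using assms by (metis even_pos_natE odd_ge3E)

text \<open>A pendant edge with a longer odd leg at the second centre has no base case here. It is
  avoided later by taking other legs or by exchanging the centres.\<close>

lemma base_E_odd:
  assumes "even a" "0 < a" "0 < x" "0 < y" "odd s" "\<not> (x = 1 \<and> odd y \<and> y \<noteq> 1)" "\<not> (y = 1 \<and> odd x \<and> x \<noteq> 1)"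
  shows "even_state 0 {#a#} {#x, y#} s False"
proof -
  obtain k where k: "s = 2 * k + 1" using assms(5) by (rule oddE)
  obtain j where j: "a = 2 * j + 2" using assms(1,2) by (rule even_pos_natE)
  have OO: "2 * i + 3 = 2 * Suc i + 1" for i :: nat by simp
  from assms(3) show ?thesis
  proof (cases rule: posE)
    case x: (even u)
    from assms(4) show ?thesis
    proof (cases rule: posE)
      case (even v) show ?thesis unfolding k j x even by (rule base_odd_E_EE)
    next
      case one show ?thesis unfolding k j x one by (subst add_mset_commute) (rule base_odd_E_1E)
    next
      case (odd3 v) show ?thesis unfolding k j x odd3 by (subst add_mset_commute) (rule base_odd_E_OE)
    qed
  next
    case x: one
    from assms(4) show ?thesis
    proof (cases rule: posE)
      case (even v) show ?thesis unfolding k j x even by (rule base_odd_E_1E)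
    next
      case one show ?thesis unfolding k j x one by (rule base_odd_E_11)
    next
      case (odd3 v) then show ?thesis using assms(6) x by simp
    qed
  next
    case x: (odd3 u)
    from assms(4) show ?thesis
    proof (cases rule: posE)
      case (even v) show ?thesis unfolding k j x even by (rule base_odd_E_OE)
    next
      case one then show ?thesis using assms(7) x by simp
    next
      case (odd3 v) show ?thesis unfolding k j x odd3 OO[of v] by (rule base_odd_E_OO)
    qed
  qed
qed

lemma base_E_even:
  assumes "even a" "0 < a" "2 \<le> x" "0 < y" "even s" "0 < s"
  shows "even_state 0 {#a#} {#x, y#} s False"
proof -
  obtain k where k: "s = 2 * k + 2" using assms(5,6) by (rule even_pos_natE)
  obtain j where j: "a = 2 * j + 2" using assms(1,2) by (rule even_pos_natE)
  show ?thesis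
  proof (cases "even x")
    case True
    then obtain u where u: "x = 2 * u + 2" using assms(3) by (auto elim: even_pos_natE)
    show ?thesis
    proof (cases "even y")
      case True
      then obtain v where v: "y = 2 * v + 2" using assms(4) by (rule even_pos_natE)
      show ?thesis unfolding k j u v by (rule base_even_E_EE)
    next
      case False
      then obtain v where v: "y = 2 * v + 1" by (rule oddE)
      show ?thesis unfolding k j u v by (rule base_even_E_EW)
    qed
  next
    case False
    then obtain u where u: "x = 2 * u + 3" using assms(3) by (auto elim: odd_ge3E)
    show ?thesis
    proof (cases "even y")
      case True
      then obtain v where v: "y = 2 * v + 2" using assms(4) by (rule even_pos_natE)
      have u': "x = 2 * Suc u + 1" using u by simp
      show ?thesis unfolding k j u' v by (subst add_mset_commute) (rule base_even_E_EW)
    next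
      case False
      then obtain v where v: "y = 2 * v + 1" by (rule oddE)
      show ?thesis unfolding k j u v by (rule base_even_E_OW)
    qed
  qed
qed

lemma base_E_111:
  assumes "even a" "0 < a" "0 < w" "even s" "0 < s"
  shows "even_state 0 {#w, a#} {#1, 1, 1#} s False"
proof -
  obtain k where k: "s = 2 * k + 2" using assms(4,5) by (rule even_pos_natE)
  obtain j where j: "a = 2 * j + 2" using assms(1,2) by (rule even_pos_natE)
  show ?thesis
  proof (cases "even w")
    case True
    then obtain v where v: "w = 2 * v + 2" using assms(3) by (rule even_pos_natE)
    show ?thesis unfolding k j v by (rule base_even_EE_111)
  next
    case False
    then obtain v where v: "w = 2 * v + 1" by (rule oddE)
    show ?thesis unfolding k j v by (rule base_even_EW_111)
  qed
qed

lemma base_O: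
  assumes "odd a" "a \<noteq> 1" "odd w" "2 \<le> x" "0 < y" "0 < s"
  shows "odd_state 0 {#a, w#} {#x, y#} s"
proof -
  obtain i where i: "a = 2 * i + 3" using assms(1,2) by (rule odd_ge3E)
  then have i': "a = 2 * Suc i + 1" by simp
  obtain v where v: "w = 2 * v + 1" using assms(3) by (rule oddE)
  have c: "{#u, v#} = {#v, u#}" for u v :: nat by (rule add_mset_commute)
  consider (EE) u t where "x = 2 * u + 2" "y = 2 * t + 2" | (EW) u t where "{#x, y#} = {#2 * t + 1, 2 * u + 2#}"
    | (OW) u t where "x = 2 * u + 3" "y = 2 * t + 1"
  proof (cases "even x")
    case True
    then obtain u where u: "x = 2 * u + 2" using assms(4) by (auto elim: even_pos_natE)
    show ?thesis
    proof (cases "even y")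
      case True
      then obtain t where t: "y = 2 * t + 2" using assms(5) by (rule even_pos_natE)
      show ?thesis using EE[OF u t] .
    next
      case False
      then obtain t where t: "y = 2 * t + 1" by (rule oddE)
      show ?thesis using EW[of t u] u t by (simp add: c)
    qed
  next
    case False
    then obtain u where u: "x = 2 * u + 3" using assms(4) by (auto elim: odd_ge3E)
    show ?thesis
    proof (cases "even y")
      case True
      then obtain t where t: "y = 2 * t + 2" using assms(5) by (rule even_pos_natE)
      show ?thesis using EW[of "Suc u" t] u t by (simp add: numeral_3_eq_3)
    next
      case False
      then obtain t where t: "y = 2 * t + 1" by (rule oddE)
      show ?thesis using OW[OF u t] .
    qed
  qed
  note xy = this
  show ?thesis
  proof (cases "even s")
    case True
    then obtain k where k: "s = 2 * k + 2" using assms(6) by (rule even_pos_natE)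
    from xy show ?thesis
    proof cases
      case EE show ?thesis unfolding k EE i' v by (rule base_even_OW_EE)
    next
      case EW show ?thesis unfolding k EW i v by (rule base_even_OW_EW)
    next
      case OW show ?thesis unfolding k OW i' v by (rule base_even_OW_OW)
    qed
  next
    case False
    then obtain k where k: "s = 2 * k + 1" by (rule oddE)
    from xy show ?thesis
    proof cases
      case EE show ?thesis unfolding k EE i v by (rule base_odd_OW_EE)
    next
      case EW show ?thesis unfolding k EW i v c[of "2 * i + 3"] by (rule base_odd_OW_EW)
    next
      case OW show ?thesis unfolding k OW i v c[of "2 * i + 3"] by (rule base_odd_OW_OW)
    qed
  qed
qed

lemma base_O_111:
  assumes "odd a" "a \<noteq> 1" "odd w" "0 < s"
  shows "odd_state 0 {#w, a#} {#1, 1, 1#} s"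
proof -
  obtain i where i: "a = 2 * i + 3" using assms(1,2) by (rule odd_ge3E)
  obtain v where v: "w = 2 * v + 1" using assms(3) by (rule oddE)
  show ?thesis
  proof (cases "even s")
    case True
    then obtain k where k: "s = 2 * k + 2" using assms(4) by (rule even_pos_natE)
    show ?thesis unfolding k i v by (rule base_even_OW_111)
  next
    case False
    then obtain k where k: "s = 2 * k + 1" by (rule oddE)
    show ?thesis unfolding k i v by (rule base_odd_OW_111)
  qed
qed

lemma base_11_odd:
  assumes "2 \<le> x" "0 < y" "odd s"
  shows "odd_state 0 {#1, 1#} {#x, y#} s"
proof -
  obtain k where k: "s = 2 * k + 1" using assms(3) by (rule oddE)
  show ?thesis
  proof (cases "even x")
    case True
    then obtain u where u: "x = 2 * u + 2" using assms(1) by (auto elim: even_pos_natE)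
    show ?thesis
    proof (cases "even y")
      case True
      then obtain t where t: "y = 2 * t + 2" using assms(2) by (rule even_pos_natE)
      show ?thesis unfolding k u t by (rule base_odd_11_EE)
    next
      case False
      then obtain t where t: "y = 2 * t + 1" by (rule oddE)
      show ?thesis unfolding k u t by (rule base_odd_11_EW)
    qed
  next
    case False
    then obtain u where u: "x = 2 * u + 3" using assms(1) by (auto elim: odd_ge3E)
    show ?thesis
    proof (cases "even y")
      case True
      then obtain t where t: "y = 2 * t + 2" using assms(2) by (rule even_pos_natE)
      have u': "x = 2 * Suc u + 1" using u by simp
      show ?thesis unfolding k u' t by (subst add_mset_commute) (rule base_odd_11_EW)
    next
      case False
      then obtain t where t: "y = 2 * t + 1" by (rule oddE)
      show ?thesis unfolding k u t by (rule base_odd_11_OW)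
    qed
  qed
qed

lemma base_11_even:
  assumes "even x" "0 < x" "0 < y" "even s" "0 < s"
  shows "odd_state 0 {#1, 1#} {#x, y#} s"
proof -
  obtain k where k: "s = 2 * k + 2" using assms(4,5) by (rule even_pos_natE)
  obtain u where u: "x = 2 * u + 2" using assms(1,2) by (rule even_pos_natE)
  show ?thesis
  proof (cases "even y")
    case True
    then obtain t where t: "y = 2 * t + 2" using assms(3) by (rule even_pos_natE)
    show ?thesis unfolding k u t by (rule base_even_11_EE)
  next
    case False
    then obtain t where t: "y = 2 * t + 1" by (rule oddE)
    show ?thesis unfolding k u t using base_even_11_EW[of u t k] by simp
  qed
qed

lemma base_EE:
  assumes "even a" "0 < a" "even b" "0 < b" "even c" "0 < c" "even d" "0 < d" "0 < s"
  shows "odd_state 0 {#a, b#} {#c, d#} s"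
proof -
  obtain a' b' c' d' where e: "a = 2 * a' + 2" "b = 2 * b' + 2" "c = 2 * c' + 2" "d = 2 * d' + 2"
    using assms by (metis even_pos_natE)
  show ?thesis
  proof (cases "even s")
    case True
    then obtain k where k: "s = 2 * k + 2" using assms by (auto elim: even_pos_natE)
    show ?thesis unfolding k e by (rule base_even_EE_EE)
  next
    case False
    then obtain k where k: "s = 2 * k + 1" by (rule oddE)
    show ?thesis unfolding k e by (rule base_odd_EE_EE)
  qed
qed

section \<open>Case distinction on the legs\<close>

lemma mset_pairE:
  assumes "x \<in># M" "2 \<le> size M"
  obtains y M' where "M = {#x, y#} + M'"
proof -
  obtain N where N: "M = add_mset x N" using assms(1) by (rule mset_add)
  then have "N \<noteq> {#}" using assms(2) by auto
  then obtain y where "y \<in># N" by (rule multiset_nonemptyE)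
  then obtain M' where "N = add_mset y M'" by (rule mset_add)
  then show ?thesis using that[of y M'] N by simp
qed

lemma mset_all_eq:
  assumes "\<forall>x\<in>#M. x = c" "n \<le> size M"
  obtains M' where "M = replicate_mset n c + M'" "\<forall>x\<in>#M'. x = c"
proof -
  have "M = replicate_mset (size M) c" using assms(1) by (simp add: set_mset_subset_singletonD subset_eq)
  also have "\<dots> = replicate_mset n c + replicate_mset (size M - n) c" using assms(2) by (simp add: multiset_eq_iff)
  finally show ?thesis using that by (metis count_replicate_mset in_replicate_mset)
qed

lemma Evens_odd_pair:
  assumes pos: "\<forall>x\<in>#A. 0 < x" "\<forall>x\<in>#B. 0 < x" and a: "a \<in># A" "even a" and sz: "size A < size B"
    and s: "odd s" and B: "B = {#x, y#} + B'" and xy: "\<not> (x = 1 \<and> odd y \<and> y \<noteq> 1)" "\<not> (y = 1 \<and> odd x \<and> x \<noteq> 1)"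
  shows "wide_both A B s"
proof -
  obtain A' where A: "A = {#a#} + A'" using a(1) by (metis add_mset_add_single mset_add add.commute)
  have "even_state 0 {#a#} {#x, y#} s False" using pos a s xy unfolding A B by (intro base_E_odd) auto
  from wide_both_extend[OF this] show ?thesis using pos sz unfolding A B by simp
qed

text \<open>An even leg at the first centre and two suitable legs at the second form the base. If
  the core is even and the second centre has pendant edges only, a larger base is needed: two legs
  against three pendant edges, available because \<open>2 \<le> size A < size B\<close>.\<close>

lemma Evens:
  assumes pos: "\<forall>x\<in>#A. 0 < x" "\<forall>x\<in>#B. 0 < x" and a: "a \<in># A" "even a" and sz: "size A < size B" and s: "0 < s"
    and o: "odd s \<Longrightarrow> 3 \<le> size B \<or> (\<nexists>y. odd y \<and> y \<noteq> 1 \<and> B = {#1, y#})"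
    and e: "even s \<Longrightarrow> 2 \<le> size A \<or> (\<exists>x\<in>#B. x \<noteq> 1)"
  shows "wide_both A B s"
proof (cases "odd s")
  case True
  note E = Evens_odd_pair[OF pos a sz True]
  have "0 < size A" using a(1) by (cases A) auto
  then have "2 \<le> size B" using sz by simp
  then obtain x where "x \<in># B" by (metis multiset_nonemptyE not_numeral_le_zero size_empty)
  then obtain y B' where B: "B = {#x, y#} + B'" using \<open>2 \<le> size B\<close> by (rule mset_pairE)
  show ?thesis
  proof (cases "B' = {#}")
    case True
    then have "size B = 2" using B by simp
    then have n: "\<nexists>y. odd y \<and> y \<noteq> 1 \<and> B = {#1, y#}" using o \<open>odd s\<close> by simp
    show ?thesis by (rule E[OF B]) (use n B True in \<open>auto simp: add_mset_commute\<close>)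
  next
    case False
    then obtain w where "w \<in># B'" by (rule multiset_nonemptyE)
    then obtain B'' where B'': "B' = add_mset w B''" by (rule mset_add)
    have B3: "B = {#x, y#} + add_mset w B''" "B = {#x, w#} + add_mset y B''" "B = {#y, w#} + add_mset x B''"
      using B B'' by (simp_all add: add_mset_commute)
    \<comment> \<open>The excluded pairs join 1 to an odd length other than 1. This relation is
      bipartite, so three legs cannot be pairwise excluded.\<close>
    show ?thesis
    proof (rule ccontr)
      assume n: "\<not> wide_both A B s"
      show False using E[OF B3(1)] E[OF B3(2)] E[OF B3(3)] n by metis
    qed
  qed
next
  case False
  then have es: "even s" by simp
  show ?thesis
  proof (cases "\<exists>x\<in>#B. x \<noteq> 1")
    case True
    then obtain x where x: "x \<in># B" "x \<noteq> 1" by blast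
    have "0 < size A" using a(1) by (cases A) auto
    then have "2 \<le> size B" using sz by simp
    then obtain y B' where B: "B = {#x, y#} + B'" using x(1) by (metis mset_pairE)
    have "0 < x" using x pos by blast
    then have "2 \<le> x" using x(2) by linarith
    obtain A' where A: "A = {#a#} + A'" using a(1) by (metis add_mset_add_single mset_add add.commute)
    have "even_state 0 {#a#} {#x, y#} s False" using pos a s es \<open>2 \<le> x\<close> unfolding A B by (intro base_E_even) auto
    from wide_both_extend[OF this] show ?thesis using pos sz unfolding A B by simp
  next
    case False
    then have "2 \<le> size A" using e es by blast
    then obtain w A' where A: "A = {#a, w#} + A'" using a(1) by (metis mset_pairE)
    have "3 \<le> size B" using \<open>2 \<le> size A\<close> sz by linarith
    then obtain B' where "B = replicate_mset 3 1 + B'" using False by (metis mset_all_eq)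
    then have B: "B = {#1, 1, 1#} + B'" by (simp add: numeral_3_eq_3)
    have "even_state 0 {#w, a#} {#1, 1, 1#} s False" using pos a s es unfolding A by (intro base_E_111) auto
    then have "even_state 0 {#a, w#} {#1, 1, 1#} s False" by (simp add: add_mset_commute)
    from wide_both_extend[OF this] show ?thesis using pos sz unfolding A B by simp
  qed
qed

lemma Odds:
  assumes pos: "\<forall>x\<in>#B. 0 < x" and A: "\<forall>x\<in>#A. odd x" "a \<in># A" "a \<noteq> 1" "2 \<le> size A" "size A \<le> size B"
    and B: "x \<in># B" "x \<noteq> 1" and s: "0 < s"
  shows "antimagic_lists A B s"
proof -
  obtain w A' where A': "A = {#a, w#} + A'" using A by (metis mset_pairE)
  have "2 \<le> size B" using A by linarith
  then obtain y B' where B': "B = {#x, y#} + B'" using B by (metis mset_pairE)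
  have "0 < x" using B pos by blast
  then have "2 \<le> x" using B(2) by linarith
  have "odd_state 0 {#a, w#} {#x, y#} s" using A pos s \<open>2 \<le> x\<close> unfolding A' B' by (intro base_O) auto
  from odd_state_extend[OF this] show ?thesis using A pos unfolding A' B' by simp
qed

lemma Odds_Ones:
  assumes A: "\<forall>x\<in>#A. odd x" "a \<in># A" "a \<noteq> 1" "2 \<le> size A" "size A < size B"
    and B: "\<forall>x\<in>#B. x = 1" and s: "0 < s"
  shows "antimagic_lists A B s"
proof -
  obtain w A' where A': "A = {#a, w#} + A'" using A by (metis mset_pairE)
  have "3 \<le> size B" using A by linarith
  then obtain B' where "B = replicate_mset 3 1 + B'" using B by (metis mset_all_eq)
  then have B': "B = {#1, 1, 1#} + B'" by (simp add: numeral_3_eq_3)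
  have "odd_state 0 {#w, a#} {#1, 1, 1#} s" using A s unfolding A' by (intro base_O_111) auto
  then have "odd_state 0 {#a, w#} {#1, 1, 1#} s" by (simp add: add_mset_commute)
  moreover have "\<forall>x\<in>#A'. odd x" "\<forall>x\<in>#B'. 0 < x" "size A' \<le> size B' + 0" using A B unfolding A' B' by auto
  ultimately show ?thesis unfolding A' B' by (rule odd_state_extend)
qed

lemma Ones_11:
  assumes "odd_state 0 {#1, 1#} B0 s" "\<forall>x\<in>#A. x = 1" "2 \<le> size A" "size A \<le> size B" "\<forall>x\<in>#B. 0 < x" "B = B0 + B'" "size B0 = 2"
  shows "antimagic_lists A B s"
proof -
  obtain A' where A: "A = replicate_mset 2 1 + A'" "\<forall>x\<in>#A'. x = 1" using assms(2,3) by (metis mset_all_eq)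
  then have A': "A = {#1, 1#} + A'" by (simp add: numeral_2_eq_2)
  show ?thesis unfolding A' assms(6) by (rule odd_state_extend[OF assms(1)]) (use assms A A' in auto)
qed

lemma Ones_odd:
  assumes A: "\<forall>x\<in>#A. x = 1" "2 \<le> size A" "size A \<le> size B" and pos: "\<forall>x\<in>#B. 0 < x" and s: "odd s"
  shows "antimagic_lists A B s"
proof (cases "\<exists>x\<in>#B. x \<noteq> 1")
  case True
  then obtain x where x: "x \<in># B" "x \<noteq> 1" by blast
  have "2 \<le> size B" using A by linarith
  then obtain y B' where B': "B = {#x, y#} + B'" using x by (metis mset_pairE)
  have "0 < x" using x pos by blast
  then have "2 \<le> x" using x(2) by linarith
  have "odd_state 0 {#1, 1#} {#x, y#} s" using pos s \<open>2 \<le> x\<close> unfolding B' by (intro base_11_odd) auto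
  from Ones_11[OF this A pos B'] show ?thesis by simp
next
  case False
  have "2 \<le> size B" "1 \<le> size A" using A by linarith+
  then obtain B' where "B = replicate_mset 2 1 + B'" using False by (metis mset_all_eq)
  then have B': "B = {#1, 1#} + B'" by (simp add: numeral_2_eq_2)
  obtain A' where "A = replicate_mset 1 1 + A'" "\<forall>x\<in>#A'. x = 1" using A \<open>1 \<le> size A\<close> by (metis mset_all_eq)
  then have A': "A = {#1#} + A'" "\<forall>x\<in>#A'. x = 1" by simp_all
  obtain k where k: "s = 2 * k + 1" using s by (rule oddE)
  have "odd_state 1 {#1#} {#1, 1#} s" unfolding k by (rule base_odd_1_11)
  moreover have "\<forall>x\<in>#A'. odd x" using A'(2) by (metis odd_one)
  moreover have "\<forall>x\<in>#B'. 0 < x" "size A' \<le> size B' + 1" using A pos unfolding A' B' by auto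
  ultimately show ?thesis unfolding A'(1) B' by (rule odd_state_extend)
qed

lemma Ones_even:
  assumes A: "\<forall>x\<in>#A. x = 1" "2 \<le> size A" "size A \<le> size B" and pos: "\<forall>x\<in>#B. 0 < x" and s: "even s" "0 < s"
  shows "antimagic_lists A B s"
proof -
  have sB: "2 \<le> size B" using A by linarith
  obtain k where k: "s = 2 * k + 2" using s by (rule even_pos_natE)
  note O = Ones_11[OF _ A pos]
  show ?thesis
  proof (cases "\<exists>x\<in>#B. even x")
    case True
    then obtain x where x: "x \<in># B" "even x" by blast
    then obtain y B' where B': "B = {#x, y#} + B'" using sB by (metis mset_pairE)
    have "odd_state 0 {#1, 1#} {#x, y#} s" using pos s x unfolding B' by (intro base_11_even) auto
    from O[OF this B'] show ?thesis by simp
  next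
    case False
    obtain x where "x \<in># B" using sB by (metis multiset_nonemptyE not_numeral_le_zero size_empty)
    then obtain y B' where B: "B = {#x, y#} + B'" using sB by (rule mset_pairE)
    \<comment> \<open>All legs at the second centre are odd here, so two of them yield a base case
      as soon as both or neither are pendant edges.\<close>
    have good: "antimagic_lists A B s" if "B = {#u, v#} + C" "(u = 1 \<longleftrightarrow> v = 1)" for u v C
    proof (cases "u = 1")
      case True
      have "odd_state 0 {#1, 1#} {#1, 1#} s" unfolding k by (rule base_even_11_11)
      from O[OF this, of C] show ?thesis using that True by simp
    next
      case False
      then have "u \<noteq> 1" "v \<noteq> 1" "odd u" "odd v" using that \<open>\<not> (\<exists>x\<in>#B. even x)\<close> by auto
      then obtain i j where ij: "u = 2 * i + 3" "v = 2 * j + 3" by (metis odd_ge3E)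
      have "odd_state 0 {#1, 1#} {#2 * i + 3, 2 * Suc j + 1#} s" unfolding k by (rule base_even_11_OO)
      then have "odd_state 0 {#1, 1#} {#u, v#} s" using ij by (simp add: numeral_3_eq_3)
      from O[OF this that(1)] show ?thesis by simp
    qed
    show ?thesis
    proof (cases "B' = {#}")
      case True
      show ?thesis
      proof (cases "x = 1 \<longleftrightarrow> y = 1")
        case True then show ?thesis using good[OF B] by blast
      next
        case ne: False
        obtain v where v: "B = {#1, v#}" "v \<noteq> 1"
        proof (cases "x = 1")
          case True then show ?thesis using that[of y] B \<open>B' = {#}\<close> ne by simp
        next
          case False then show ?thesis using that[of x] B \<open>B' = {#}\<close> ne by (simp add: add_mset_commute)
        qed
        have "odd v" using False v by auto
        then obtain j where j: "v = 2 * j + 3" using v(2) by (rule odd_ge3E)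
        show ?thesis
        proof (cases "\<exists>i. j = Suc i \<or> k = Suc (Suc i)")
          case True
          then have "odd_state 0 {#1, 1#} {#1, v#} s"
            using base_even_11_1O5[of _ k] base_even_11_13[of j] unfolding j k by auto
          from O[OF this, of "{#}"] show ?thesis using v by simp
        next
          case False
          \<comment> \<open>What remains is a leg of length 3 with a core of length 2 or 4. As
            \<open>size A \<le> size B = 2\<close>, this is a single spider for each core, and both
            are labelled explicitly.\<close>
          have "j = 0" using False by (cases j) auto
          have "k = 0 \<or> k = 1" using False by (metis One_nat_def not0_implies_Suc)
          then have "s = 2 \<or> s = 4" "v = 3" using k j \<open>j = 0\<close> by auto
          moreover have "A = {#1, 1#}"
          proof -
            obtain A' where "A = replicate_mset 2 1 + A'" using A(1,2) by (metis mset_all_eq)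
            then have "A = {#1, 1#} + A'" by (simp add: numeral_2_eq_2)
            moreover have "size A = 2" using A v by simp
            ultimately show ?thesis by simp
          qed
          ultimately show ?thesis using v antimagic_lists_11_13_2 antimagic_lists_11_13_4 by auto
        qed
      qed
    next
      case False
      then obtain w where "w \<in># B'" by (rule multiset_nonemptyE)
      then obtain B'' where B'': "B' = add_mset w B''" by (rule mset_add)
      have B3: "B = {#x, y#} + add_mset w B''" "B = {#x, w#} + add_mset y B''" "B = {#y, w#} + add_mset x B''"
        using B B'' by (simp_all add: add_mset_commute)
      \<comment> \<open>Of three legs, two agree on whether they are pendant edges.\<close>
      show ?thesis using good[OF B3(1)] good[OF B3(2)] good[OF B3(3)] by blast
    qed
  qed
qed

lemma Ones:
  assumes "\<forall>x\<in>#A. x = 1" "2 \<le> size A" "size A \<le> size B" "\<forall>x\<in>#B. 0 < x" "0 < s"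
  shows "antimagic_lists A B s"
  using Ones_odd[of A B s] Ones_even[of A B s] assms by blast

lemma labelling_less:
  assumes pos: "\<forall>x\<in>#A. 0 < x" "\<forall>x\<in>#B. 0 < x" and sz: "2 \<le> size A" "size A < size B" and s: "0 < s"
  shows "antimagic_lists A B s"
proof (cases "\<exists>a\<in>#A. even a")
  case True
  then obtain a where a: "a \<in># A" "even a" by blast
  have "wide_both A B s" by (rule Evens[OF pos a sz(2) s]) (use sz in auto)
  then show ?thesis unfolding wide_both_def using wide_lists_antimagic by blast
next
  case odd: False
  show ?thesis
  proof (cases "\<exists>a\<in>#A. a \<noteq> 1")
    case True
    then obtain a where a: "a \<in># A" "a \<noteq> 1" by blast
    show ?thesis
    proof (cases "\<exists>x\<in>#B. x \<noteq> 1")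
      case True
      then show ?thesis using Odds[OF pos(2) _ a sz(1) _ _ _ s] odd sz by auto
    next
      case False
      show ?thesis by (rule Odds_Ones[OF _ a sz _ s]) (use odd False in blast)+
    qed
  next
    case False
    show ?thesis by (rule Ones) (use False sz pos s in auto)
  qed
qed

text \<open>Setting the odd leg \<open>y\<close> aside makes the first centre the smaller one, so
  that \<open>Evens\<close> applies; \<open>y\<close> returns through the second part of
  \<open>wide_both\<close>. If the second centre is unsuitable for this, its legs are all odd and
  the centres exchange roles.\<close>

lemma labelling_mixed:
  assumes pos: "\<forall>x\<in>#A. 0 < x" "\<forall>x\<in>#B. 0 < x" and sz: "2 \<le> size A" "size A = size B" and s: "0 < s"
    and a: "a \<in># A" "even a" and y: "y \<in># A" "odd y"
  shows "antimagic_lists A B s \<or> antimagic_lists B A s"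
proof -
  obtain A1 where A1: "A = add_mset y A1" using y(1) by (rule mset_add)
  have a1: "a \<in># A1" using a y A1 by auto
  have pos1: "\<forall>x\<in>#A1. 0 < x" using pos A1 by auto
  have sz1: "size A1 < size B" using sz A1 by simp
  consider (ones) "\<forall>x\<in>#B. x = 1" | (bad) v where "odd v" "v \<noteq> 1" "B = {#1, v#}"
    | (good) "\<exists>x\<in>#B. x \<noteq> 1" "\<nexists>y. odd y \<and> y \<noteq> 1 \<and> B = {#1, y#}" by blast
  then show ?thesis
  proof cases
    case ones
    then have "antimagic_lists B A s" using Ones[of B A s] pos sz s by simp
    then show ?thesis ..
  next
    case bad
    have "antimagic_lists B A s" by (rule Odds[of A B v a s]) (use bad pos sz s a in auto)
    then show ?thesis ..
  next
    case good
    have "wide_both A1 B s" by (rule Evens[OF pos1 pos(2) a1 a(2) sz1 s]) (use good in auto)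
    then have "wide_lists A B s" using y(2) unfolding wide_both_def A1 by blast
    then show ?thesis using wide_lists_antimagic by blast
  qed
qed

text \<open>A centre with odd legs only can be taken first, except that a centre with pendant edges
  only has precedence. If both have an even leg, either one of them has both parities and
  \<open>labelling_mixed\<close> applies, or all legs are even and are paired off in an
  \<open>odd_state\<close>.\<close>

lemma labelling_eq:
  assumes pos: "\<forall>x\<in>#A. 0 < x" "\<forall>x\<in>#B. 0 < x" and sz: "2 \<le> size A" "size A = size B" and s: "0 < s"
  shows "antimagic_lists A B s \<or> antimagic_lists B A s"
proof -
  have side: "antimagic_lists A B s \<or> antimagic_lists B A s" if odd: "\<forall>x\<in>#A. odd x" and sz: "2 \<le> size A" "size A = size B"
     and pos: "\<forall>x\<in>#A. 0 < x" "\<forall>x\<in>#B. 0 < x" for A B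
  proof -
    have sB: "2 \<le> size B" "size B \<le> size A" "size A \<le> size B" using sz by simp_all
    show ?thesis
    proof (cases "\<forall>x\<in>#A. x = 1")
      case True
      from Ones[OF this sz(1) sB(3) pos(2) s] show ?thesis ..
    next
      case False
      then obtain a where a: "a \<in># A" "a \<noteq> 1" by blast
      show ?thesis
      proof (cases "\<forall>x\<in>#B. x = 1")
        case True
        from Ones[OF this sB(1,2) pos(1) s] show ?thesis ..
      next
        case False
        then obtain b where "b \<in># B" "b \<noteq> 1" by blast
        from Odds[OF pos(2) odd a sz(1) sB(3) this s] show ?thesis ..
      qed
    qed
  qed
  have sB: "2 \<le> size B" using sz by simp
  show ?thesis
  proof (cases "(\<forall>x\<in>#A. odd x) \<or> (\<forall>x\<in>#B. odd x)")
    case True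
    then show ?thesis
    proof
      assume "\<forall>x\<in>#A. odd x" from side[OF this sz pos] show ?thesis .
    next
      assume "\<forall>x\<in>#B. odd x" from side[OF this sB sz(2)[symmetric] pos(2,1)] show ?thesis by (rule disj_commute[THEN iffD1])
    qed
  next
    case False
    then obtain a b where a: "a \<in># A" "even a" and b: "b \<in># B" "even b" by blast
    show ?thesis
    proof (cases "\<exists>y\<in>#A. odd y")
      case True
      then show ?thesis using labelling_mixed[OF pos sz s a] by blast
    next
      case eA: False
      show ?thesis
      proof (cases "\<exists>y\<in>#B. odd y")
        case True
        then obtain y where y: "y \<in># B" "odd y" by blast
        from labelling_mixed[OF pos(2,1) sB sz(2)[symmetric] s b y] show ?thesis by (rule disj_commute[THEN iffD1])
      next
        case eB: False
        obtain a' A' where A: "A = {#a, a'#} + A'" using a(1) sz(1) by (rule mset_pairE)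
        obtain b' B' where B: "B = {#b, b'#} + B'" using b(1) sB by (rule mset_pairE)
        have ev: "\<forall>x\<in>#A. even x \<and> 0 < x" "\<forall>x\<in>#B. even x \<and> 0 < x" using eA eB pos by blast+
        have "odd_state 0 {#a, a'#} {#b, b'#} s" by (rule base_EE) (use ev[unfolded A B] s in simp_all)
        then have "odd_state 0 A B s" unfolding A B by (rule odd_state_extend_even) (use ev[unfolded A B] sz[unfolded A B] in simp_all)
        then have "antimagic_lists A B s" by (intro finished_antimagic odd_state_finished)
        then show ?thesis ..
      qed
    qed
  qed
qed

section \<open>Acyclic graphs\<close>

definition pedges :: "'a list \<Rightarrow> 'a set list" where
  "pedges p = map (\<lambda>(x, y). {x, y}) (zip p (tl p))"

lemma pedges_simps [simp]: "pedges [] = []" "pedges [x] = []" "pedges (x # y # p) = {x, y} # pedges (y # p)"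
  by (simp_all add: pedges_def)

lemma length_pedges [simp]: "length (pedges p) = length p - 1"
  by (simp add: pedges_def)

lemma pedges_append: "pedges (p @ x # q) = pedges (p @ [x]) @ pedges (x # q)"
  by (induction p rule: induct_list012) auto

lemma pedges_snoc: "p \<noteq> [] \<Longrightarrow> pedges (p @ [u]) = pedges p @ [{last p, u}]"
  by (induction p rule: induct_list012) auto

lemma pedges_Cons: "p \<noteq> [] \<Longrightarrow> pedges (u # p) = {u, hd p} # pedges p"
  by (cases p) auto

lemma set_pedges_rev: "set (pedges (rev p)) = set (pedges p)"
proof (induction p)
  case (Cons x p)
  show ?case
  proof (cases "p = []")
    case False
    then have "set (pedges (rev (x # p))) = insert {hd p, x} (set (pedges (rev p)))"
      by (simp add: pedges_snoc last_rev)
    then show ?thesis using Cons False by (simp add: pedges_Cons insert_commute)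
  qed simp
qed simp

lemma pedges_subset: "e \<in> set (pedges p) \<Longrightarrow> e \<subseteq> set p"
  by (induction p rule: induct_list012) auto

lemma pedges_meets_tl: "e \<in> set (pedges (x # p)) \<Longrightarrow> e \<inter> set p \<noteq> {}"
  by (induction p arbitrary: x) auto

lemma distinct_pedges: "distinct p \<Longrightarrow> distinct (pedges p)"
proof (induction p rule: induct_list012)
  case (3 x y p)
  have "x \<notin> set (y # p)" using 3(3) by simp
  then have "{x, y} \<notin> set (pedges (y # p))" using pedges_subset[of "{x, y}" "y # p"] by blast
  then show ?case using 3(2,3) by simp
qed simp_all

lemma is_walk_iff: "is_walk E p \<longleftrightarrow> p \<noteq> [] \<and> set (pedges p) \<subseteq> E"
proof -
  have "(\<forall>i. Suc i < length p \<longrightarrow> {p ! i, p ! Suc i} \<in> E) \<longleftrightarrow> set (pedges p) \<subseteq> E"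
  proof (induction p rule: induct_list012)
    case (3 x y p)
    have "(\<forall>i. Suc i < length (x # y # p) \<longrightarrow> {(x # y # p) ! i, (x # y # p) ! Suc i} \<in> E) \<longleftrightarrow>
       {x, y} \<in> E \<and> (\<forall>i. Suc i < length (y # p) \<longrightarrow> {(y # p) ! i, (y # p) ! Suc i} \<in> E)"
    proof -
      have "(\<forall>i. P i) \<longleftrightarrow> P 0 \<and> (\<forall>i. P (Suc i))" for P by (metis not0_implies_Suc)
      from this[of "\<lambda>i. Suc i < length (x # y # p) \<longrightarrow> {(x # y # p) ! i, (x # y # p) ! Suc i} \<in> E"] show ?thesis by simp
    qed
    then show ?case using 3 by simp
  qed auto
  then show ?thesis unfolding is_walk_def by simp
qed

lemma distinct_walk:
  assumes "p \<noteq> []" "set (pedges p) \<subseteq> E"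
  shows "\<exists>q. q \<noteq> [] \<and> set (pedges q) \<subseteq> E \<and> hd q = hd p \<and> last q = last p \<and> distinct q"
  using assms
proof (induction p)
  case (Cons x p)
  show ?case
  proof (cases "p = []")
    case True then show ?thesis by (intro exI[of _ "[x]"]) simp
  next
    case False
    then obtain q where q: "q \<noteq> []" "set (pedges q) \<subseteq> E" "hd q = hd p" "last q = last p" "distinct q"
      using Cons by (auto simp: pedges_Cons)
    show ?thesis
    proof (cases "x \<in> set q")
      case True
      then obtain q1 q2 where q12: "q = q1 @ x # q2" by (metis split_list)
      have "set (pedges (x # q2)) \<subseteq> E" using q(2) pedges_append[of q1 x q2] q12 by simp
      moreover have "distinct (x # q2)" "last (x # q2) = last (x # p)" using q(4,5) q12 False by simp_all
      ultimately show ?thesis by (intro exI[of _ "x # q2"]) simp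
    next
      case x: False
      show ?thesis using q False x Cons.prems by (intro exI[of _ "x # q"]) (auto simp: pedges_Cons)
    qed
  qed
qed simp

section \<open>Connected vertex sets and their growth\<close>

definition joined :: "'a set set \<Rightarrow> 'a set \<Rightarrow> bool" where
  "joined E U \<longleftrightarrow> (\<forall>x\<in>U. \<forall>y\<in>U. \<exists>p. p \<noteq> [] \<and> set (pedges p) \<subseteq> E \<and> hd p = x \<and> last p = y \<and> distinct p \<and> set p \<subseteq> U)"

lemma joinedE:
  assumes "joined E U" "x \<in> U" "y \<in> U"
  obtains p where "p \<noteq> []" "set (pedges p) \<subseteq> E" "hd p = x" "last p = y" "distinct p" "set p \<subseteq> U"
  using assms unfolding joined_def by meson

lemma joined_insert:
  assumes U: "joined E U" and u: "u \<notin> U" "w \<in> U" "{u, w} \<in> E"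
  shows "joined E (insert u U)"
  unfolding joined_def
proof (intro ballI)
  fix x y assume xy: "x \<in> insert u U" "y \<in> insert u U"
  show "\<exists>p. p \<noteq> [] \<and> set (pedges p) \<subseteq> E \<and> hd p = x \<and> last p = y \<and> distinct p \<and> set p \<subseteq> insert u U"
  proof (cases "x = u")
    case True
    show ?thesis
    proof (cases "y = u")
      case True then show ?thesis using \<open>x = u\<close> by (intro exI[of _ "[u]"]) simp
    next
      case False
      then obtain p where "p \<noteq> []" "set (pedges p) \<subseteq> E" "hd p = w" "last p = y" "distinct p" "set p \<subseteq> U" using joinedE[OF U u(2)] xy(2) by auto
      then show ?thesis using True u by (intro exI[of _ "u # p"]) (auto simp: pedges_Cons)
    qed
  next
    case x: False
    show ?thesis
    proof (cases "y = u")
      case True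
      obtain p where "p \<noteq> []" "set (pedges p) \<subseteq> E" "hd p = x" "last p = w" "distinct p" "set p \<subseteq> U" using joinedE[OF U _ u(2), of x] xy(1) x by auto
      then show ?thesis using True u by (intro exI[of _ "p @ [u]"]) (auto simp: pedges_snoc insert_commute)
    next
      case False
      then obtain p where "p \<noteq> []" "set (pedges p) \<subseteq> E" "hd p = x" "last p = y" "distinct p" "set p \<subseteq> U" using joinedE[OF U, of x y] xy x by auto
      then show ?thesis by (intro exI[of _ p]) auto
    qed
  qed
qed

text \<open>A second neighbour of \<open>u\<close> in \<open>U\<close> would close a cycle.\<close>

lemma edges_insert:
  assumes U: "joined E U" and u: "u \<notin> U" "w \<in> U" "{u, w} \<in> E" and c: "\<not> has_cycle E" and e2: "\<forall>e\<in>E. card e = 2"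
  shows "{e \<in> E. e \<subseteq> insert u U} = insert {w, u} {e \<in> E. e \<subseteq> U}"
proof -
  have "e = {u, w}" if e: "e \<in> E" "e \<subseteq> insert u U" "\<not> e \<subseteq> U" for e
  proof (rule ccontr)
    assume ne: "e \<noteq> {u, w}"
    have "u \<in> e" using e by blast
    moreover have "card e = 2" using e2 e by blast
    ultimately obtain v where v: "e = {u, v}" "v \<noteq> u" by (auto simp: card_2_iff)
    then have "v \<in> U" "v \<noteq> w" using e ne by auto
    then obtain p where p: "p \<noteq> []" "set (pedges p) \<subseteq> E" "hd p = v" "last p = w" "distinct p" "set p \<subseteq> U"
      using joinedE[OF U _ u(2), of v] by blast
    have "length p \<noteq> 1" using p \<open>v \<noteq> w\<close> by (auto simp: length_Suc_conv)
    then have "2 \<le> length p" using p(1) by (metis One_nat_def Suc_leI length_greater_0_conv le_neq_implies_less numeral_2_eq_2)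
    have "pedges (u # p @ [u]) = {u, v} # pedges p @ [{w, u}]" using p by (simp add: pedges_Cons pedges_snoc)
    then have "is_walk E (u # p @ [u])" unfolding is_walk_iff using p v e u by (auto simp: insert_commute)
    moreover have "distinct (tl (u # p @ [u]))" using p u by auto
    ultimately have "has_cycle E" unfolding has_cycle_def
      using \<open>2 \<le> length p\<close> by (intro exI[of _ "u # p @ [u]"]) simp
    then show False using c by blast
  qed
  then have "{e \<in> E. e \<subseteq> insert u U} \<subseteq> insert {u, w} {e \<in> E. e \<subseteq> U}" by blast
  moreover have "insert {u, w} {e \<in> E. e \<subseteq> U} \<subseteq> {e \<in> E. e \<subseteq> insert u U}" using u by blast
  ultimately show ?thesis by (simp add: insert_commute)
qed

lemma joined_path:
  assumes "p \<noteq> []" "set (pedges p) \<subseteq> E" "distinct p" and c: "\<not> has_cycle E" and e2: "\<forall>e\<in>E. card e = 2"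
  shows "joined E (set p) \<and> {e \<in> E. e \<subseteq> set p} = set (pedges p)"
  using assms(1-3)
proof (induction p rule: rev_nonempty_induct)
  case (single x)
  have "{e \<in> E. e \<subseteq> {x}} = {}"
  proof (rule ccontr)
    assume "{e \<in> E. e \<subseteq> {x}} \<noteq> {}"
    then obtain e where e: "e \<in> E" "e \<subseteq> {x}" by blast
    then have "card e \<le> 1" using card_mono[of "{x}" e] by simp
    then show False using e2 e(1) by force
  qed
  then show ?case by (auto simp: joined_def intro!: exI[of _ "[x]"])
next
  case (snoc x p)
  then have p: "joined E (set p)" "{e \<in> E. e \<subseteq> set p} = set (pedges p)" "{x, last p} \<in> E" "x \<notin> set p" "last p \<in> set p"
    by (auto simp: pedges_snoc insert_commute)
  have s: "set (p @ [x]) = insert x (set p)" by simp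
  show ?case unfolding s using joined_insert[OF p(1,4,5,3)] edges_insert[OF p(1,4,5,3) c e2] snoc p(2)
    by (simp add: pedges_snoc)
qed

lemma boundary_edge:
  assumes "p \<noteq> []" "set (pedges p) \<subseteq> E" "hd p \<in> U" "last p \<notin> U"
  shows "\<exists>w u. w \<in> U \<and> u \<notin> U \<and> {u, w} \<in> E \<and> u \<in> set p"
  using assms
proof (induction p rule: induct_list012)
  case (3 x y p)
  show ?case
  proof (cases "y \<in> U")
    case True then show ?thesis using 3 by auto
  next
    case False then show ?thesis using 3 by (intro exI[of _ x] exI[of _ y]) (auto simp: insert_commute)
  qed
qed simp_all

lemma degree_ge3:
  assumes "finite E" "{w, x} \<in> E" "{w, y} \<in> E" "{w, u} \<in> E" "x \<noteq> y" "x \<noteq> u" "y \<noteq> u"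
  shows "3 \<le> degree E w"
proof -
  have "card {{w, x}, {w, y}, {w, u}} = 3" using assms(5-) by (simp add: doubleton_eq_iff)
  moreover have "{{w, x}, {w, y}, {w, u}} \<subseteq> incident_edges E w" using assms by (auto simp: incident_edges_def)
  moreover have "finite (incident_edges E w)" using assms(1) by (simp add: incident_edges_def)
  ultimately show ?thesis unfolding degree_def by (metis card_mono)
qed

text \<open>Together with a neighbour outside the path these two give degree at least 3; this is how
  a branching away from the centres is excluded.\<close>

lemma interior_neighbours:
  assumes "w \<in> set q" "w \<noteq> hd q" "w \<noteq> last q" "distinct q" "set (pedges q) \<subseteq> E"
  shows "\<exists>x y. x \<noteq> y \<and> x \<in> set q \<and> y \<in> set q \<and> {w, x} \<in> E \<and> {w, y} \<in> E"
proof -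
  obtain q1 q2 where q: "q = q1 @ w # q2" using assms(1) by (metis split_list)
  have n: "q1 \<noteq> []" "q2 \<noteq> []" using assms q by auto
  have "pedges q = pedges q1 @ [{last q1, w}] @ {w, hd q2} # pedges q2"
    using pedges_append[of q1 w q2] pedges_snoc[OF n(1), of w] pedges_Cons[OF n(2), of w] q by simp
  then have "{last q1, w} \<in> E" "{w, hd q2} \<in> E" using assms(5) by auto
  moreover have "last q1 \<in> set q1" "hd q2 \<in> set q2" using n by auto
  moreover have "set q1 \<inter> set q2 = {}" using assms(4) q by auto
  ultimately have "last q1 \<noteq> hd q2" "last q1 \<in> set q" "hd q2 \<in> set q" "{w, last q1} \<in> E" "{w, hd q2} \<in> E"
    using q by (auto simp: insert_commute)
  then show ?thesis by blast
qed

section \<open>Decomposition of a double spider\<close>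

text \<open>Every leg is extended by its centre, so that each edge of the tree lies on exactly one
  path.\<close>

definition paths :: "'a \<Rightarrow> 'a \<Rightarrow> 'a list \<Rightarrow> 'a list list \<Rightarrow> 'a list list \<Rightarrow> 'a list list" where
  "paths a b core LA LB = core # map (Cons a) LA @ map (Cons b) LB"

text \<open>Here a leg is the list of its vertices from the neighbour of the centre to the leaf.\<close>

definition decomposed :: "'a set set \<Rightarrow> 'a set \<Rightarrow> 'a \<Rightarrow> 'a \<Rightarrow> 'a list \<Rightarrow> 'a list list \<Rightarrow> 'a list list \<Rightarrow> bool" where
  "decomposed E U a b core LA LB \<longleftrightarrow> core \<noteq> [] \<and> hd core = a \<and> last core = b \<and> a \<noteq> b \<and>
     distinct (concat (core # LA @ LB)) \<and> set (concat (core # LA @ LB)) = U \<and> [] \<notin> set (LA @ LB) \<and>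
     {e \<in> E. e \<subseteq> U} = set (concat (map pedges (paths a b core LA LB)))"

lemma decomposed_swap:
  assumes "decomposed E U a b core LA LB"
  shows "decomposed E U b a (rev core) LB LA"
proof -
  have "mset (concat (rev core # LB @ LA)) = mset (concat (core # LA @ LB))" by simp
  then have "distinct (concat (rev core # LB @ LA)) = distinct (concat (core # LA @ LB))"
    "set (concat (rev core # LB @ LA)) = set (concat (core # LA @ LB))"
    by (rule mset_eq_imp_distinct_iff, rule mset_eq_setD)
  moreover have "set (concat (map pedges (paths b a (rev core) LB LA))) = set (concat (map pedges (paths a b core LA LB)))"
    unfolding paths_def by (simp add: set_pedges_rev Un_ac)
  ultimately show ?thesis using assms unfolding decomposed_def by (auto simp: hd_rev last_rev)
qed

lemma decomposed_paths:
  assumes "decomposed E U a b core LA LB" "q \<in> set (paths a b core LA LB)"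
  shows "set (pedges q) \<subseteq> E" "distinct q" "set q \<subseteq> U" "hd q \<in> {a, b}"
proof -
  have e: "{e \<in> E. e \<subseteq> U} = set (concat (map pedges (paths a b core LA LB)))" using assms(1) unfolding decomposed_def by blast
  have "set (pedges q) \<subseteq> set (concat (map pedges (paths a b core LA LB)))" using assms(2) by auto
  then show "set (pedges q) \<subseteq> E" unfolding e[symmetric] by blast
  have core: "core \<noteq> []" "hd core = a" "last core = b" and d: "distinct (concat (core # LA @ LB))" and U: "set (concat (core # LA @ LB)) = U"
    using assms(1) unfolding decomposed_def by blast+
  then have ab: "a \<in> set core" "b \<in> set core" by auto
  consider "q = core" | l where "l \<in> set LA" "q = a # l" | l where "l \<in> set LB" "q = b # l" using assms(2) unfolding paths_def by auto
  then have "distinct q \<and> set q \<subseteq> U \<and> hd q \<in> {a, b}"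
  proof cases
    case 1 then show ?thesis using core d U by auto
  next
    case (2 l)
    then have "distinct l" "set core \<inter> set l = {}" using d by (auto simp: distinct_concat_iff)
    then show ?thesis using 2 ab U by auto
  next
    case (3 l)
    then have "distinct l" "set core \<inter> set l = {}" using d by (auto simp: distinct_concat_iff)
    then show ?thesis using 3 ab U by auto
  qed
  then show "distinct q" "set q \<subseteq> U" "hd q \<in> {a, b}" by blast+
qed

lemma decomposed_newI:
  assumes r: "decomposed E U a b core LA LB" and u: "u \<notin> U" and e: "{e \<in> E. e \<subseteq> insert u U} = insert {w, u} {e \<in> E. e \<subseteq> U}"
    and m: "mset (concat (LA' @ LB')) = add_mset u (mset (concat (LA @ LB)))" and ne: "[] \<notin> set (LA' @ LB')"
    and p: "set (concat (map pedges (paths a b core LA' LB'))) = insert {w, u} (set (concat (map pedges (paths a b core LA LB))))"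
  shows "decomposed E (insert u U) a b core LA' LB'"
proof -
  have m': "mset (concat (core # LA' @ LB')) = mset (u # concat (core # LA @ LB))" using m by simp
  have U: "set (concat (core # LA @ LB)) = U" "distinct (concat (core # LA @ LB))" using r unfolding decomposed_def by blast+
  have "set (concat (core # LA' @ LB')) = insert u U" using mset_eq_setD[OF m'] U(1) by simp
  moreover have "distinct (concat (core # LA' @ LB'))"
    unfolding mset_eq_imp_distinct_iff[OF m'] distinct.simps(2) U(1) using U(2) u by blast
  ultimately show ?thesis using r ne unfolding decomposed_def p e by blast
qed

text \<open>The new vertex hangs either at a centre, where it starts a leg, or at the end of a leg,
  which it prolongs: at an interior vertex of a path it would produce a third vertex of degree at
  least 3.\<close>

lemma decomposed_grow:
  assumes r: "decomposed E U a b core LA LB" and j: "joined E U" and u: "u \<notin> U" "w \<in> U" "{u, w} \<in> E"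
    and c: "\<not> has_cycle E" and e2: "\<forall>e\<in>E. card e = 2" and fin: "finite E" and deg: "\<And>v. 3 \<le> degree E v \<Longrightarrow> v \<in> {a, b}"
  shows "\<exists>LA' LB'. decomposed E (insert u U) a b core LA' LB'"
proof -
  note new = decomposed_newI[OF r u(1) edges_insert[OF j u c e2]]
  have ne: "[] \<notin> set (LA @ LB)" and lc: "last core = b" and U: "set (concat (core # LA @ LB)) = U" using r unfolding decomposed_def by blast+
  show ?thesis
  proof (cases "w = a \<or> w = b")
    case True
    then show ?thesis
    proof
      assume w: "w = a"
      have "decomposed E (insert u U) a b core ([u] # LA) LB"
        by (rule new) (use ne w in \<open>auto simp: paths_def\<close>)
      then show ?thesis by blast
    next
      assume w: "w = b"
      have "decomposed E (insert u U) a b core LA ([u] # LB)"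
        by (rule new) (use ne w in \<open>auto simp: paths_def\<close>)
      then show ?thesis by blast
    qed
  next
    case w: False
    have "\<exists>q\<in>set (paths a b core LA LB). w \<in> set q" using u(2) unfolding U[symmetric] paths_def by (simp add: bex_Un) auto
    then obtain q where q: "q \<in> set (paths a b core LA LB)" "w \<in> set q" by blast
    note rq = decomposed_paths[OF r q(1)]
    have "w \<noteq> hd q" using rq(4) w by auto
    have wl: "w = last q"
    proof (rule ccontr)
      assume "w \<noteq> last q"
      then obtain x y where xy: "x \<noteq> y" "x \<in> set q" "y \<in> set q" "{w, x} \<in> E" "{w, y} \<in> E"
        using interior_neighbours[OF q(2) \<open>w \<noteq> hd q\<close> _ rq(2,1)] by blast
      have "x \<noteq> u" "y \<noteq> u" using xy rq(3) u(1) by auto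
      moreover have "{w, u} \<in> E" using u(3) by (simp add: insert_commute)
      ultimately have "3 \<le> degree E w" using degree_ge3[OF fin xy(4,5)] xy(1) by blast
      then show False using deg w by blast
    qed
    have sn: "set (pedges (x # l @ [u])) = insert {last (x # l), u} (set (pedges (x # l)))" for x l
      using pedges_snoc[of "x # l" u] by simp
    have "q \<noteq> core" using wl lc w by blast
    then consider (A) l where "l \<in> set LA" "q = a # l" | (B) l where "l \<in> set LB" "q = b # l"
      using q(1) unfolding paths_def by auto
    then show ?thesis
    proof cases
      case A
      obtain L1 L2 where L: "LA = L1 @ l # L2" using A(1) by (metis split_list)
      have "decomposed E (insert u U) a b core (L1 @ (l @ [u]) # L2) LB"
      proof (rule new)
        show "mset (concat ((L1 @ (l @ [u]) # L2) @ LB)) = add_mset u (mset (concat (LA @ LB)))" unfolding L by simp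
        show "[] \<notin> set ((L1 @ (l @ [u]) # L2) @ LB)" using ne unfolding L by simp
        show "set (concat (map pedges (paths a b core (L1 @ (l @ [u]) # L2) LB))) = insert {w, u} (set (concat (map pedges (paths a b core LA LB))))"
          unfolding L paths_def using sn[of a l] wl A(2) by (simp add: Un_ac)
      qed
      then show ?thesis by blast
    next
      case B
      obtain L1 L2 where L: "LB = L1 @ l # L2" using B(1) by (metis split_list)
      have "decomposed E (insert u U) a b core LA (L1 @ (l @ [u]) # L2)"
      proof (rule new)
        show "mset (concat (LA @ (L1 @ (l @ [u]) # L2))) = add_mset u (mset (concat (LA @ LB)))" unfolding L by simp
        show "[] \<notin> set (LA @ (L1 @ (l @ [u]) # L2))" using ne unfolding L by simp
        show "set (concat (map pedges (paths a b core LA (L1 @ (l @ [u]) # L2)))) = insert {w, u} (set (concat (map pedges (paths a b core LA LB))))"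
          unfolding L paths_def using sn[of b l] wl B(2) by (simp add: Un_ac)
      qed
      then show ?thesis by blast
    qed
  qed
qed

text \<open>Starting from the path between the centres, vertices are added across a boundary edge,
  one at a time, until \<open>U = V\<close>.\<close>

lemma decomposed_exists:
  assumes t: "is_tree V E" and ab: "a \<in> V" "b \<in> V" "a \<noteq> b" and deg: "\<And>v. 3 \<le> degree E v \<Longrightarrow> v \<in> {a, b}"
  shows "\<exists>core LA LB. decomposed E V a b core LA LB"
proof -
  have fV: "finite V" and e2: "\<forall>e\<in>E. card e = 2" and eV: "\<forall>e\<in>E. e \<subseteq> V" and conn: "connected_graph V E" and c: "\<not> has_cycle E"
    using t unfolding is_tree_def simple_graph_def by blast+
  have fE: "finite E" using fV eV by (meson Sup_least finite_UnionD finite_subset)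
  have walk: "\<exists>p. p \<noteq> [] \<and> set (pedges p) \<subseteq> E \<and> hd p = x \<and> last p = y" if "x \<in> V" "y \<in> V" for x y
    using conn that unfolding connected_graph_def is_walk_iff by blast
  have grow: "\<exists>LA LB. decomposed E V a b core LA LB"
    if "decomposed E U a b core LA LB" "joined E U" "U \<subseteq> V" for U core LA LB
    using that
  proof (induction "card (V - U)" arbitrary: U LA LB rule: less_induct)
    case less
    show ?case
    proof (cases "U = V")
      case True then show ?thesis using less.prems by blast
    next
      case False
      then obtain v where v: "v \<in> V" "v \<notin> U" using less.prems by blast
      have "a \<in> U" using less.prems(1) unfolding decomposed_def by auto
      obtain p where p: "p \<noteq> []" "set (pedges p) \<subseteq> E" "hd p = a" "last p = v" using walk[OF ab(1) v(1)] by blast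
      have pU: "hd p \<in> U" "last p \<notin> U" using p v \<open>a \<in> U\<close> by simp_all
      obtain w u where w: "w \<in> U" "u \<notin> U" "{u, w} \<in> E"
        using boundary_edge[OF p(1,2) pU] by blast
      have "{u, w} \<subseteq> V" using w(3) eV by blast
      then have uV: "u \<in> V" by blast
      obtain LA' LB' where r: "decomposed E (insert u U) a b core LA' LB'"
        using decomposed_grow[OF less.prems(1,2) w(2,1,3) c e2 fE deg] by blast
      have j: "joined E (insert u U)" by (rule joined_insert[OF less.prems(2) w(2,1,3)])
      have "card (V - insert u U) < card (V - U)"
        by (rule psubset_card_mono) (use fV uV w(2) in auto)
      moreover have "insert u U \<subseteq> V" using uV less.prems(3) by blast
      ultimately show ?thesis using less.hyps r j by blast
    qed
  qed
  obtain p where "p \<noteq> []" "set (pedges p) \<subseteq> E" "hd p = a" "last p = b" using walk[OF ab(1,2)] by blast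
  then obtain q where q: "q \<noteq> []" "set (pedges q) \<subseteq> E" "hd q = a" "last q = b" "distinct q"
    using distinct_walk by metis
  have jq: "joined E (set q)" "{e \<in> E. e \<subseteq> set q} = set (pedges q)" using joined_path[OF q(1,2,5) c e2] by blast+
  have "decomposed E (set q) a b q [] []" unfolding decomposed_def paths_def using q ab jq(2) by simp
  \<comment> \<open>A walk is only required to use edges; its interior vertices belong to
    \<open>V\<close> because they lie on an edge.\<close>
  moreover have "set q \<subseteq> V"
  proof
    fix x assume x: "x \<in> set q"
    show "x \<in> V"
    proof (cases "x = a \<or> x = b")
      case False
      then obtain y where "{x, y} \<in> E" using interior_neighbours[OF x _ _ q(5,2)] q(3,4) by blast
      then show ?thesis using eV by blast
    qed (use ab in blast)
  qed
  ultimately show ?thesis using grow[OF _ jq(1)] by blast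
qed

section \<open>Vertex sums along paths\<close>

lemma pedges_rev: "pedges (rev p) = rev (pedges p)"
proof (induction p)
  case (Cons x p)
  show ?case
  proof (cases "p = []")
    case False
    then show ?thesis using Cons by (simp add: pedges_snoc pedges_Cons last_rev insert_commute)
  qed simp
qed simp

text \<open>The contribution of one path to the vertex sum at \<open>v\<close>. As the paths are
  edge-disjoint, vertex sums are sums of these.\<close>

definition psum :: "('a set \<Rightarrow> nat) \<Rightarrow> 'a list \<Rightarrow> 'a \<Rightarrow> nat" where
  "psum f q v = (\<Sum>e\<leftarrow>pedges q. if v \<in> e then f e else 0)"

lemma psum_Cons: "p \<noteq> [] \<Longrightarrow> psum f (x # p) v = (if v = x \<or> v = hd p then f {x, hd p} else 0) + psum f p v"
  by (simp add: psum_def pedges_Cons)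

lemma psum_single [simp]: "psum f [x] v = 0"
  by (simp add: psum_def)

lemma psum_notin: "v \<notin> set q \<Longrightarrow> psum f q v = 0"
proof (induction q)
  case (Cons x q)
  then show ?case by (cases "q = []") (auto simp: psum_Cons)
qed (simp add: psum_def)

lemma psum_hd:
  assumes "distinct q" "2 \<le> length q"
  shows "psum f q (hd q) = hd (map f (pedges q))"
proof -
  obtain x y p where "q = x # y # p" using assms(2) by (metis Suc_le_length_iff numeral_2_eq_2)
  then show ?thesis using assms(1) by (simp add: psum_Cons psum_notin)
qed

lemma psum_last:
  "distinct q \<Longrightarrow> 2 \<le> length q \<Longrightarrow> psum f q (last q) = last (map f (pedges q))"
proof (induction q rule: induct_list012)
  case (3 x y p)
  show ?case
  proof (cases "p = []")
    case False
    then have l: "last p \<in> set p" by simp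
    have "last p \<noteq> x" "last p \<noteq> y" using 3(3) l by auto
    moreover have "psum f (y # p) (last p) = last (map f (pedges (y # p)))" using 3(2,3) False by (simp add: Suc_le_eq)
    moreover have "pedges (y # p) \<noteq> []" using False by (simp add: pedges_Cons)
    ultimately show ?thesis using False by (simp add: psum_Cons[of "y # p"])
  qed (use 3 in \<open>simp add: psum_Cons\<close>)
qed simp_all

lemma psum_interior: "distinct q \<Longrightarrow> map (psum f q) (butlast (tl q)) = adj (map f (pedges q))"
proof (induction q rule: induct_list012)
  case (3 x y p)
  show ?case
  proof (cases p)
    case (Cons z r)
    have IH: "map (psum f (y # p)) (butlast p) = adj (map f (pedges (y # p)))" using 3(2,3) by simp
    have "psum f (x # y # p) v = psum f (y # p) v" if "v \<in> set (butlast p)" for v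
    proof -
      have "v \<in> set p" using that by (rule in_set_butlastD)
      then show ?thesis using 3(3) by (auto simp: psum_Cons[of "y # p"])
    qed
    then have "map (psum f (x # y # p)) (butlast p) = map (psum f (y # p)) (butlast p)" by (rule map_cong[OF refl])
    then have "map (psum f (x # y # p)) (butlast p) = adj (map f (pedges (y # p)))" using IH by (rule trans)
    moreover have "psum f (x # y # p) y = f {x, y} + f {y, z}"
      using 3(3) Cons psum_notin[of y "z # r" f] by (simp add: psum_Cons)
    ultimately show ?thesis using Cons by simp
  qed simp
qed simp_all

lemma vertex_sum_paths:
  assumes "E = set (concat (map pedges Q))" "distinct (concat (map pedges Q))"
  shows "vertex_sum E f v = (\<Sum>q\<leftarrow>Q. psum f q v)"
proof -
  have fin: "finite E" using assms by simp
  have "vertex_sum E f v = (\<Sum>e\<in>E. if v \<in> e then f e else 0)"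
    unfolding vertex_sum_def incident_edges_def by (rule sum.mono_neutral_cong_left) (use fin in auto)
  also have "\<dots> = (\<Sum>e\<leftarrow>concat (map pedges Q). if v \<in> e then f e else 0)"
    unfolding assms(1) using assms(2) by (rule sum_list_distinct_conv_sum_set[symmetric])
  also have "\<dots> = (\<Sum>q\<leftarrow>Q. psum f q v)" by (induction Q) (simp_all add: psum_def)
  finally show ?thesis .
qed

lemma distinct_append3:
  "distinct (xs @ ys @ zs) \<longleftrightarrow> distinct xs \<and> distinct ys \<and> distinct zs \<and> set xs \<inter> set ys = {} \<and>
     set xs \<inter> set zs = {} \<and> set ys \<inter> set zs = {}"
  by auto

lemma distinct_leg_edges:
  assumes "distinct (concat L)" "x \<notin> set (concat L)"
  shows "distinct (concat (map (\<lambda>l. pedges (x # l)) L))"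
  using assms
proof (induction L)
  case (Cons l L)
  have "e \<notin> set (concat (map (\<lambda>l. pedges (x # l)) L))" if e: "e \<in> set (pedges (x # l))" for e
  proof
    assume "e \<in> set (concat (map (\<lambda>l. pedges (x # l)) L))"
    then obtain l' where l': "l' \<in> set L" "e \<in> set (pedges (x # l'))" by auto
    have "e \<inter> set l \<noteq> {}" using e by (rule pedges_meets_tl)
    moreover have "e \<subseteq> insert x (set l')" using pedges_subset[OF l'(2)] by simp
    moreover have "set l \<inter> set (concat L) = {}" "x \<notin> set l" using Cons.prems by auto
    moreover have "set l' \<subseteq> set (concat L)" using l'(1) by auto
    ultimately show False by blast
  qed
  moreover have "distinct (pedges (x # l))" using Cons.prems by (intro distinct_pedges) simp
  moreover have "distinct (concat (map (\<lambda>l. pedges (x # l)) L))" using Cons by simp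
  ultimately show ?case by auto
qed simp

lemma leg_edge:
  assumes "e \<in> set (concat (map (\<lambda>l. pedges (x # l)) L))"
  shows "e \<inter> set (concat L) \<noteq> {}" "e \<subseteq> insert x (set (concat L))"
proof -
  from assms obtain l where l: "l \<in> set L" "e \<in> set (pedges (x # l))" by auto
  have "set l \<subseteq> set (concat L)" using l(1) by auto
  then show "e \<inter> set (concat L) \<noteq> {}" "e \<subseteq> insert x (set (concat L))"
    using pedges_meets_tl[OF l(2)] pedges_subset[OF l(2)] by auto
qed

lemma decomposed_distinct_edges:
  assumes "decomposed E U a b core LA LB"
  shows "distinct (concat (map pedges (paths a b core LA LB)))"
proof -
  have core: "core \<noteq> []" "hd core = a" "last core = b" and d: "distinct (concat (core # LA @ LB))"
    using assms unfolding decomposed_def by blast+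
  then have ab: "a \<in> set core" "b \<in> set core" by auto
  let ?A = "concat (map (\<lambda>l. pedges (a # l)) LA)" and ?B = "concat (map (\<lambda>l. pedges (b # l)) LB)"
  have dd: "distinct core" "distinct (concat LA)" "distinct (concat LB)" "set core \<inter> set (concat LA) = {}"
    "set core \<inter> set (concat LB) = {}" "set (concat LA) \<inter> set (concat LB) = {}"
    using distinct_append3[of core "concat LA" "concat LB"] d unfolding concat.simps concat_append by blast+
  have n: "a \<notin> set (concat LA)" "a \<notin> set (concat LB)" "b \<notin> set (concat LA)" "b \<notin> set (concat LB)" using dd ab by blast+
  have "distinct ?A" by (rule distinct_leg_edges[OF dd(2) n(1)])
  moreover have "distinct ?B" by (rule distinct_leg_edges[OF dd(3) n(4)])
  moreover have "distinct (pedges core)" by (rule distinct_pedges[OF dd(1)])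
  moreover have "set (pedges core) \<inter> set ?A = {}"
  proof (rule equals0I)
    fix e assume "e \<in> set (pedges core) \<inter> set ?A"
    then have e: "e \<in> set (pedges core)" "e \<in> set ?A" by (rule IntD1, rule IntD2)
    show False using leg_edge(1)[OF e(2)] pedges_subset[OF e(1)] dd(4) by blast
  qed
  moreover have "set (pedges core) \<inter> set ?B = {}"
  proof (rule equals0I)
    fix e assume "e \<in> set (pedges core) \<inter> set ?B"
    then have e: "e \<in> set (pedges core)" "e \<in> set ?B" by (rule IntD1, rule IntD2)
    show False using leg_edge(1)[OF e(2)] pedges_subset[OF e(1)] dd(5) by blast
  qed
  moreover have "set ?A \<inter> set ?B = {}"
  proof (rule equals0I)
    fix e assume "e \<in> set ?A \<inter> set ?B"
    then have e: "e \<in> set ?A" "e \<in> set ?B" by (rule IntD1, rule IntD2)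
    show False using leg_edge(1)[OF e(2)] leg_edge(2)[OF e(1)] dd(6) n(2) by blast
  qed
  ultimately have "distinct (pedges core @ ?A @ ?B)" unfolding distinct_append3 by blast
  moreover have "concat (map pedges (paths a b core LA LB)) = pedges core @ ?A @ ?B" by (simp add: paths_def comp_def)
  ultimately show ?thesis by simp
qed

lemma leg_psum_single:
  assumes "distinct (concat L)" "l \<in> set L" "v \<in> set l" "v \<noteq> x"
  shows "(\<Sum>l\<leftarrow>L. psum f (x # l) v) = psum f (x # l) v"
  using assms
proof (induction L)
  case (Cons k L)
  have z: "(\<Sum>l\<leftarrow>L. psum f (x # l) v) = 0" if "v \<notin> set (concat L)" for L
    using that assms(4) by (induction L) (auto simp: psum_notin)
  show ?case
  proof (cases "l = k")
    case True
    then have "v \<notin> set (concat L)" using Cons.prems by auto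
    then show ?thesis using z True by simp
  next
    case False
    then have l: "l \<in> set L" using Cons.prems by simp
    then have "v \<notin> set k" using Cons.prems by auto
    then show ?thesis using Cons l by (simp add: psum_notin)
  qed
qed simp

lemma leg_psum_zero: "v \<notin> insert x (set (concat L)) \<Longrightarrow> (\<Sum>l\<leftarrow>L. psum f (x # l) v) = 0"
  by (induction L) (auto simp: psum_notin)

lemma map_butlast_cong: "(\<And>v. v \<in> set l \<Longrightarrow> g v = h v) \<Longrightarrow> map g (butlast l) = map h (butlast l)"
  by (auto dest: in_set_butlastD)

text \<open>Only the side of the first centre is treated; \<open>decomposed_swap\<close> supplies
  the other. The labelling \<open>f\<close> is left arbitrary so that the lemma also yields the
  degrees.\<close>

lemma decomposed_sums:
  assumes r: "decomposed E V a b core LA LB" and eV: "\<forall>e\<in>E. e \<subseteq> V"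
  shows "map (vertex_sum E f) (butlast (tl core)) = adj (map f (pedges core))"
    and "l \<in> set LA \<Longrightarrow> map (vertex_sum E f) (butlast l) = adj (map f (pedges (a # l)))"
    and "l \<in> set LA \<Longrightarrow> vertex_sum E f (last l) = last (map f (pedges (a # l)))"
    and "vertex_sum E f a = (\<Sum>l\<leftarrow>LA. hd (map f (pedges (a # l)))) + hd (map f (pedges core))"
proof -
  have core: "core \<noteq> []" "hd core = a" "last core = b" "a \<noteq> b" and d: "distinct (concat (core # LA @ LB))" and ne: "[] \<notin> set (LA @ LB)"
    and E: "{e \<in> E. e \<subseteq> V} = set (concat (map pedges (paths a b core LA LB)))"
    using r unfolding decomposed_def by blast+
  then have ab: "a \<in> set core" "b \<in> set core" by auto
  have E': "E = set (concat (map pedges (paths a b core LA LB)))" using E eV by blast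
  have vs: "vertex_sum E f v = psum f core v + (\<Sum>l\<leftarrow>LA. psum f (a # l) v) + (\<Sum>l\<leftarrow>LB. psum f (b # l) v)" for v
    unfolding vertex_sum_paths[OF E' decomposed_distinct_edges[OF r]] by (simp add: paths_def comp_def)
  have dd: "distinct core" "distinct (concat LA)" "distinct (concat LB)" "set core \<inter> set (concat LA) = {}"
    "set core \<inter> set (concat LB) = {}" "set (concat LA) \<inter> set (concat LB) = {}"
    using distinct_append3[of core "concat LA" "concat LB"] d unfolding concat.simps concat_append by blast+
  have n: "a \<notin> set (concat LA)" "a \<notin> set (concat LB)" "b \<notin> set (concat LA)" "b \<notin> set (concat LB)" using dd ab by blast+
  have lc: "2 \<le> length core" using core by (cases core rule: list.exhaust; cases "tl core") auto
  have "vertex_sum E f v = psum f core v" if "v \<in> set (butlast (tl core))" for v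
  proof -
    have "v \<in> set (tl core)" using that by (rule in_set_butlastD)
    then have 1: "v \<noteq> a" "v \<in> set core" using dd(1) core by (cases core; auto)+
    have "v \<noteq> b"
    proof -
      have "tl core \<noteq> []" using that by auto
      then have "tl core = butlast (tl core) @ [b]" using core(3) by (metis append_butlast_last_id last_tl)
      moreover have "distinct (tl core)" using dd(1) by (rule distinct_tl)
      ultimately have "b \<notin> set (butlast (tl core))" by (metis distinct_append disjoint_iff list.set_intros(1))
      then show ?thesis using that by blast
    qed
    then have "v \<notin> insert a (set (concat LA))" "v \<notin> insert b (set (concat LB))" using 1 dd(4,5) by blast+
    note z = this[THEN leg_psum_zero[where f = f]]
    show ?thesis unfolding vs z by simp
  qed
  then have "map (vertex_sum E f) (butlast (tl core)) = map (psum f core) (butlast (tl core))" by simp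
  then show "map (vertex_sum E f) (butlast (tl core)) = adj (map f (pedges core))" using psum_interior[OF dd(1)] by simp
  have leg: "vertex_sum E f v = psum f (a # l) v" if l: "l \<in> set LA" "v \<in> set l" for l v
  proof -
    have v: "v \<in> set (concat LA)" using l by auto
    have v2: "v \<notin> set core" "v \<notin> set (concat LB)" "v \<noteq> a" "v \<noteq> b" using v dd n by blast+
    show ?thesis unfolding vs using leg_psum_single[OF dd(2) l v2(3)] psum_notin[OF v2(1)] leg_psum_zero[of v b LB f] v2 by simp
  qed
  have ld: "distinct (a # l)" "2 \<le> length (a # l)" "l \<noteq> []" if "l \<in> set LA" for l
  proof -
    show "l \<noteq> []" using that ne by auto
    then show "2 \<le> length (a # l)" by (cases l) auto
    show "distinct (a # l)" using that dd(2) n(1) by (auto simp: distinct_concat_iff)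
  qed
  show "map (vertex_sum E f) (butlast l) = adj (map f (pedges (a # l)))" if l: "l \<in> set LA"
  proof -
    have "map (vertex_sum E f) (butlast l) = map (psum f (a # l)) (butlast l)" using leg[OF l] by (rule map_butlast_cong)
    also have "\<dots> = adj (map f (pedges (a # l)))" using psum_interior[OF ld(1)[OF l], of f] by simp
    finally show ?thesis .
  qed
  show "vertex_sum E f (last l) = last (map f (pedges (a # l)))" if l: "l \<in> set LA"
    using leg[OF l, of "last l"] psum_last[OF ld(1,2)[OF l], of f] ld(3)[OF l] by simp
  have "map (\<lambda>l. psum f (a # l) a) LA = map (\<lambda>l. hd (map f (pedges (a # l)))) LA"
  proof (rule map_cong[OF refl])
    fix l assume "l \<in> set LA"
    then show "psum f (a # l) a = hd (map f (pedges (a # l)))" using psum_hd[OF ld(1,2), of l f] by simp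
  qed
  then show "vertex_sum E f a = (\<Sum>l\<leftarrow>LA. hd (map f (pedges (a # l)))) + hd (map f (pedges core))"
  proof -
    assume m: "map (\<lambda>l. psum f (a # l) a) LA = map (\<lambda>l. hd (map f (pedges (a # l)))) LA"
    have z: "(\<Sum>l\<leftarrow>LB. psum f (b # l) a) = 0" by (rule leg_psum_zero) (use n(2) core(4) in blast)
    show ?thesis unfolding vs m z using psum_hd[OF dd(1) lc, of f] core by simp
  qed
qed

section \<open>Label functions with prescribed values\<close>

lemma ex_map_eq: "distinct xs \<Longrightarrow> length xs = length ys \<Longrightarrow> \<exists>f. map f xs = ys"
proof (induction xs ys rule: list_induct2')
  case (4 x xs y ys)
  then obtain f where "map f xs = ys" by auto
  then have "map (f(x := y)) (x # xs) = y # ys" using 4 by simp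
  then show ?case by (intro exI[of _ "f(x := y)"])
qed auto

lemma ex_map_map_eq:
  assumes "distinct (concat Xs)" "map length Xs = map length Ys"
  shows "\<exists>f. map (map f) Xs = Ys"
proof -
  have l: "length Xs = length Ys" using assms(2) by (metis length_map)
  have "length (concat Xs) = length (concat Ys)" using assms(2) by (simp add: length_concat)
  then obtain f where "map f (concat Xs) = concat Ys" using ex_map_eq[OF assms(1)] by blast
  then have c: "concat (map (map f) Xs) = concat Ys" by (simp add: map_concat)
  have "\<forall>(x, y)\<in>set (zip (map (map f) Xs) Ys). length x = length y"
    using assms(2) l by (auto simp: set_zip) (metis nth_map)
  then have "map (map f) Xs = Ys" using c l by (subst (asm) concat_eq_concat_iff) auto
  then show ?thesis by blast
qed

section \<open>Double spiders are strongly antimagic\<close>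

lemma ex_reorder: "mset (map g L) = mset ys \<Longrightarrow> \<exists>L'. mset L' = mset L \<and> map g L' = ys"
proof (induction ys arbitrary: L)
  case (Cons y ys)
  then have "y \<in> set (map g L)" by (metis list.set_intros(1) mset_eq_setD)
  then obtain x where x: "x \<in> set L" "g x = y" by auto
  then obtain L1 L2 where L: "L = L1 @ x # L2" by (metis split_list)
  have "mset (map g (L1 @ L2)) = mset ys" using Cons.prems x(2) unfolding L by simp
  then obtain L' where "mset L' = mset (L1 @ L2)" "map g L' = ys" using Cons.IH by blast
  then show ?case using x(2) L by (intro exI[of _ "x # L'"]) simp
qed simp

text \<open>\<open>antimagic_lists\<close> knows the lengths only as multisets, whereas the labels
  go onto legs in a given order. All its conditions are invariant under permuting \<open>LA\<close>
  and \<open>LB\<close>.\<close>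

lemma antimagic_lists_ordered:
  assumes "antimagic_lists (mset xs) (mset ys) s"
  obtains LA LB C m where "map length LA = xs" "map length LB = ys" "length C = s"
    "distinct (concat (C # LA @ LB))" "set (concat (C # LA @ LB)) = {1..m}"
    "distinct (concat (map adj (C # LA @ LB)))" "\<forall>xs\<in>set (LA @ LB). xs \<noteq> []"
    "\<forall>xs\<in>set (LA @ LB). hd xs < sum_list (map last LA) + hd C \<and> (\<forall>t\<in>set (concat (map adj (C # LA @ LB))). hd xs < t)"
    "\<forall>t\<in>set (concat (map adj (C # LA @ LB))). t < sum_list (map last LA) + hd C"
    "sum_list (map last LA) + hd C < sum_list (map last LB) + last C"
proof -
  obtain LA LB C m where l: "mset (map length LA) = mset xs" "mset (map length LB) = mset ys" "length C = s" and
    d: "distinct (concat (C # LA @ LB))" "set (concat (C # LA @ LB)) = {1..m}"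
    "distinct (concat (map adj (C # LA @ LB)))" "\<forall>xs\<in>set (LA @ LB). xs \<noteq> []"
    "\<forall>xs\<in>set (LA @ LB). hd xs < sum_list (map last LA) + hd C \<and> (\<forall>t\<in>set (concat (map adj (C # LA @ LB))). hd xs < t)"
    "\<forall>t\<in>set (concat (map adj (C # LA @ LB))). t < sum_list (map last LA) + hd C"
    "sum_list (map last LA) + hd C < sum_list (map last LB) + last C"
    using assms unfolding antimagic_lists_def by blast
  obtain LA' where A: "mset LA' = mset LA" "map length LA' = xs" using ex_reorder[OF l(1)] by blast
  obtain LB' where B: "mset LB' = mset LB" "map length LB' = ys" using ex_reorder[OF l(2)] by blast
  have cc: "mset (concat L) = mset (concat L')" if "mset L = mset L'" for L L' :: "nat list list"
    using that by (simp add: mset_concat) (metis mset_map sum_mset_sum_list)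
  have AB: "mset (C # LA' @ LB') = mset (C # LA @ LB)" using A B by simp
  have ABa: "mset (map adj (C # LA' @ LB')) = mset (map adj (C # LA @ LB))" unfolding mset_map AB ..
  have s: "set (LA' @ LB') = set (LA @ LB)" using A(1) B(1) by (metis mset_append mset_eq_setD)
  have sa: "sum_list (map last LA') = sum_list (map last LA)" "sum_list (map last LB') = sum_list (map last LB)"
    using A(1) B(1) by (metis mset_map sum_mset_sum_list)+
  note q = mset_eq_imp_distinct_iff[OF cc[OF AB]] mset_eq_setD[OF cc[OF AB]] mset_eq_imp_distinct_iff[OF cc[OF ABa]] mset_eq_setD[OF cc[OF ABa]]
  show ?thesis
    by (rule that[of LA' LB' C m, OF A(2) B(2) l(3), unfolded q s sa]) (rule d)+
qed

text \<open>\<open>I\<close> stands for the vertices of degree two and \<open>F\<close> for the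
  leaves. For the centres \<open>degree E a \<le> degree E b\<close> is enough, since equal degrees
  impose no order.\<close>

lemma strongly_antimagicI:
  assumes V: "V = {a, b} \<union> I \<union> F" and bij: "bij_betw f E {1..card E}"
    and ab: "vertex_sum E f a < vertex_sum E f b"
    and I: "\<And>v. v \<in> I \<Longrightarrow> vertex_sum E f v < vertex_sum E f a" "inj_on (vertex_sum E f) I"
    and F: "\<And>v. v \<in> F \<Longrightarrow> vertex_sum E f v < vertex_sum E f a" "\<And>v w. v \<in> F \<Longrightarrow> w \<in> I \<Longrightarrow> vertex_sum E f v < vertex_sum E f w"
      "inj_on (vertex_sum E f) F"
    and deg: "\<And>v. v \<in> I \<Longrightarrow> degree E v = 2" "\<And>v. v \<in> F \<Longrightarrow> degree E v = 1" "3 \<le> degree E a" "degree E a \<le> degree E b"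
  shows "strongly_antimagic V E"
proof -
  let ?p = "vertex_sum E f"
  have b: "?p v < ?p b" if "v \<in> I \<union> F" for v using that I(1) F(1) ab less_trans by blast
  have inj: "u = v" if uv: "u \<in> V" "v \<in> V" "?p u = ?p v" for u v
  proof (rule ccontr)
    assume ne: "u \<noteq> v"
    have "u = a \<or> u = b \<or> u \<in> I \<or> u \<in> F" "v = a \<or> v = b \<or> v \<in> I \<or> v \<in> F" using uv V by blast+
    then show False
      using ne uv(3) ab I(1)[of u] I(1)[of v] F(1)[of u] F(1)[of v] F(2)[of u v] F(2)[of v u] b[of u] b[of v] inj_onD[OF I(2), of u v] inj_onD[OF F(3), of u v]
      by (elim disjE) simp_all
  qed
  have mono: "?p u < ?p v" if uv: "u \<in> V" "v \<in> V" "degree E u < degree E v" for u v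
  proof -
    have "u = a \<or> u = b \<or> u \<in> I \<or> u \<in> F" "v = a \<or> v = b \<or> v \<in> I \<or> v \<in> F" using uv V by blast+
    then show ?thesis
      using uv(3) ab I(1)[of u] F(1)[of u] F(2)[of u v] b[of u] deg(1)[of u] deg(1)[of v] deg(2)[of u] deg(2)[of v] deg(3,4)
      by (elim disjE) simp_all
  qed
  show ?thesis unfolding strongly_antimagic_def strongly_antimagic_labeling_def using bij inj mono by blast
qed

lemma adj_const: "t \<in> set (adj (map (\<lambda>_. 1) xs)) \<Longrightarrow> t = 2"
  by (induction xs rule: induct_list012) auto

text \<open>Through the constant labelling 1 all degrees follow from
  \<open>decomposed_sums\<close>.\<close>

lemma degree_vertex_sum: "degree E v = vertex_sum E (\<lambda>_. 1) v"
  by (simp add: degree_def vertex_sum_def)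

lemma distinct_map_hd: "distinct (concat L) \<Longrightarrow> \<forall>xs\<in>set L. xs \<noteq> [] \<Longrightarrow> distinct (map hd L)"
proof (induction L)
  case (Cons l L)
  have "hd l \<in> set l" using Cons.prems by simp
  moreover have "hd ` set L \<subseteq> set (concat L)" using Cons.prems(2) by auto
  moreover have "set l \<inter> set (concat L) = {}" using Cons.prems by simp
  ultimately have "hd l \<notin> hd ` set L" by blast
  then show ?case using Cons by simp
qed simp

lemma decomposed_degrees:
  assumes r: "decomposed E V a b core LA LB" and eV: "\<forall>e\<in>E. e \<subseteq> V"
  shows "v \<in> set (butlast (tl core)) \<Longrightarrow> degree E v = 2"
    and "l \<in> set LA \<Longrightarrow> v \<in> set (butlast l) \<Longrightarrow> degree E v = 2"
    and "l \<in> set LA \<Longrightarrow> degree E (last l) = 1"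
    and "degree E a = length LA + 1"
proof -
  note S = decomposed_sums[OF r eV, where f = "\<lambda>_. 1"]
  have ne: "[] \<notin> set (LA @ LB)" and core: "core \<noteq> []" "hd core \<noteq> last core" using r unfolding decomposed_def by auto
  have hl: "hd (map (\<lambda>_. 1::nat) xs) = 1" "last (map (\<lambda>_. 1::nat) xs) = 1" if "xs \<noteq> []" for xs :: "'a set list"
    using that by (simp_all add: hd_map last_map)
  have pl: "pedges (x # l) \<noteq> []" if "l \<noteq> []" for x :: 'a and l using that by (simp add: pedges_Cons)
  show "degree E v = 2" if "v \<in> set (butlast (tl core))"
  proof -
    have "degree E v \<in> set (map (vertex_sum E (\<lambda>_. 1)) (butlast (tl core)))" unfolding degree_vertex_sum set_map using that by (rule imageI)
    then show ?thesis unfolding S(1) by (rule adj_const)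
  qed
  show "degree E v = 2" if "l \<in> set LA" "v \<in> set (butlast l)"
  proof -
    have "degree E v \<in> set (map (vertex_sum E (\<lambda>_. 1)) (butlast l))" unfolding degree_vertex_sum set_map using that(2) by (rule imageI)
    then show ?thesis unfolding S(2)[OF that(1)] by (rule adj_const)
  qed
  show "degree E (last l) = 1" if "l \<in> set LA"
  proof -
    have "l \<noteq> []" using that ne by auto
    then show ?thesis unfolding degree_vertex_sum S(3)[OF that] by (rule hl(2)[OF pl])
  qed
  have pc: "pedges core \<noteq> []" using core by (cases core; cases "tl core") auto
  have m: "map (\<lambda>l. hd (map (\<lambda>_. 1::nat) (pedges (a # l)))) LA = map (\<lambda>_. 1) LA"
  proof (rule map_cong[OF refl])
    fix l assume "l \<in> set LA"
    then have "l \<noteq> []" using ne by auto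
    then show "hd (map (\<lambda>_. 1::nat) (pedges (a # l))) = 1" by (rule hl(1)[OF pl])
  qed
  show "degree E a = length LA + 1" unfolding degree_vertex_sum S(4) m hl(1)[OF pc] by (simp add: sum_list_triv)
qed

lemma set_core_split:
  assumes "core \<noteq> []" "hd core \<noteq> last core"
  shows "set core = {hd core, last core} \<union> set (butlast (tl core))"
proof -
  obtain x q where c: "core = x # q" "q \<noteq> []" using assms by (cases core) (auto split: if_splits)
  then have "set q = insert (last q) (set (butlast q))" by (metis append_butlast_last_id list.simps(15) rotate1.simps(2) set_rotate1)
  then show ?thesis using c by auto
qed

lemma decomposed_labelling:
  assumes r: "decomposed E V a b core LA LB" and eV: "\<forall>e\<in>E. e \<subseteq> V" and sz: "2 \<le> length LA" "length LA \<le> length LB"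
    and antimagic_lists: "antimagic_lists (mset (map length LA)) (mset (map length LB)) (length core - 1)"
  shows "strongly_antimagic V E"
proof -
  have core: "core \<noteq> []" "hd core = a" "last core = b" "a \<noteq> b" and dV: "distinct (concat (core # LA @ LB))" and V: "set (concat (core # LA @ LB)) = V"
    and ne: "[] \<notin> set (LA @ LB)" and E: "{e \<in> E. e \<subseteq> V} = set (concat (map pedges (paths a b core LA LB)))"
    using r unfolding decomposed_def by blast+
  have E': "E = set (concat (map pedges (paths a b core LA LB)))" using E eV by blast
  note dE = decomposed_distinct_edges[OF r]
  obtain LA0 LB0 C m where l: "map length LA0 = map length LA" "map length LB0 = map length LB" "length C = length core - 1" and
    d: "distinct (concat (C # LA0 @ LB0))" "set (concat (C # LA0 @ LB0)) = {1..m}"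
    "distinct (concat (map adj (C # LA0 @ LB0)))" "\<forall>xs\<in>set (LA0 @ LB0). xs \<noteq> []"
    "\<forall>xs\<in>set (LA0 @ LB0). hd xs < sum_list (map last LA0) + hd C \<and> (\<forall>t\<in>set (concat (map adj (C # LA0 @ LB0))). hd xs < t)"
    "\<forall>t\<in>set (concat (map adj (C # LA0 @ LB0))). t < sum_list (map last LA0) + hd C"
    "sum_list (map last LA0) + hd C < sum_list (map last LB0) + last C"
    by (rule antimagic_lists_ordered[OF antimagic_lists])
  \<comment> \<open>The paths of the graph start at the centres, while the label lists of the legs
    start at the leaves; hence \<open>rev\<close>.\<close>
  have "map length (map pedges (paths a b core LA LB)) = map length (C # map rev LA0 @ map rev LB0)"
    using l by (simp add: paths_def comp_def)
  from ex_map_map_eq[OF dE this] obtain f where f: "map (map f) (map pedges (paths a b core LA LB)) = C # map rev LA0 @ map rev LB0" ..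
  have lAB: "length LA = length LA0" "length LB = length LB0" using l by (metis length_map)+
  have fC: "map f (pedges core) = C" and fA: "map (\<lambda>l. map f (pedges (a # l))) LA = map rev LA0"
    and fB: "map (\<lambda>l. map f (pedges (b # l))) LB = map rev LB0"
    using f lAB by (simp_all add: paths_def comp_def)
  let ?p = "vertex_sum E f"
  let ?IV = "butlast (tl core) @ concat (map butlast LA) @ concat (map butlast LB)"
  let ?FV = "map last LA @ map last LB"
  note S = decomposed_sums[OF r eV] and S' = decomposed_sums[OF decomposed_swap[OF r] eV]
  have mA: "map (\<lambda>l. map ?p (butlast l)) LA = map (rev \<circ> adj) LA0"
  proof -
    have "map (\<lambda>l. map ?p (butlast l)) LA = map adj (map (\<lambda>l. map f (pedges (a # l))) LA)" using S(2) by simp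
    then show ?thesis unfolding fA by (simp add: comp_def adj_rev)
  qed
  have mB: "map (\<lambda>l. map ?p (butlast l)) LB = map (rev \<circ> adj) LB0"
  proof -
    have "map (\<lambda>l. map ?p (butlast l)) LB = map adj (map (\<lambda>l. map f (pedges (b # l))) LB)" using S'(2) by simp
    then show ?thesis unfolding fB by (simp add: comp_def adj_rev)
  qed
  have cr: "mset (concat (map (rev \<circ> adj) L)) = mset (concat (map adj L))" for L :: "nat list list" by (induction L) simp_all
  have pI: "mset (map ?p ?IV) = mset (concat (map adj (C # LA0 @ LB0)))"
  proof -
    have "map ?p ?IV = adj C @ concat (map (\<lambda>l. map ?p (butlast l)) LA) @ concat (map (\<lambda>l. map ?p (butlast l)) LB)"
      using S(1)[of f] unfolding fC by (simp add: map_concat comp_def)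
    then show ?thesis unfolding mA mB by (simp add: cr)
  qed
  have pF: "map ?p ?FV = map hd (LA0 @ LB0)"
  proof -
    have "map ?p (map last LA) = map last (map (\<lambda>l. map f (pedges (a # l))) LA)" using S(3) by simp
    moreover have "map ?p (map last LB) = map last (map (\<lambda>l. map f (pedges (b # l))) LB)" using S'(3) by simp
    ultimately show ?thesis unfolding fA fB by (simp add: comp_def last_rev)
  qed
  have pa: "?p a = sum_list (map last LA0) + hd C"
  proof -
    have "map (\<lambda>l. hd (map f (pedges (a # l)))) LA = map hd (map rev LA0)" unfolding fA[symmetric] by simp
    then show ?thesis unfolding S(4) fC by (simp add: comp_def hd_rev)
  qed
  have pb: "?p b = sum_list (map last LB0) + last C"
  proof -
    have "map (\<lambda>l. hd (map f (pedges (b # l)))) LB = map hd (map rev LB0)" unfolding fB[symmetric] by simp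
    moreover have "hd (map f (pedges (rev core))) = last C" unfolding pedges_rev rev_map[symmetric] fC by (rule hd_rev)
    ultimately show ?thesis unfolding S'(4) by (simp add: comp_def hd_rev)
  qed
  have iv: "?p v \<in> set (concat (map adj (C # LA0 @ LB0)))" if "v \<in> set ?IV" for v
  proof -
    have "?p v \<in> set (map ?p ?IV)" using that by (simp only: set_map imageI)
    then show ?thesis unfolding mset_eq_setD[OF pI] .
  qed
  have fv: "\<exists>xs\<in>set (LA0 @ LB0). ?p v = hd xs" if "v \<in> set ?FV" for v
  proof -
    have "?p v \<in> set (map ?p ?FV)" using that by (simp only: set_map imageI)
    then have "?p v \<in> hd ` set (LA0 @ LB0)" unfolding pF set_map .
    then show ?thesis by (rule imageE) blast
  qed
  have dI: "inj_on ?p (set ?IV)" using d(3) unfolding mset_eq_imp_distinct_iff[OF pI, symmetric] distinct_map by blast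
  have "distinct (map hd (LA0 @ LB0))" using d(1,4) by (intro distinct_map_hd) simp_all
  then have dF: "inj_on ?p (set ?FV)" unfolding pF[symmetric] distinct_map by blast
  have ES: "map f (concat (map pedges (paths a b core LA LB))) = concat (C # map rev LA0 @ map rev LB0)"
    unfolding f[symmetric] by (rule map_concat)
  have mr: "mset (concat (C # map rev LA0 @ map rev LB0)) = mset (concat (C # LA0 @ LB0))"
  proof -
    have "mset (concat (map rev L)) = mset (concat L)" for L :: "nat list list" by (induction L) simp_all
    then show ?thesis by simp
  qed
  have bij: "bij_betw f E {1..card E}"
  proof -
    have "distinct (map f (concat (map pedges (paths a b core LA LB))))" unfolding ES mset_eq_imp_distinct_iff[OF mr] by (rule d(1))
    then have inj: "inj_on f E" unfolding E' distinct_map by blast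
    have "f ` E = set (map f (concat (map pedges (paths a b core LA LB))))" unfolding E' by (rule set_map[symmetric])
    also have "\<dots> = {1..m}" unfolding ES mset_eq_setD[OF mr] by (rule d(2))
    finally have im: "f ` E = {1..m}" .
    then have "card E = m" using card_image[OF inj] by simp
    then show ?thesis using inj im unfolding bij_betw_def by blast
  qed
  have VV: "V = {a, b} \<union> set ?IV \<union> set ?FV"
  proof -
    have leg: "set l = set (butlast l) \<union> {last l}" if "l \<noteq> []" for l :: "'a list"
      using that by (metis append_butlast_last_id empty_set list.simps(15) set_append)
    have legs: "set (concat L) = set (concat (map butlast L)) \<union> set (map last L)" if "[] \<notin> set L" for L :: "'a list list"
      using that
    proof (induction L)
      case (Cons l L)
      then have "set l = set (butlast l) \<union> {last l}" by (intro leg) auto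
      then show ?case using Cons by auto
    qed simp
    have "[] \<notin> set LA" "[] \<notin> set LB" using ne by auto
    note la = this[THEN legs]
    have sc: "set core = {a, b} \<union> set (butlast (tl core))" using set_core_split[of core] core by simp
    have "V = set core \<union> set (concat LA) \<union> set (concat LB)" unfolding V[symmetric] by auto
    also have "\<dots> = {a, b} \<union> set ?IV \<union> set ?FV" unfolding la sc set_append by blast
    finally show ?thesis .
  qed
  note dg = decomposed_degrees[OF r eV] and dg' = decomposed_degrees[OF decomposed_swap[OF r] eV]
  show ?thesis
  proof (rule strongly_antimagicI[OF VV bij])
    show "?p a < ?p b" unfolding pa pb by (rule d(7))
    show "?p v < ?p a" if "v \<in> set ?IV" for v using iv[OF that] d(6) unfolding pa by blast
    show "inj_on ?p (set ?IV)" "inj_on ?p (set ?FV)" by (fact dI, fact dF)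
    show "?p v < ?p a" if "v \<in> set ?FV" for v using fv[OF that] d(5) unfolding pa by metis
    show "?p v < ?p w" if "v \<in> set ?FV" "w \<in> set ?IV" for v w using fv[OF that(1)] iv[OF that(2)] d(5) by metis
    show "degree E v = 2" if "v \<in> set ?IV" for v using that dg(1,2) dg'(2) by auto
    show "degree E v = 1" if "v \<in> set ?FV" for v using that dg(3) dg'(3) by auto
    show "3 \<le> degree E a" "degree E a \<le> degree E b" using dg(4) dg'(4) sz by simp_all
  qed
qed

theorem theorem2:
  fixes V :: "'a set" and E :: "'a set set"
  assumes "double_spider V E"
  shows "strongly_antimagic V E"
proof -
  have t: "is_tree V E" and c: "card {v \<in> V. degree E v \<ge> 3} = 2" using assms unfolding double_spider_def by blast+
  have eV: "\<forall>e\<in>E. e \<subseteq> V" using t unfolding is_tree_def simple_graph_def by blast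
  obtain a b where ab: "{v \<in> V. degree E v \<ge> 3} = {a, b}" "a \<noteq> b" using c by (auto simp: card_2_iff)
  then have aV: "a \<in> V" "b \<in> V" "3 \<le> degree E a" "3 \<le> degree E b" by blast+
  have deg: "v \<in> {a, b}" if "3 \<le> degree E v" for v
  proof -
    have "incident_edges E v \<noteq> {}" using that unfolding degree_def by auto
    then have "v \<in> V" using eV unfolding incident_edges_def by blast
    then show ?thesis using that ab(1) by blast
  qed
  obtain core LA LB where r: "decomposed E V a b core LA LB" using decomposed_exists[OF t aV(1,2) ab(2) deg] by blast
  let ?A = "mset (map length LA)" and ?B = "mset (map length LB)" and ?s = "length core - 1"
  have core: "core \<noteq> []" "hd core \<noteq> last core" and ne: "[] \<notin> set (LA @ LB)" using r unfolding decomposed_def by blast+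
  have s: "0 < ?s" using core by (cases core; cases "tl core") auto
  have pos: "\<forall>x\<in>#?A. 0 < x" "\<forall>x\<in>#?B. 0 < x" using ne by auto
  have r': "decomposed E V b a (rev core) LB LA" by (rule decomposed_swap[OF r])
  have sz: "2 \<le> length LA" "2 \<le> length LB" using decomposed_degrees(4)[OF r eV] decomposed_degrees(4)[OF r' eV] aV by linarith+
  consider (less) "length LA < length LB" | (greater) "length LB < length LA" | (equal) "length LA = length LB" by linarith
  then have "length LA \<le> length LB \<and> antimagic_lists ?A ?B ?s \<or> length LB \<le> length LA \<and> antimagic_lists ?B ?A ?s"
  proof cases
    case less then show ?thesis using labelling_less[OF pos _ _ s] sz by simp
  next
    case greater then show ?thesis using labelling_less[OF pos(2,1) _ _ s] sz by simp
  next
    case equal then show ?thesis using labelling_eq[OF pos _ _ s] sz by simp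
  qed
  then show ?thesis
  proof
    assume "length LA \<le> length LB \<and> antimagic_lists ?A ?B ?s"
    then show ?thesis using decomposed_labelling[OF r eV sz(1)] by blast
  next
    assume "length LB \<le> length LA \<and> antimagic_lists ?B ?A ?s"
    then show ?thesis using decomposed_labelling[OF r' eV sz(2)] by simp
  qed
qed

end
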